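(* Let $m>d$ be a fixed integer. Let $\tilde\beta_n$ be an estimator of $\beta_0\in\mathbb{R}^d$, based on an i.i.d. sample $X_1,\dots,X_n$, which satisfies $$n^{1/2}(\tilde\beta_n-\beta_0)=\sqrt n\,\mathbb{P}_n\phi+o_p(1),$$ where $E[\phi\phi^T]$ is nonsingular, and let $S_n^*$ be the block jackknife matrix defined in the context. Then, as $n\to\infty$, $$n(\tilde\beta_n-\beta_0)^T[S_n^*]^{-1}(\tilde\beta_n-\beta_0)$$ converges weakly to $d(m-1)F_{d,m-d}/(m-d)$, where $F_{r,s}$ has an $F$ distribution with degrees of freedom $r$ and $s$.
   Context: $\mathbb{P}_n$ is the empirical measure of $X_1,\dots,X_n$. The estimator is a rule defined for every sample size, and $\phi$ is its (mean zero, square-integrable, $\mathbb{R}^d$-valued) influence function. Block jackknife. For each $n\ge m$, let $k_{m,n}$ be the largest integer with $mk_{m,n}\le n$, and let $N_{m,n}=mk_{m,n}$. Randomly sample $N_{m,n}$ out of the $n$ observations without replacement to obtain $X_1^*,\dots,X_{N_{m,n}}^*$. For $j=1,\dots,m$, let $\tilde\beta_{n,j}^*$ be the estimate of $\beta$ (by the same rule) based on $X_1^*,\dots,X_{N_{m,n}}^*$ after omitting $X_j^*,X_{m+j}^*,X_{2m+j}^*,\dots,X_{(k_{m,n}-1)m+j}^*$. Put $$\bar\beta_n^*=m^{-1}\sum_{j=1}^m\tilde\beta_{n,j}^*,\qquad S_n^*=(m-1)k_{m,n}\sum_{j=1}^m(\tilde\beta_{n,j}^*-\bar\beta_n^* )(\tilde\beta_{n,j}^*-\bar\beta_n^*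 )^T.$$ *)

theory Defs
  imports "HOL-Probability.Probability"
begin

definition in_probability_to_zero ::
    "'a measure \<Rightarrow> (nat \<Rightarrow> 'a \<Rightarrow> 'b::real_normed_vector) \<Rightarrow> bool" where
  "in_probability_to_zero M Z \<longleftrightarrow>
     (\<forall>\<epsilon>>0. (\<lambda>n. measure M {\<omega> \<in> space M. norm (Z n \<omega>) > \<epsilon>}) \<longlonglongrightarrow> 0)"

definition outer_product :: "real ^ 'n \<Rightarrow> real ^ 'm \<Rightarrow> real ^ 'm ^ 'n" where
  "outer_product v w = (\<chi> i j. v $ i * w $ j)"

definition chi_square_distribution :: "nat \<Rightarrow> real measure" where
  "chi_square_distribution r =
     distr (PiM {..<r} (\<lambda>_. density lborel std_normal_density)) borel (\<lambda>z. \<Sum>i<r. (z i)\<^sup>2)"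

text \<open>The law of the ratio of two independent chi-square variables, each divided by its
  degrees of freedom. It is meant for positive \<open>r\<close> and \<open>s\<close>; then the denominator is
  almost surely positive.\<close>

definition F_distribution :: "nat \<Rightarrow> nat \<Rightarrow> real measure" where
  "F_distribution r s =
     distr (chi_square_distribution r \<Otimes>\<^sub>M chi_square_distribution s) borel
       (\<lambda>(u, v). (u / real r) / (v / real s))"

definition block_size :: "nat \<Rightarrow> nat \<Rightarrow> nat" where
  "block_size m n = (GREATEST k. m * k \<le> n)"

lemma block_size_eq_div:
  assumes "m > 0"
  shows "block_size m n = n div m"
  unfolding block_size_def
proof (rule Greatest_equality)
  show "m * (n div m) \<le> n" by simp
  show "k \<le> n div m" if "m * k \<le> n" for k
    using that assms by (simp add: less_eq_div_iff_mult_less_eq mult.commute)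
qed

text \<open>The outcomes of \<open>N\<close> successive draws without replacement from the indices
  \<open>0, \<dots>, n - 1\<close>, in the order drawn.\<close>

definition ordered_draws :: "nat \<Rightarrow> nat \<Rightarrow> nat list set" where
  "ordered_draws N n = {s. length s = N \<and> distinct s \<and> set s \<subseteq> {..<n}}"

text \<open>Uniform draws, independent of the first \<open>n\<close> observations. Independence is stated
  through the generated families of events because \<open>indep_var\<close> requires both variables
  to have values in the same type.\<close>

definition random_draw_without_replacement ::
    "'a measure \<Rightarrow> 'x measure \<Rightarrow> (nat \<Rightarrow> 'a \<Rightarrow> 'x) \<Rightarrow> nat \<Rightarrow> nat \<Rightarrow> ('a \<Rightarrow> nat list) \<Rightarrow> bool" where
  "random_draw_without_replacement M P X N n s \<longleftrightarrow>
     s \<in> measurable M (count_space UNIV) \<and>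
     distr M (count_space UNIV) s = measure_pmf (pmf_of_set (ordered_draws N n)) \<and>
     prob_space.indep_set M
       {(\<lambda>\<omega>. \<lambda>i\<in>{..<n}. X i \<omega>) -` A \<inter> space M | A. A \<in> sets (PiM {..<n} (\<lambda>_. P))}
       {s -` B \<inter> space M | B. B \<in> sets (count_space UNIV)}"

text \<open>An estimator is a function of the list of observations, hence a rule for every
  sample size. Lists are indexed from 0, so the blocks are numbered \<open>0, \<dots>, m - 1\<close> and
  block \<open>j\<close> consists of the positions congruent to \<open>j\<close> modulo \<open>m\<close>.\<close>

definition jackknife_estimate ::
    "('x list \<Rightarrow> real ^ 'd) \<Rightarrow> nat \<Rightarrow> 'x list \<Rightarrow> nat \<Rightarrow> real ^ 'd" where
  "jackknife_estimate est m xs j = est (nths xs {i. i mod m \<noteq> j})"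

definition jackknife_mean :: "('x list \<Rightarrow> real ^ 'd) \<Rightarrow> nat \<Rightarrow> 'x list \<Rightarrow> real ^ 'd" where
  "jackknife_mean est m xs = (1 / real m) *\<^sub>R (\<Sum>j<m. jackknife_estimate est m xs j)"

definition jackknife_matrix ::
    "('x list \<Rightarrow> real ^ 'd) \<Rightarrow> nat \<Rightarrow> nat \<Rightarrow> 'x list \<Rightarrow> real ^ 'd ^ 'd" where
  "jackknife_matrix est m k xs =
     ((real m - 1) * real k) *\<^sub>R
       (\<Sum>j<m. outer_product (jackknife_estimate est m xs j - jackknife_mean est m xs)
                            (jackknife_estimate est m xs j - jackknife_mean est m xs))"

end

(* Write G_j for the normalized sum of phi over block j of the drawn sample. By the asymptotic
   expansion, sqrt n times the estimation error is sqrt m times the mean of the G_j, and S_n^* is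
   their scatter matrix divided by m - 1, both up to o_p(1). By the central limit theorem the G_j
   are asymptotically i.i.d. normal, so the claim reduces to Hotelling's T^2 for m normal vectors.

   The number m is not a type, so no Euclidean space carries (G_1, ..., G_m). Only the sums of the
   G_j and of the G_j G_j^T enter the statistic, and they live in a space that depends on d alone;
   their characteristic function is the m-th power of that of one block.

   For Gaussian columns Y_1, ..., Y_m, Hotelling's statistic is |Pe|^2 / |(I - P)e|^2, where e is
   the direction (1, ..., 1) in R^m and P projects onto the row space of the matrix Y. By rotation
   invariance e may be replaced by an independent Gaussian vector; given Y, numerator and
   denominator are then independent chi-square variables with d and m - d degrees of freedom. *)

theory Submission
  imports Defs
begin

section \<open>Trigonometric approximation and characteristic functions\<close>

inductive trig_poly :: "('x \<Rightarrow> real) set \<Rightarrow> ('x \<Rightarrow> real) \<Rightarrow> bool" for L where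
  cos: "l \<in> L \<Longrightarrow> trig_poly L (\<lambda>x. a * cos (l x + c))"
| add: "trig_poly L f \<Longrightarrow> trig_poly L g \<Longrightarrow> trig_poly L (\<lambda>x. f x + g x)"

text \<open>The product formula 2 cos a cos b = cos (a + b) + cos (a - b) keeps products inside the
  class; it is the reason why the phases must be closed under sums and differences.\<close>

lemma trig_poly_mult:
  assumes add: "\<And>l k. l \<in> L \<Longrightarrow> k \<in> L \<Longrightarrow> (\<lambda>x. l x + k x) \<in> L"
    and diff: "\<And>l k. l \<in> L \<Longrightarrow> k \<in> L \<Longrightarrow> (\<lambda>x. l x - k x) \<in> L"
    and "trig_poly L f" "trig_poly L g"
  shows "trig_poly L (\<lambda>x. f x * g x)"
  using assms(3)
proof induction
  case (cos l a c)
  show ?case using assms(4)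
  proof induction
    case (cos k b e)
    have "trig_poly L (\<lambda>x. a * b / 2 * cos ((l x + k x) + (c + e)) + a * b / 2 * cos ((l x - k x) + (c - e)))"
      using \<open>l \<in> L\<close> cos by (intro trig_poly.intros add diff)
    also have "(\<lambda>x. a * b / 2 * cos ((l x + k x) + (c + e)) + a * b / 2 * cos ((l x - k x) + (c - e))) =
        (\<lambda>x. a * cos (l x + c) * (b * cos (k x + e)))" (is "?l = ?r")
    proof
      fix x
      have e: "l x + k x + (c + e) = (l x + c) + (k x + e)" "l x - k x + (c - e) = (l x + c) - (k x + e)" by auto
      show "?l x = ?r x" unfolding e cos_add cos_diff by (simp add: field_simps)
    qed
    finally show ?case .
  next
    case (add g1 g2)
    then show ?case by (simp add: distrib_left trig_poly.add)
  qed
next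
  case (add f1 f2)
  then show ?case by (simp add: distrib_right trig_poly.add)
qed

lemma trig_poly_const: "(\<lambda>x. 0) \<in> L \<Longrightarrow> trig_poly L (\<lambda>x. a)"
  using trig_poly.cos[of "\<lambda>x. 0" L a 0] by simp

lemma trig_poly_sum:
  assumes "(\<lambda>x. 0) \<in> L" "\<And>i. i \<in> I \<Longrightarrow> trig_poly L (f i)"
  shows "trig_poly L (\<lambda>x. \<Sum>i\<in>I. f i x)"
  using assms(2)
  by (induction I rule: infinite_finite_induct) (auto intro: trig_poly.add trig_poly_const assms(1))

lemma trig_poly_prod:
  assumes "(\<lambda>x. 0) \<in> L"
    and "\<And>l k. l \<in> L \<Longrightarrow> k \<in> L \<Longrightarrow> (\<lambda>x. l x + k x) \<in> L"
    and "\<And>l k. l \<in> L \<Longrightarrow> k \<in> L \<Longrightarrow> (\<lambda>x. l x - k x) \<in> L"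
    and "\<And>i. i \<in> I \<Longrightarrow> trig_poly L (f i)"
  shows "trig_poly L (\<lambda>x. \<Prod>i\<in>I. f i x)"
  using assms(4)
  by (induction I rule: infinite_finite_induct)
     (auto intro: trig_poly_mult trig_poly_const assms(1-3))

lemma trig_poly_comp:
  assumes "trig_poly L f" "\<And>l. l \<in> L \<Longrightarrow> (\<lambda>x. l (h x)) \<in> K"
  shows "trig_poly K (\<lambda>x. f (h x))"
  using assms(1) by induction (auto intro: trig_poly.intros assms(2))

lemma trig_poly_measurable:
  assumes "trig_poly L f" "L \<subseteq> borel_measurable M"
  shows "f \<in> borel_measurable M"
  using assms(1)
proof induction
  case (cos l a c)
  then have [measurable]: "l \<in> borel_measurable M" using assms(2) by auto
  show ?case by measurable
qed auto

text \<open>The phases are a parameter of \<open>trig_poly\<close> because two settings occur: inner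
  products on a Euclidean space here, and linear combinations of coordinates
  (\<open>coord_phases\<close>) on the function spaces that carry product measures.\<close>

abbreviation inner_phases :: "('v::real_inner \<Rightarrow> real) set" where
  "inner_phases \<equiv> range (\<lambda>t x. t \<bullet> x)"

lemma inner_phases_zero: "(\<lambda>x. 0) \<in> inner_phases"
  by (auto intro!: image_eqI[of _ _ 0])

lemma inner_phases_add: "l \<in> inner_phases \<Longrightarrow> k \<in> inner_phases \<Longrightarrow> (\<lambda>x. l x + k x) \<in> inner_phases"
  by (auto simp flip: inner_add_left)

lemma inner_phases_diff: "l \<in> inner_phases \<Longrightarrow> k \<in> inner_phases \<Longrightarrow> (\<lambda>x. l x - k x) \<in> inner_phases"
  by (auto simp flip: inner_diff_left)

text \<open>A linear form of the substituted point is a combination of sines, and a sine is a cosine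
  shifted by pi/2. Sums and products of polynomials are then covered by the closure
  properties.\<close>

lemma trig_poly_of_sin_polynomial:
  fixes q :: "'v::euclidean_space \<Rightarrow> real"
  assumes "real_polynomial_function q"
  shows "trig_poly inner_phases (\<lambda>x::'v. q (\<Sum>b\<in>Basis. sin (a * (x \<bullet> b)) *\<^sub>R b))"
  using assms
proof induction
  case (linear f)
  interpret bounded_linear f by fact
  have "trig_poly inner_phases (\<lambda>x::'v. \<Sum>b\<in>Basis. f b * cos ((a *\<^sub>R b) \<bullet> x + (- (pi/2))))"
    by (intro trig_poly_sum inner_phases_zero trig_poly.cos rangeI)
  also have "(\<lambda>x::'v. \<Sum>b\<in>Basis. f b * cos ((a *\<^sub>R b) \<bullet> x + (- (pi/2)))) =
     (\<lambda>x. f (\<Sum>b\<in>Basis. sin (a * (x \<bullet> b)) *\<^sub>R b))"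
    by (auto simp: sum scaleR cos_diff inner_commute mult.commute)
  finally show ?case .
next
  case (mult f g)
  show ?case by (rule trig_poly_mult[OF inner_phases_add inner_phases_diff mult.IH])
qed (auto intro: trig_poly_const trig_poly.add inner_phases_zero)

text \<open>The substitution \<open>x\<^sub>b \<mapsto> sin (x\<^sub>b / R)\<close> is injective on the ball but maps the whole space
  into the compact unit box. Approximating by polynomials there keeps the trigonometric
  polynomial bounded outside the ball as well.\<close>

lemma trig_poly_approx:
  fixes f :: "'v::euclidean_space \<Rightarrow> real"
  assumes f: "continuous_on UNIV f" and B: "\<And>x. \<bar>f x\<bar> \<le> B" and R: "R > 0" and e: "e > 0"
  obtains p where "trig_poly inner_phases p" "\<And>x. norm x \<le> R \<Longrightarrow> \<bar>f x - p x\<bar> \<le> e" "\<And>x. \<bar>p x\<bar> \<le> B + e"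
proof -
  define K :: "'v set" where "K = cbox (-One) One"
  define E :: "'v \<Rightarrow> 'v" where "E x = (\<Sum>b\<in>Basis. sin (1/R * (x \<bullet> b)) *\<^sub>R b)" for x
  \<comment> \<open>\<open>F\<close> is \<open>f\<close> in the coordinates \<open>E\<close>:
    \<open>arcsin\<close> recovers x . b / R from its sine, because norm x \<le> R puts this number
    into [-1, 1], inside [-pi/2, pi/2].\<close>
  define F :: "'v \<Rightarrow> real" where "F y = f (\<Sum>b\<in>Basis. (R * arcsin (y \<bullet> b)) *\<^sub>R b)" for y
  have EK: "E x \<in> K" for x
    by (auto simp: K_def E_def mem_box inner_sum_left inner_Basis if_distrib cong: if_cong)
  have "continuous_on K (\<lambda>y. \<Sum>b\<in>Basis. (R * arcsin (y \<bullet> b)) *\<^sub>R b)"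
    by (auto intro!: continuous_intros simp: K_def mem_box)
  then have "continuous_on K F"
    unfolding F_def by (rule continuous_on_compose2[OF f]) auto
  then obtain q where q: "real_polynomial_function q" "\<And>y. y \<in> K \<Longrightarrow> \<bar>F y - q y\<bar> < e"
    using Stone_Weierstrass_real_polynomial_function[of K F e] e by (auto simp: K_def compact_cbox)
  show ?thesis
  proof
    show "trig_poly inner_phases (\<lambda>x. q (E x))"
      unfolding E_def by (rule trig_poly_of_sin_polynomial[OF q(1)])
    show "\<bar>q (E x)\<bar> \<le> B + e" for x
      using q(2)[OF EK[of x]] B[of "\<Sum>b\<in>Basis. (R * arcsin (E x \<bullet> b)) *\<^sub>R b"] by (auto simp: F_def)
    show "\<bar>f x - q (E x)\<bar> \<le> e" if x: "norm x \<le> R" for x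
    proof -
      have "R * arcsin (E x \<bullet> b) = x \<bullet> b" if b: "b \<in> Basis" for b
      proof -
        have "\<bar>x \<bullet> b\<bar> \<le> R" using Basis_le_norm[OF b, of x] x by linarith
        then have "\<bar>1/R * (x \<bullet> b)\<bar> \<le> 1" using R by (simp add: abs_mult)
        moreover have "1 \<le> pi / 2" using pi_ge_two by simp
        ultimately have "arcsin (sin (1/R * (x \<bullet> b))) = 1/R * (x \<bullet> b)"
          by (intro arcsin_sin) (simp_all only: abs_le_iff, linarith+)
        then show ?thesis using R b
          by (simp add: E_def inner_sum_left inner_Basis if_distrib cong: if_cong)
      qed
      then have "F (E x) = f x"
        by (simp add: F_def euclidean_representation cong: sum.cong)
      then show ?thesis using q(2)[OF EK[of x]] by auto
    qed
  qed
qed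

section \<open>Weak convergence and the continuity theorem\<close>

definition tight_seq :: "'a measure \<Rightarrow> (nat \<Rightarrow> 'a \<Rightarrow> 'b::real_normed_vector) \<Rightarrow> bool" where
  "tight_seq M Z \<longleftrightarrow>
     (\<forall>\<epsilon>>0. \<exists>R. \<forall>\<^sub>F n in sequentially. measure M {\<omega> \<in> space M. norm (Z n \<omega>) > R} \<le> \<epsilon>)"

text \<open>Stated with bounded continuous test functions because the main object is a pair of a
  vector and a matrix; distribution functions appear only at the end, for the real
  statistic.\<close>

definition conv_in_law ::
    "'a measure \<Rightarrow> (nat \<Rightarrow> 'a \<Rightarrow> 'v::euclidean_space) \<Rightarrow> 'v measure \<Rightarrow> bool" where
  "conv_in_law M V \<nu> \<longleftrightarrow>
     (\<forall>f :: 'v \<Rightarrow> real. continuous_on UNIV f \<and> bounded (range f) \<longrightarrow>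
        (\<lambda>n. \<integral>\<omega>. f (V n \<omega>) \<partial>M) \<longlonglongrightarrow> (\<integral>x. f x \<partial>\<nu>))"

lemma (in prob_space) integral_diff_bound:
  fixes f g :: "'a \<Rightarrow> real"
  assumes [measurable]: "f \<in> borel_measurable M" "g \<in> borel_measurable M" "A \<in> sets M"
    and f: "\<And>\<omega>. \<omega> \<in> space M \<Longrightarrow> \<bar>f \<omega>\<bar> \<le> B" and g: "\<And>\<omega>. \<omega> \<in> space M \<Longrightarrow> \<bar>g \<omega>\<bar> \<le> C"
    and e: "\<And>\<omega>. \<omega> \<in> space M - A \<Longrightarrow> \<bar>f \<omega> - g \<omega>\<bar> \<le> e" and "e \<ge> 0"
  shows "\<bar>(\<integral>\<omega>. f \<omega> \<partial>M) - (\<integral>\<omega>. g \<omega> \<partial>M)\<bar> \<le> e + (B + C) * prob A"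
proof -
  have i: "integrable M f" "integrable M g"
    by (rule integrable_const_bound[of _ B] integrable_const_bound[of _ C]; use f g in auto)+
  have "\<bar>(\<integral>\<omega>. f \<omega> \<partial>M) - (\<integral>\<omega>. g \<omega> \<partial>M)\<bar> = \<bar>\<integral>\<omega>. f \<omega> - g \<omega> \<partial>M\<bar>" using i by simp
  also have "\<dots> \<le> (\<integral>\<omega>. \<bar>f \<omega> - g \<omega>\<bar> \<partial>M)" using i by (intro integral_abs_bound)
  also have "\<dots> \<le> (\<integral>\<omega>. e + (B + C) * indicator A \<omega> \<partial>M)"
  proof (rule integral_mono)
    fix \<omega> assume w: "\<omega> \<in> space M"
    show "\<bar>f \<omega> - g \<omega>\<bar> \<le> e + (B + C) * indicator A \<omega>"
      using e[of \<omega>] f[OF w] g[OF w] w \<open>e \<ge> 0\<close> by (auto simp: indicator_def)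
  qed (use i in \<open>auto simp: less_top[symmetric]\<close>)
  also have "\<dots> = e + (B + C) * prob A"
    by (subst Bochner_Integration.integral_add) (auto simp: prob_space less_top[symmetric])
  finally show ?thesis .
qed

text \<open>\<open>cos (l + c)\<close> is the real part of \<open>cis c * cis l\<close>, so
  convergence of the characteristic functions on the phases gives every cosine term, and sums follow
  by linearity. Integrability is carried in the conclusion because additivity of the integral needs
  it during the induction.\<close>

lemma trig_poly_integral_tendsto:
  assumes M: "\<And>n. prob_space (M n)" and \<nu>: "prob_space \<nu>"
    and meas: "\<And>n l. l \<in> L \<Longrightarrow> (\<lambda>\<omega>. l (V n \<omega>)) \<in> borel_measurable (M n)" "L \<subseteq> borel_measurable \<nu>"
    and cis: "\<And>l. l \<in> L \<Longrightarrow> (\<lambda>n. \<integral>\<omega>. cis (l (V n \<omega>)) \<partial>(M n)) \<longlonglongrightarrow> (\<integral>x. cis (l x) \<partial>\<nu>)"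
    and p: "trig_poly L p"
  shows "(\<lambda>n. \<integral>\<omega>. p (V n \<omega>) \<partial>(M n)) \<longlonglongrightarrow> (\<integral>x. p x \<partial>\<nu>) \<and>
     (\<forall>n. integrable (M n) (\<lambda>\<omega>. p (V n \<omega>))) \<and> integrable \<nu> p"
  using p
proof induction
  case (cos l a c)
  have eq: "(\<integral>\<omega>. a * cos (l (W \<omega>) + c) \<partial>N) = a * Re (cis c * (\<integral>\<omega>. cis (l (W \<omega>)) \<partial>N))"
    and int: "integrable N (\<lambda>\<omega>. a * cos (l (W \<omega>) + c))"
    if N: "prob_space N" and [measurable]: "(\<lambda>\<omega>. l (W \<omega>)) \<in> borel_measurable N" for N :: "'z measure" and W
  proof -
    interpret prob_space N by fact
    have i: "integrable N (\<lambda>\<omega>. cis (l (W \<omega>)))"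
      by (rule integrable_const_bound[of _ 1]) (auto simp: cis_conv_exp)
    have "a * Re (cis c * (\<integral>\<omega>. cis (l (W \<omega>)) \<partial>N)) = a * Re (\<integral>\<omega>. cis c * cis (l (W \<omega>)) \<partial>N)" by simp
    also have "\<dots> = a * (\<integral>\<omega>. Re (cis c * cis (l (W \<omega>))) \<partial>N)" using i by (subst integral_Re) auto
    also have "\<dots> = a * (\<integral>\<omega>. cos (l (W \<omega>) + c) \<partial>N)" by (simp only: cis_mult add.commute cis.sel)
    also have "\<dots> = (\<integral>\<omega>. a * cos (l (W \<omega>) + c) \<partial>N)" by (rule integral_mult_right_zero[symmetric])
    finally show "(\<integral>\<omega>. a * cos (l (W \<omega>) + c) \<partial>N) = a * Re (cis c * (\<integral>\<omega>. cis (l (W \<omega>)) \<partial>N))" ..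
    show "integrable N (\<lambda>\<omega>. a * cos (l (W \<omega>) + c))"
      by (rule integrable_const_bound[of _ "\<bar>a\<bar>"]) (auto simp: abs_mult intro!: mult_left_le)
  qed
  have m2: "l \<in> borel_measurable \<nu>" using meas(2) cos by auto
  show ?case
    unfolding eq[OF M meas(1)[OF cos]] eq[OF \<nu>, of "\<lambda>x. x", OF m2]
    using int[OF M meas(1)[OF cos]] int[OF \<nu>, of "\<lambda>x. x", OF m2] cis[OF cos]
    by (intro conjI allI tendsto_intros)
next
  case (add f g)
  then show ?case by (auto intro!: tendsto_add)
qed

lemma (in prob_space) tail_prob_tendsto_0:
  fixes f :: "'a \<Rightarrow> 'b::real_normed_vector"
  assumes [measurable]: "f \<in> borel_measurable M"
  shows "(\<lambda>n. prob {\<omega> \<in> space M. norm (f \<omega>) > real n}) \<longlonglongrightarrow> 0"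
proof -
  have "(\<lambda>n. prob {\<omega> \<in> space M. norm (f \<omega>) > real n}) \<longlonglongrightarrow> prob (\<Inter>n. {\<omega> \<in> space M. norm (f \<omega>) > real n})"
    by (rule finite_Lim_measure_decseq) (auto simp: decseq_def)
  moreover have "(\<Inter>n. {\<omega> \<in> space M. norm (f \<omega>) > real n}) = {}"
    by (auto simp: not_less intro: less_imp_le) (meson less_asym reals_Archimedean2)
  ultimately show ?thesis by simp
qed

text \<open>On a ball that carries nearly all the mass, \<open>f\<close> is close to a trigonometric
  polynomial, whose integrals converge by assumption. Outside the ball both are bounded and the mass
  is small, by tightness for the sequence and automatically for the limit.\<close>

theorem conv_in_law_Levy:
  fixes V :: "nat \<Rightarrow> 'a \<Rightarrow> 'v::euclidean_space"
  assumes M: "prob_space M" and \<nu>: "prob_space \<nu>" and s\<nu>[measurable_cong]: "sets \<nu> = sets borel"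
    and V[measurable]: "\<And>n. V n \<in> borel_measurable M"
    and tight: "tight_seq M V"
    and cis: "\<And>t. (\<lambda>n. \<integral>\<omega>. cis (t \<bullet> V n \<omega>) \<partial>M) \<longlonglongrightarrow> (\<integral>x. cis (t \<bullet> x) \<partial>\<nu>)"
  shows "conv_in_law M V \<nu>"
  unfolding conv_in_law_def
proof (intro allI impI, elim conjE)
  fix f :: "'v \<Rightarrow> real" assume f: "continuous_on UNIV f" and "bounded (range f)"
  then obtain B where B: "B > 0" "\<And>x. \<bar>f x\<bar> \<le> B" by (auto simp: bounded_pos)
  have fm[measurable]: "f \<in> borel_measurable borel" using f by (rule borel_measurable_continuous_onI)
  interpret M: prob_space M by fact
  interpret N: prob_space \<nu> by fact
  show "(\<lambda>n. \<integral>\<omega>. f (V n \<omega>) \<partial>M) \<longlonglongrightarrow> (\<integral>x. f x \<partial>\<nu>)"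
  proof (rule LIMSEQ_I)
    fix r :: real assume r: "r > 0"
    \<comment> \<open>The budget for r: replacing \<open>f\<close> by \<open>p\<close> costs at most
      e + (2 B + e) d \<le> r/8 + r/8 under either law, and the integrals of \<open>p\<close> differ
      by less than r/4. The cap e \<le> 1 turns 2 B + e into the 2 B + 1 that defines
      \<open>d\<close>.\<close>
    define e where "e = min 1 (r/8)"
    define d where "d = r / (8 * (2 * B + 1))"
    have e: "e > 0" "e \<le> 1" "e \<le> r/8" and d: "d > 0" using r B by (auto simp: e_def d_def)
    obtain R1 where R1: "\<forall>\<^sub>F n in sequentially. measure M {\<omega> \<in> space M. norm (V n \<omega>) > R1} \<le> d"
      using tight d by (auto simp: tight_seq_def)
    have "\<forall>\<^sub>F n in sequentially. N.prob {x \<in> space \<nu>. norm x > real n} < d"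
      using order_tendstoD(2)[OF N.tail_prob_tendsto_0[of "\<lambda>x. x"] d] by simp
    then obtain R2 where R2: "N.prob {x \<in> space \<nu>. norm x > real R2} < d"
      by (auto simp: eventually_sequentially)
    define R where "R = max (max R1 (real R2)) 1"
    have R: "R > 0" "R \<ge> R1" "R \<ge> real R2" by (auto simp: R_def)
    obtain p where p: "trig_poly inner_phases p" "\<And>x. norm x \<le> R \<Longrightarrow> \<bar>f x - p x\<bar> \<le> e" "\<And>x. \<bar>p x\<bar> \<le> B + e"
      using trig_poly_approx[OF f B(2) R(1) e(1)] by blast
    have [measurable]: "p \<in> borel_measurable borel"
      by (rule trig_poly_measurable[OF p(1)]) auto
    have "(\<lambda>n. \<integral>\<omega>. p (V n \<omega>) \<partial>M) \<longlonglongrightarrow> (\<integral>x. p x \<partial>\<nu>)"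
    proof (rule conjunct1[OF trig_poly_integral_tendsto[of "\<lambda>_. M" \<nu> inner_phases V p]])
      show "inner_phases \<subseteq> borel_measurable \<nu>" by auto
    qed (use M \<nu> p(1) cis in auto)
    then have 1: "\<forall>\<^sub>F n in sequentially. \<bar>(\<integral>\<omega>. p (V n \<omega>) \<partial>M) - (\<integral>x. p x \<partial>\<nu>)\<bar> < r/4"
      using r by (auto simp: tendsto_iff dist_real_def dest!: spec[of _ "r/4"])
    have small: "e + (B + (B + e)) * q \<le> r/4" if "q \<le> d" "q \<ge> 0" for q
    proof -
      have "(B + (B + e)) * q \<le> (2 * B + 1) * d" using B e that by (intro mult_mono) auto
      also have "\<dots> = r/8" using B by (simp add: d_def divide_simps)
      finally show ?thesis using e by linarith
    qed
    have nu: "\<bar>(\<integral>x. f x \<partial>\<nu>) - (\<integral>x. p x \<partial>\<nu>)\<bar> \<le> r/4"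
    proof -
      have "N.prob {x \<in> space \<nu>. norm x > R} \<le> N.prob {x \<in> space \<nu>. norm x > real R2}"
        using R by (intro N.finite_measure_mono) auto
      moreover have "\<bar>(\<integral>x. f x \<partial>\<nu>) - (\<integral>x. p x \<partial>\<nu>)\<bar> \<le> e + (B + (B + e)) * N.prob {x \<in> space \<nu>. norm x > R}"
        using B p(2,3) e by (intro N.integral_diff_bound) (auto simp: not_less)
      ultimately show ?thesis using small[of "N.prob {x \<in> space \<nu>. norm x > R}"] R2 by auto
    qed
    have "\<forall>\<^sub>F n in sequentially. norm ((\<integral>\<omega>. f (V n \<omega>) \<partial>M) - (\<integral>x. f x \<partial>\<nu>)) < r"
      using 1 R1
    proof eventually_elim
      case (elim n)
      have "M.prob {\<omega> \<in> space M. norm (V n \<omega>) > R} \<le> M.prob {\<omega> \<in> space M. norm (V n \<omega>) > R1}"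
        using R by (intro M.finite_measure_mono) auto
      moreover have "\<bar>(\<integral>\<omega>. f (V n \<omega>) \<partial>M) - (\<integral>\<omega>. p (V n \<omega>) \<partial>M)\<bar> \<le> e + (B + (B + e)) * M.prob {\<omega> \<in> space M. norm (V n \<omega>) > R}"
        using B p(2,3) e by (intro M.integral_diff_bound) (auto simp: not_less)
      ultimately have "\<bar>(\<integral>\<omega>. f (V n \<omega>) \<partial>M) - (\<integral>\<omega>. p (V n \<omega>) \<partial>M)\<bar> \<le> r/4"
        using small[of "M.prob {\<omega> \<in> space M. norm (V n \<omega>) > R}"] elim by auto
      then show ?case using nu elim r by (auto simp: abs_if split: if_splits)
    qed
    then show "\<exists>no. \<forall>n\<ge>no. norm ((\<integral>\<omega>. f (V n \<omega>) \<partial>M) - (\<integral>x. f x \<partial>\<nu>)) < r"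
      by (auto simp: eventually_sequentially)
  qed
qed

text \<open>Continuous steps falling from 1 to 0 between a and a + 1 / (n + 1) converge pointwise to
  the indicator, and each is approximated to within 1 / (n + 1) on the ball of radius n + 1. The
  bound 2 = 1 + 1 is there for dominated convergence.\<close>

lemma half_line_trig_approx:
  obtains p :: "nat \<Rightarrow> real \<Rightarrow> real" where "\<And>n. trig_poly inner_phases (p n)" "\<And>n x. \<bar>p n x\<bar> \<le> 2"
    "\<And>x. (\<lambda>n. p n x) \<longlonglongrightarrow> indicator {..a} x"
proof -
  define f where "f n = cts_step a (a + 1 / real (Suc n))" for n
  have c: "continuous_on UNIV (f n)" for n
    unfolding f_def by (rule uniformly_continuous_imp_continuous cts_step_uniformly_continuous)+ simp
  have b: "\<bar>f n x\<bar> \<le> 1" for n x by (auto simp: f_def cts_step_def divide_simps)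
  have "\<exists>p. trig_poly inner_phases p \<and> (\<forall>x. norm x \<le> real (Suc n) \<longrightarrow> \<bar>f n x - p x\<bar> \<le> 1 / real (Suc n)) \<and>
      (\<forall>x. \<bar>p x\<bar> \<le> 1 + 1 / real (Suc n))" for n
    by (rule trig_poly_approx[OF c b, of "real (Suc n)" "1 / real (Suc n)"]) auto
  then obtain p where p: "\<And>n. trig_poly inner_phases (p n)"
    "\<And>n x. norm x \<le> real (Suc n) \<Longrightarrow> \<bar>f n x - p n x\<bar> \<le> 1 / real (Suc n)"
    "\<And>n x. \<bar>p n x\<bar> \<le> 1 + 1 / real (Suc n)" by metis
  show ?thesis
  proof
    show "trig_poly inner_phases (p n)" for n by fact
    show "\<bar>p n x\<bar> \<le> 2" for n x by (rule order.trans[OF p(3)]) simp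
    fix x
    have "\<forall>\<^sub>F n in sequentially. f n x = indicator {..a} x"
    proof (cases "x \<le> a")
      case False
      then have "\<forall>\<^sub>F n in sequentially. 1 / real (Suc n) < x - a"
        using order_tendstoD(2)[OF LIMSEQ_inverse_real_of_nat, of "x - a"] by (simp add: inverse_eq_divide)
      then show ?thesis by eventually_elim (auto simp: f_def cts_step_def)
    qed (simp add: f_def cts_step_def)
    then have 1: "(\<lambda>n. f n x) \<longlonglongrightarrow> indicator {..a} x" by (rule tendsto_eventually)
    have "(\<lambda>n. f n x - p n x) \<longlonglongrightarrow> 0"
    proof (rule Lim_null_comparison)
      show "(\<lambda>n. 1 / real (Suc n)) \<longlonglongrightarrow> 0" using LIMSEQ_inverse_real_of_nat by (simp add: inverse_eq_divide)
      show "\<forall>\<^sub>F n in sequentially. norm (f n x - p n x) \<le> 1 / real (Suc n)"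
        using eventually_ge_at_top[of "nat \<lceil>\<bar>x\<bar>\<rceil>"] by eventually_elim (use p(2) in \<open>auto simp: nat_le_iff ceiling_le_iff\<close>)
    qed
    from tendsto_diff[OF 1 this] show "(\<lambda>n. p n x) \<longlonglongrightarrow> indicator {..a} x" by simp
  qed
qed

section \<open>Laws on finite products are determined by characteristic functions\<close>

abbreviation coord_phases :: "'i set \<Rightarrow> (('i \<Rightarrow> real) \<Rightarrow> real) set" where
  "coord_phases I \<equiv> range (\<lambda>t x. \<Sum>i\<in>I. t i * x i)"

lemma coord_phases_closed:
  "(\<lambda>x. 0) \<in> coord_phases I"
  "l \<in> coord_phases I \<Longrightarrow> k \<in> coord_phases I \<Longrightarrow> (\<lambda>x. l x + k x) \<in> coord_phases I"
  "l \<in> coord_phases I \<Longrightarrow> k \<in> coord_phases I \<Longrightarrow> (\<lambda>x. l x - k x) \<in> coord_phases I"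
proof -
  show "(\<lambda>x. 0) \<in> coord_phases I" by (rule image_eqI[of _ _ "\<lambda>_. 0"]) auto
  assume "l \<in> coord_phases I" "k \<in> coord_phases I"
  then obtain s t where "l = (\<lambda>x. \<Sum>i\<in>I. s i * x i)" "k = (\<lambda>x. \<Sum>i\<in>I. t i * x i)" by auto
  then show "(\<lambda>x. l x + k x) \<in> coord_phases I" "(\<lambda>x. l x - k x) \<in> coord_phases I"
    by (auto simp: distrib_right left_diff_distrib sum.distrib sum_subtractf
        intro: image_eqI[of _ _ "\<lambda>i. s i + t i"] image_eqI[of _ _ "\<lambda>i. s i - t i"])
qed

lemma coord_phases_single:
  assumes "finite I" "i \<in> I"
  shows "(\<lambda>x. t * x i) \<in> coord_phases I"
proof -
  have "(\<lambda>x. t * x i) = (\<lambda>x. \<Sum>j\<in>I. (if j = i then t else 0) * x j)"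
    using assms by (auto simp: if_distrib[of "\<lambda>z. z * _"] cong: if_cong)
  then show ?thesis by (rule image_eqI[of _ _ "\<lambda>j. if j = i then t else 0"]) simp
qed

text \<open>Products of trigonometric polynomials in single coordinates are trigonometric
  polynomials in all coordinates, so equal characteristic functions give them equal integrals.
  Dominated convergence then passes to products of indicators. The factor \<open>UNIV\<close> is
  allowed so that some coordinates can be left free.\<close>

lemma PiM_half_lines_eq:
  assumes I: "finite I" and Q: "prob_space Q" "prob_space R"
    and sQ[measurable_cong]: "sets Q = sets (PiM I (\<lambda>_. borel :: real measure))"
    and sR[measurable_cong]: "sets R = sets (PiM I (\<lambda>_. borel :: real measure))"
    and cis: "\<And>t. (\<integral>x. cis (\<Sum>i\<in>I. t i * x i) \<partial>Q) = (\<integral>x. cis (\<Sum>i\<in>I. t i * x i) \<partial>R)"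
    and A: "\<And>i. i \<in> I \<Longrightarrow> A i \<in> insert UNIV (range atMost)"
  shows "measure Q {x \<in> space Q. \<forall>i\<in>I. x i \<in> A i} = measure R {x \<in> space R. \<forall>i\<in>I. x i \<in> A i}"
proof -
  have "\<exists>p. (\<forall>n. trig_poly inner_phases (p n)) \<and> (\<forall>n x. \<bar>p n x\<bar> \<le> 2) \<and>
    (\<forall>x. (\<lambda>n. p n x) \<longlonglongrightarrow> indicator (A i) x)" if i: "i \<in> I" for i
  proof (cases "A i = UNIV")
    case True
    then show ?thesis
      by (intro exI[of _ "\<lambda>n x. 1"]) (intro conjI allI trig_poly_const inner_phases_zero; simp add: True)
  next
    case False
    then obtain a where "A i = {..a}" using A[OF i] by auto
    then show ?thesis using half_line_trig_approx[of a] by metis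
  qed
  then obtain p where p: "\<And>i n. i \<in> I \<Longrightarrow> trig_poly inner_phases (p i n)"
    "\<And>i n x. i \<in> I \<Longrightarrow> \<bar>p i n x\<bar> \<le> 2" "\<And>i x. i \<in> I \<Longrightarrow> (\<lambda>n. p i n x) \<longlonglongrightarrow> indicator (A i) x" by metis
  have [measurable]: "p i n \<in> borel_measurable borel" if "i \<in> I" for i n
    by (rule trig_poly_measurable[OF p(1)[OF that]]) auto
  have [measurable]: "A i \<in> sets borel" if "i \<in> I" for i using A[OF that] by auto
  define q where "q n x = (\<Prod>i\<in>I. p i n (x i))" for n x
  have tq: "trig_poly (coord_phases I) (q n)" for n
    unfolding q_def
    by (intro trig_poly_prod coord_phases_closed trig_poly_comp[OF p(1)])
       (auto intro: coord_phases_single I)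
  have mL: "coord_phases I \<subseteq> borel_measurable (PiM I (\<lambda>_. borel))" by auto
  have lim: "(\<lambda>n. \<integral>x. q n x \<partial>N) \<longlonglongrightarrow> measure N {x \<in> space N. \<forall>i\<in>I. x i \<in> A i}"
    if N: "prob_space N" and sN[measurable_cong]: "sets N = sets (PiM I (\<lambda>_. borel))" for N
  proof -
    interpret prob_space N by fact
    have [measurable]: "q n \<in> borel_measurable N" for n unfolding q_def by measurable
    have "(\<lambda>n. \<integral>x. q n x \<partial>N) \<longlonglongrightarrow> (\<integral>x. (\<Prod>i\<in>I. indicator (A i) (x i)) \<partial>N)"
    proof (rule integral_dominated_convergence[of _ _ _ "\<lambda>_. 2 ^ card I"])
      show "AE x in N. (\<lambda>n. q n x) \<longlonglongrightarrow> (\<Prod>i\<in>I. indicator (A i) (x i))"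
        unfolding q_def by (intro AE_I2 tendsto_prod p(3))
      show "AE x in N. norm (q n x) \<le> 2 ^ card I" for n
      proof (rule AE_I2)
        fix x
        have "\<bar>\<Prod>i\<in>I. p i n (x i)\<bar> \<le> (\<Prod>i\<in>I. 2)"
          unfolding abs_prod by (intro prod_mono) (use p(2) in auto)
        then show "norm (q n x) \<le> 2 ^ card I" by (simp add: q_def)
      qed
    qed auto
    also have "(\<integral>x. (\<Prod>i\<in>I. indicator (A i) (x i)) \<partial>N) = (\<integral>x. indicator {x \<in> space N. \<forall>i\<in>I. x i \<in> A i} x \<partial>N :: real)"
      using I by (intro Bochner_Integration.integral_cong) (auto simp: indicator_def)
    finally show ?thesis using I by simp
  qed
  have "(\<integral>x. q n x \<partial>Q) = (\<integral>x. q n x \<partial>R)" for n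
  proof -
    \<comment> \<open>Equality of the two integrals is read off from the convergence lemma applied
      to the constant sequence \<open>Q\<close>.\<close>
    have "(\<lambda>n::nat. \<integral>x. q n' x \<partial>Q) \<longlonglongrightarrow> (\<integral>x. q n' x \<partial>R)" for n'
    proof (rule conjunct1[OF trig_poly_integral_tendsto[of "\<lambda>_. Q" R "coord_phases I" "\<lambda>_ x. x" "q n'"]])
      show "(\<lambda>n::nat. \<integral>x. cis (l x) \<partial>Q) \<longlonglongrightarrow> (\<integral>x. cis (l x) \<partial>R)" if "l \<in> coord_phases I" for l
        using that cis by auto
    qed (use Q tq mL in \<open>auto simp: measurable_cong_sets[OF sQ refl] measurable_cong_sets[OF sR refl]\<close>)
    then show ?thesis by (simp add: LIMSEQ_const_iff)
  qed
  then show ?thesis using lim[OF Q(1) sQ] lim[OF Q(2) sR] by (auto intro: LIMSEQ_unique)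
qed

text \<open>The probabilities of products of half-lines give the marginals of \<open>Q\<close>, when
  all other factors are \<open>UNIV\<close>, and the independence of its coordinates. A law with
  independent coordinates is the product of its marginals.\<close>

theorem PiM_eqI_characteristic_function:
  fixes N :: "'i \<Rightarrow> real measure"
  assumes I: "finite I" "I \<noteq> {}" and Q: "prob_space Q"
    and sQ[measurable_cong]: "sets Q = sets (PiM I (\<lambda>_. borel :: real measure))"
    and N: "\<And>i. prob_space (N i)" and sN[measurable_cong]: "\<And>i. sets (N i) = sets borel"
    and cis: "\<And>t. (\<integral>x. cis (\<Sum>i\<in>I. t i * x i) \<partial>Q) = (\<integral>x. cis (\<Sum>i\<in>I. t i * x i) \<partial>PiM I N)"
  shows "Q = PiM I N"
proof -
  interpret Q: prob_space Q by fact
  interpret R: finite_product_prob_space N I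
    by (simp add: finite_product_prob_space_def finite_product_sigma_finite_def product_prob_space_def
        product_prob_space_axioms_def finite_product_sigma_finite_axioms_def product_sigma_finite_def
        prob_space_imp_sigma_finite N I)
  have pR: "prob_space (PiM I N)" by (intro prob_space_PiM N)
  have sR: "sets (PiM I N) = sets (PiM I (\<lambda>_. borel :: real measure))"
    by (rule sets_PiM_cong) (auto simp: sN)
  have spQ: "space Q = space (PiM I N)" using sets_eq_imp_space_eq[OF sQ] sets_eq_imp_space_eq[OF sR] by simp
  have spN: "space (N i) = UNIV" for i using sets_eq_imp_space_eq[OF sN] by simp
  have eq: "Q.prob {x \<in> space Q. \<forall>i\<in>I. x i \<in> A i} = (\<Prod>i\<in>I. measure (N i) (A i))"
    if A: "\<And>i. i \<in> I \<Longrightarrow> A i \<in> insert UNIV (range atMost)" for A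
  proof -
    have "Q.prob {x \<in> space Q. \<forall>i\<in>I. x i \<in> A i} = measure (PiM I N) {x \<in> space (PiM I N). \<forall>i\<in>I. x i \<in> A i}"
      by (rule PiM_half_lines_eq[OF I(1) Q pR sQ sR cis A])
    also have "{x \<in> space (PiM I N). \<forall>i\<in>I. x i \<in> A i} = PiE I A"
      by (auto simp: space_PiM PiE_iff spN extensional_def)
    also have "measure (PiM I N) \<dots> = (\<Prod>i\<in>I. measure (N i) (A i))"
      using A by (intro R.prob_times) (fastforce simp: sN)
    finally show ?thesis .
  qed
  have marg: "Q.prob {x \<in> space Q. x j \<in> B} = measure (N j) B"
    if j: "j \<in> I" and B: "B \<in> insert UNIV (range atMost)" for j B
  proof -
    have "Q.prob {x \<in> space Q. x j \<in> B} = Q.prob {x \<in> space Q. \<forall>i\<in>I. x i \<in> (if i = j then B else UNIV)}"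
      using j by (intro arg_cong[of _ _ Q.prob]) auto
    also have "\<dots> = (\<Prod>i\<in>I. measure (N i) (if i = j then B else UNIV))" using B by (intro eq) auto
    also have "\<dots> = (\<Prod>i\<in>I. if i = j then measure (N j) B else 1)"
      using prob_space.prob_space[OF N] by (intro prod.cong) (auto simp: spN)
    also have "\<dots> = measure (N j) B" using I j by simp
    finally show ?thesis .
  qed
  have dist: "distr Q borel (\<lambda>x. x j) = N j" if j: "j \<in> I" for j
  proof (rule cdf_unique)
    have [measurable]: "(\<lambda>x. x j) \<in> borel_measurable Q" using j by measurable
    show "real_distribution (distr Q borel (\<lambda>x. x j))" by (rule Q.real_distribution_distr) fact
    show "real_distribution (N j)"
      using N[of j] sN[of j] by (simp add: real_distribution_def real_distribution_axioms_def spN)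
    show "cdf (distr Q borel (\<lambda>x. x j)) = cdf (N j)"
    proof
      fix a
      have "cdf (distr Q borel (\<lambda>x. x j)) a = Q.prob {x \<in> space Q. x j \<in> {..a}}"
        by (auto simp: cdf_def measure_distr vimage_def Int_def conj_commute)
      then show "cdf (distr Q borel (\<lambda>x. x j)) a = cdf (N j) a" using marg[OF j, of "{..a}"] by (simp add: cdf_def)
    qed
  qed
  have rv: "i \<in> I \<Longrightarrow> Q.random_variable borel (\<lambda>x. x i)" for i by measurable
  have "Q.indep_vars (\<lambda>_. borel) (\<lambda>i x. x i) I"
  proof (subst Q.indep_vars_finite[where E="\<lambda>_. insert UNIV (range atMost)", OF I(2,1)])
    show "sets (borel :: real measure) = sigma_sets (space borel) (insert UNIV (range atMost))"
    proof -
      have "sets (borel :: real measure) = sigma_sets UNIV (range atMost)"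
        by (subst borel_eq_atMost) (auto simp: sets_measure_of)
      moreover have "sigma_sets UNIV (insert UNIV (range atMost)) = sigma_sets UNIV (range (atMost :: real \<Rightarrow> _))"
        by (intro sigma_sets_eqI) (auto intro: sigma_sets_top sigma_sets.Basic)
      ultimately show ?thesis by simp
    qed
    show "Int_stable (insert UNIV (range (atMost :: real \<Rightarrow> _)))"
      by (auto simp: Int_stable_def)
    show "\<forall>A\<in>I \<rightarrow> insert UNIV (range atMost). Q.prob (\<Inter>j\<in>I. (\<lambda>x. x j) -` A j \<inter> space Q) = (\<Prod>j\<in>I. Q.prob ((\<lambda>x. x j) -` A j \<inter> space Q))"
    proof
      fix A :: "'i \<Rightarrow> real set" assume A: "A \<in> I \<rightarrow> insert UNIV (range atMost)"
      have "(\<Inter>j\<in>I. (\<lambda>x. x j) -` A j \<inter> space Q) = {x \<in> space Q. \<forall>i\<in>I. x i \<in> A i}" using I by auto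
      moreover have "(\<lambda>x. x j) -` A j \<inter> space Q = {x \<in> space Q. x j \<in> A j}" for j by auto
      ultimately show "Q.prob (\<Inter>j\<in>I. (\<lambda>x. x j) -` A j \<inter> space Q) = (\<Prod>j\<in>I. Q.prob ((\<lambda>x. x j) -` A j \<inter> space Q))"
        using eq[of A] A by (auto simp: marg Pi_iff)
    qed
  qed (auto intro: rv)
  then have "distr Q (PiM I (\<lambda>_. borel)) (\<lambda>x. \<lambda>i\<in>I. x i) = PiM I (\<lambda>i. distr Q borel (\<lambda>x. x i))"
    by (subst Q.indep_vars_iff_distr_eq_PiM'[OF I(2), symmetric]) (auto intro: rv)
  also have "\<dots> = PiM I N" by (intro PiM_cong) (auto simp: dist)
  also have "distr Q (PiM I (\<lambda>_. borel)) (\<lambda>x. \<lambda>i\<in>I. x i) = distr Q Q (\<lambda>x. x)"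
    by (intro distr_cong) (auto simp: sQ spQ space_PiM PiE_iff extensional_restrict)
  finally show ?thesis by (simp add: distr_id)
qed

section \<open>Standard Gaussian vectors\<close>

abbreviation gauss :: "'i set \<Rightarrow> ('i \<Rightarrow> real) measure" where
  "gauss I \<equiv> PiM I (\<lambda>_. std_normal_distribution)"

lemma prob_space_std_normal: "prob_space std_normal_distribution"
  by (rule prob_space_normal_density) simp

interpretation std_normal: prob_space std_normal_distribution
  by (rule prob_space_std_normal)

lemma prob_space_gauss: "prob_space (gauss I)"
  by (intro prob_space_PiM prob_space_std_normal)

lemma sets_gauss[measurable_cong]: "sets (gauss I) = sets (PiM I (\<lambda>_. borel))"
  by (intro sets_PiM_cong) auto

lemma gauss_coordinate_measurable: "i \<in> I \<Longrightarrow> (\<lambda>x. x i) \<in> borel_measurable (gauss I)"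
  by (subst measurable_cong_sets[OF sets_gauss refl]) (rule measurable_component_singleton)

interpretation gauss: product_sigma_finite "\<lambda>_. std_normal_distribution"
  by (simp add: product_sigma_finite_def prob_space_imp_sigma_finite prob_space_std_normal)

lemma cis_sum: "finite I \<Longrightarrow> cis (\<Sum>i\<in>I. f i) = (\<Prod>i\<in>I. cis (f i))"
  by (induction I rule: finite_induct) (auto simp: cis_mult[symmetric])

lemma integral_cis_gauss:
  assumes "finite I"
  shows "(\<integral>x. cis (\<Sum>i\<in>I. t i * x i) \<partial>gauss I) = complex_of_real (exp (- (\<Sum>i\<in>I. (t i)\<^sup>2) / 2))"
proof -
  have "(\<integral>x. cis (\<Sum>i\<in>I. t i * x i) \<partial>gauss I) = (\<integral>x. (\<Prod>i\<in>I. cis (t i * x i)) \<partial>gauss I)"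
    using assms by (simp add: cis_sum)
  also have "\<dots> = (\<Prod>i\<in>I. \<integral>x. cis (t i * x) \<partial>std_normal_distribution)"
  proof (rule gauss.product_integral_prod[OF assms])
    show "integrable std_normal_distribution (\<lambda>x. cis (t i * x))" for i
      by (rule std_normal.integrable_const_bound[of _ 1]) (auto simp: cis_conv_exp)
  qed
  also have "\<dots> = (\<Prod>i\<in>I. complex_of_real (exp (- (t i)\<^sup>2 / 2)))"
  proof (rule prod.cong)
    fix i
    have "(\<integral>x. cis (t i * x) \<partial>std_normal_distribution) = char std_normal_distribution (t i)"
      by (simp add: char_def cis_conv_exp)
    then show "(\<integral>x. cis (t i * x) \<partial>std_normal_distribution) = complex_of_real (exp (- (t i)\<^sup>2 / 2))"
      by (simp add: char_std_normal_distribution)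
  qed simp
  also have "\<dots> = complex_of_real (exp (\<Sum>i\<in>I. - (t i)\<^sup>2 / 2))"
    using assms by (simp only: exp_sum of_real_prod)
  finally show ?thesis by (simp add: sum_negf sum_divide_distrib)
qed

text \<open>Each \<open>u i\<close> is a vector indexed by \<open>J\<close>. For
  \<open>I = J\<close> this is an orthogonal matrix; with fewer rows it encodes a subspace together
  with an orthonormal basis.\<close>

definition ortho_rows :: "'j set \<Rightarrow> 'i set \<Rightarrow> ('i \<Rightarrow> 'j \<Rightarrow> real) \<Rightarrow> bool" where
  "ortho_rows J I u \<longleftrightarrow> (\<forall>i\<in>I. \<forall>k\<in>I. (\<Sum>j\<in>J. u i j * u k j) = (if i = k then 1 else 0))"

lemma ortho_rows_combination_norm:
  assumes "finite I" "finite J" "ortho_rows J I u"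
  shows "(\<Sum>j\<in>J. (\<Sum>i\<in>I. t i * u i j)\<^sup>2) = (\<Sum>i\<in>I. (t i)\<^sup>2)"
proof -
  have "(\<Sum>j\<in>J. (\<Sum>i\<in>I. t i * u i j)\<^sup>2) = (\<Sum>j\<in>J. \<Sum>i\<in>I. \<Sum>k\<in>I. (t i * t k) * (u i j * u k j))"
    by (simp add: power2_eq_square sum_product algebra_simps)
  also have "\<dots> = (\<Sum>i\<in>I. \<Sum>k\<in>I. (t i * t k) * (\<Sum>j\<in>J. u i j * u k j))"
    by (subst sum.swap, rule sum.cong[OF refl], subst sum.swap) (simp add: sum_distrib_left)
  also have "\<dots> = (\<Sum>i\<in>I. \<Sum>k\<in>I. (t i * t k) * (if i = k then 1 else 0))"
    using assms(3) by (intro sum.cong) (auto simp: ortho_rows_def)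
  also have "\<dots> = (\<Sum>i\<in>I. (t i)\<^sup>2)"
    using assms(1) by (simp add: power2_eq_square if_distrib cong: if_cong)
  finally show ?thesis .
qed

text \<open>The characteristic function at t depends on the length of t only, and rotating the
  vector amounts to rotating t by the transpose.\<close>

lemma gauss_rotate:
  fixes u :: "'i \<Rightarrow> 'i \<Rightarrow> real"
  assumes I: "finite I" "I \<noteq> {}" and u: "ortho_rows I I u"
  shows "distr (gauss I) (gauss I) (\<lambda>x. \<lambda>i\<in>I. \<Sum>j\<in>I. u i j * x j) = gauss I" (is "?D = _")
proof (rule PiM_eqI_characteristic_function[OF I])
  have T[measurable]: "(\<lambda>x. \<lambda>i\<in>I. \<Sum>j\<in>I. u i j * x j) \<in> measurable (gauss I) (gauss I)"
    by (subst measurable_cong_sets[OF refl sets_gauss]) measurable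
  interpret prob_space "gauss I" by (rule prob_space_gauss)
  show "prob_space ?D" by (rule prob_space_distr[OF T])
  show "sets ?D = sets (PiM I (\<lambda>_. borel))" by (simp add: sets_gauss)
  fix t :: "'i \<Rightarrow> real"
  have "(\<integral>x. cis (\<Sum>i\<in>I. t i * x i) \<partial>?D) = (\<integral>x. cis (\<Sum>j\<in>I. (\<Sum>i\<in>I. t i * u i j) * x j) \<partial>gauss I)"
  proof (subst integral_distr[OF T])
    have "(\<Sum>i\<in>I. t i * (\<lambda>i\<in>I. \<Sum>j\<in>I. u i j * x j) i) = (\<Sum>j\<in>I. (\<Sum>i\<in>I. t i * u i j) * x j)" for x
      by (simp add: sum_distrib_left sum_distrib_right mult.assoc) (rule sum.swap)
    then show "(\<integral>x. cis (\<Sum>i\<in>I. t i * (\<lambda>i\<in>I. \<Sum>j\<in>I. u i j * x j) i) \<partial>gauss I) =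
      (\<integral>x. cis (\<Sum>j\<in>I. (\<Sum>i\<in>I. t i * u i j) * x j) \<partial>gauss I)" by simp
  qed (simp add: cis_conv_exp)
  then show "(\<integral>x. cis (\<Sum>i\<in>I. t i * x i) \<partial>?D) = (\<integral>x. cis (\<Sum>i\<in>I. t i * x i) \<partial>gauss I)"
    using I by (simp add: integral_cis_gauss ortho_rows_combination_norm[OF _ _ u])
qed (auto intro: prob_space_std_normal)

text \<open>\<open>v\<close> is e_k - P e_k, where P is the orthogonal projection onto the span of
  the rows. The two claims are orthogonality of the residual and Pythagoras, since |P e_k|^2 is the
  sum of the \<open>(u i k)\<^sup>2\<close>.\<close>

lemma ortho_rows_residual:
  assumes fin: "finite I" "finite J" and u: "ortho_rows J I u" and k: "k \<in> J"
  defines "v \<equiv> \<lambda>j. (if j = k then 1 else 0) - (\<Sum>i\<in>I. u i k * u i j)"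
  shows "l \<in> I \<Longrightarrow> (\<Sum>j\<in>J. v j * u l j) = 0"
    and "(\<Sum>j\<in>J. (v j)\<^sup>2) = 1 - (\<Sum>i\<in>I. (u i k)\<^sup>2)"
proof -
  show z: "(\<Sum>j\<in>J. v j * u l j) = 0" if "l \<in> I" for l
  proof -
    have "(\<Sum>j\<in>J. v j * u l j) = u l k - (\<Sum>j\<in>J. \<Sum>i\<in>I. u i k * (u i j * u l j))"
      using fin k by (simp add: v_def left_diff_distrib sum_subtractf sum_distrib_right mult.assoc
          if_distrib[of "\<lambda>z. z * _"] cong: if_cong)
    also have "(\<Sum>j\<in>J. \<Sum>i\<in>I. u i k * (u i j * u l j)) = (\<Sum>i\<in>I. u i k * (\<Sum>j\<in>J. u i j * u l j))"
      by (subst sum.swap) (simp add: sum_distrib_left)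
    also have "\<dots> = (\<Sum>i\<in>I. u i k * (if i = l then 1 else 0))"
      using u that by (intro sum.cong) (auto simp: ortho_rows_def)
    also have "\<dots> = u l k" using fin that by (simp add: if_distrib cong: if_cong)
    finally show ?thesis by simp
  qed
  have "(\<Sum>j\<in>J. (v j)\<^sup>2) = (\<Sum>j\<in>J. v j * (if j = k then 1 else 0)) - (\<Sum>j\<in>J. v j * (\<Sum>i\<in>I. u i k * u i j))"
    by (simp add: power2_eq_square right_diff_distrib[symmetric] sum_subtractf[symmetric] v_def)
  also have "(\<Sum>j\<in>J. v j * (\<Sum>i\<in>I. u i k * u i j)) = (\<Sum>i\<in>I. u i k * (\<Sum>j\<in>J. v j * u i j))"
    by (simp add: sum_distrib_left) (subst sum.swap, simp add: algebra_simps)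
  also have "\<dots> = 0" by (simp add: z)
  also have "(\<Sum>j\<in>J. v j * (if j = k then 1 else 0)) = v k" using fin k by (simp add: if_distrib cong: if_cong)
  also have "v k = 1 - (\<Sum>i\<in>I. (u i k)\<^sup>2)" by (simp add: v_def power2_eq_square)
  finally show "(\<Sum>j\<in>J. (v j)\<^sup>2) = 1 - (\<Sum>i\<in>I. (u i k)\<^sup>2)" by simp
qed

text \<open>The summands are the diagonal entries of I - P, so this is the trace of the
  complementary projection.\<close>

lemma ortho_rows_trace:
  assumes fin: "finite I" "finite J" and u: "ortho_rows J I u"
  shows "(\<Sum>k\<in>J. 1 - (\<Sum>i\<in>I. (u i k)\<^sup>2)) = real (card J) - real (card I)"
proof -
  have "(\<Sum>k\<in>J. \<Sum>i\<in>I. (u i k)\<^sup>2) = (\<Sum>i\<in>I. \<Sum>k\<in>J. u i k * u i k)"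
    by (subst sum.swap) (simp add: power2_eq_square)
  also have "\<dots> = real (card I)" using u by (simp add: ortho_rows_def)
  finally show ?thesis by (simp add: sum_subtractf)
qed

text \<open>A new unit row exists because \<open>\<Sum>\<^sub>k \<bar>P e\<^sub>k\<bar>\<^sup>2 = card I < card J\<close> for the projection \<open>P\<close> onto the
  rows, so some basis vector \<open>e\<^sub>k\<close> is not in their span.\<close>

lemma ortho_rows_extend_one:
  assumes fin: "finite I" "finite J" and u: "ortho_rows J I u" and c: "card I < card J"
  obtains v where "(\<Sum>j\<in>J. (v j)\<^sup>2) = 1" "\<And>l. l \<in> I \<Longrightarrow> (\<Sum>j\<in>J. v j * u l j) = 0"
proof -
  have "\<exists>k\<in>J. 1 - (\<Sum>i\<in>I. (u i k)\<^sup>2) > 0"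
  proof (rule ccontr)
    assume "\<not> ?thesis"
    then have "(\<Sum>k\<in>J. 1 - (\<Sum>i\<in>I. (u i k)\<^sup>2)) \<le> 0" by (intro sum_nonpos) auto
    then show False using ortho_rows_trace[OF fin u] c by simp
  qed
  then obtain k where k: "k \<in> J" and pos: "1 - (\<Sum>i\<in>I. (u i k)\<^sup>2) > 0" by auto
  define s where "s = 1 - (\<Sum>i\<in>I. (u i k)\<^sup>2)"
  define w where "w j = (if j = k then 1 else 0) - (\<Sum>i\<in>I. u i k * u i j)" for j
  note w = ortho_rows_residual[OF fin u k, folded w_def s_def]
  show ?thesis
  proof (rule that[of "\<lambda>j. w j / sqrt s"])
    show "(\<Sum>j\<in>J. (w j / sqrt s)\<^sup>2) = 1"
      using pos by (simp add: power_divide sum_divide_distrib[symmetric] w(2) s_def)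
    show "(\<Sum>j\<in>J. w j / sqrt s * u l j) = 0" if "l \<in> I" for l
      using w(1)[OF that] by (simp add: sum_divide_distrib[symmetric])
  qed
qed

text \<open>\<open>K\<close> supplies labels for new rows. In the application the first d rows are
  given and the labels d, ..., m - 1 are free, so the result is an orthogonal m x m matrix.\<close>

lemma ortho_rows_extend:
  assumes fin: "finite K" "finite I" "finite J" and u: "ortho_rows J I u"
    and "I \<inter> K = {}" "card I + card K \<le> card J"
  shows "\<exists>u'. ortho_rows J (I \<union> K) u' \<and> (\<forall>i\<in>I. u' i = u i)"
  using fin(1) assms(5,6)
proof induction
  case empty
  then show ?case using u by auto
next
  case (insert k K)
  then obtain u' where u': "ortho_rows J (I \<union> K) u'" "\<forall>i\<in>I. u' i = u i" by auto
  have "card (I \<union> K) < card J" using insert fin by (subst card_Un_disjoint) auto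
  then obtain v where v: "(\<Sum>j\<in>J. (v j)\<^sup>2) = 1" "\<And>l. l \<in> I \<union> K \<Longrightarrow> (\<Sum>j\<in>J. v j * u' l j) = 0"
    using ortho_rows_extend_one[OF _ fin(3) u'(1)] insert fin by auto
  have k: "k \<notin> I \<union> K" using insert by auto
  have "ortho_rows J (I \<union> insert k K) (u'(k := v))"
    using u'(1) v k by (auto simp: ortho_rows_def power2_eq_square mult.commute)
  moreover have "\<forall>i\<in>I. (u'(k := v)) i = u i" using u'(2) k by auto
  ultimately show ?case by blast
qed

text \<open>For as many rows as columns the trace of I - P is 0. It is the sum of the squared
  lengths of all residuals of the basis vectors, so each residual vanishes; its entries are the
  claimed relations.\<close>

lemma ortho_rows_square_columns:
  assumes fin: "finite I" and u: "ortho_rows I I u" and "j \<in> I" "k \<in> I"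
  shows "(\<Sum>i\<in>I. u i k * u i j) = (if j = k then 1 else 0)"
proof -
  define w where "w k j = (if j = k then 1 else 0) - (\<Sum>i\<in>I. u i k * u i j)" for k j
  note w = ortho_rows_residual(2)[OF fin fin u, folded w_def]
  have "(\<Sum>k\<in>I. 1 - (\<Sum>i\<in>I. (u i k)\<^sup>2)) = 0" using ortho_rows_trace[OF fin fin u] by simp
  then have "(\<Sum>k\<in>I. \<Sum>j\<in>I. (w k j)\<^sup>2) = 0" using w by (simp cong: sum.cong)
  then have "w k j = 0" using fin assms(3,4) by (simp add: sum_nonneg_eq_0_iff sum_nonneg)
  then show ?thesis by (simp add: w_def)
qed

lemma ortho_rows_Parseval:
  assumes fin: "finite I" and u: "ortho_rows I I u"
  shows "(\<Sum>i\<in>I. (\<Sum>j\<in>I. u i j * x j)\<^sup>2) = (\<Sum>j\<in>I. (x j)\<^sup>2)"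
proof -
  have "ortho_rows I I (\<lambda>i j. u j i)"
    using ortho_rows_square_columns[OF fin u] by (auto simp: ortho_rows_def)
  from ortho_rows_combination_norm[OF fin fin this, of x] show ?thesis by (simp add: mult.commute)
qed

section \<open>Chi-square laws of projected Gaussian vectors\<close>

lemma sets_chi_square[simp, measurable_cong]: "sets (chi_square_distribution r) = sets borel"
  by (simp add: chi_square_distribution_def)

lemma distr_gauss_block_sum_squares:
  "distr (gauss {d..<m}) borel (\<lambda>y. \<Sum>i=d..<m. (y i)\<^sup>2) = chi_square_distribution (m - d)"
proof (cases "d \<le> m")
  case True
  have "gauss {..<m-d} = distr (gauss {d..<m}) (gauss {..<m-d}) (\<lambda>\<omega>. \<lambda>n\<in>{..<m-d}. \<omega> (n + d))"
    by (rule distr_PiM_reindex[symmetric]) (auto simp: prob_space_std_normal inj_on_def)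
  then have "chi_square_distribution (m - d) = distr (distr (gauss {d..<m}) (gauss {..<m-d}) (\<lambda>\<omega>. \<lambda>n\<in>{..<m-d}. \<omega> (n + d))) borel (\<lambda>z. \<Sum>i<m-d. (z i)\<^sup>2)"
    by (simp add: chi_square_distribution_def)
  also have "\<dots> = distr (gauss {d..<m}) borel ((\<lambda>z. \<Sum>i<m-d. (z i)\<^sup>2) \<circ> (\<lambda>\<omega>. \<lambda>n\<in>{..<m-d}. \<omega> (n + d)))"
  proof (rule distr_distr)
    show "(\<lambda>\<omega>. \<lambda>n\<in>{..<m-d}. \<omega> (n + d)) \<in> measurable (gauss {d..<m}) (gauss {..<m-d})"
      by (intro measurable_restrict measurable_component_singleton) auto
  qed measurable
  also have "\<dots> = distr (gauss {d..<m}) borel (\<lambda>y. \<Sum>i=d..<m. (y i)\<^sup>2)"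
  proof (rule distr_cong)
    fix y :: "nat \<Rightarrow> real"
    have "(\<Sum>i<m-d. (y (i + d))\<^sup>2) = (\<Sum>i=d..<m. (y i)\<^sup>2)"
      by (rule sum.reindex_bij_witness[of _ "\<lambda>i. i - d" "\<lambda>i. i + d"]) auto
    then show "((\<lambda>z. \<Sum>i<m-d. (z i)\<^sup>2) \<circ> (\<lambda>\<omega>. \<lambda>n\<in>{..<m-d}. \<omega> (n + d))) y = (\<Sum>i=d..<m. (y i)\<^sup>2)" by simp
  qed auto
  finally show ?thesis ..
qed (simp add: chi_square_distribution_def)

lemma distr_gauss_split_sum_squares:
  assumes "d \<le> m"
  shows "distr (gauss {..<m}) (borel \<Otimes>\<^sub>M borel) (\<lambda>y. (\<Sum>i<d. (y i)\<^sup>2, \<Sum>i=d..<m. (y i)\<^sup>2)) =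
    chi_square_distribution d \<Otimes>\<^sub>M chi_square_distribution (m - d)"
proof -
  have I: "{..<m} = {..<d} \<union> {d..<m}" "{..<d} \<inter> {d..<m} = {}" using assms by auto
  have "chi_square_distribution d \<Otimes>\<^sub>M chi_square_distribution (m - d) =
     distr (gauss {..<d}) borel (\<lambda>z. \<Sum>i<d. (z i)\<^sup>2) \<Otimes>\<^sub>M distr (gauss {d..<m}) borel (\<lambda>y. \<Sum>i=d..<m. (y i)\<^sup>2)"
    by (simp add: distr_gauss_block_sum_squares) (simp add: chi_square_distribution_def)
  also have "\<dots> = distr (gauss {..<d} \<Otimes>\<^sub>M gauss {d..<m}) (borel \<Otimes>\<^sub>M borel) (\<lambda>(x, y). (\<Sum>i<d. (x i)\<^sup>2, \<Sum>i=d..<m. (y i)\<^sup>2))"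
    by (intro pair_measure_distr prob_space_imp_sigma_finite prob_space.prob_space_distr prob_space_gauss) measurable
  also have "\<dots> = distr (gauss {..<d} \<Otimes>\<^sub>M gauss {d..<m}) (borel \<Otimes>\<^sub>M borel)
     ((\<lambda>y. (\<Sum>i<d. (y i)\<^sup>2, \<Sum>i=d..<m. (y i)\<^sup>2)) \<circ> merge {..<d} {d..<m})"
    by (intro distr_cong) (auto simp: merge_def space_pair_measure)
  also have "\<dots> = distr (distr (gauss {..<d} \<Otimes>\<^sub>M gauss {d..<m}) (gauss ({..<d} \<union> {d..<m})) (merge {..<d} {d..<m})) (borel \<Otimes>\<^sub>M borel)
     (\<lambda>y. (\<Sum>i<d. (y i)\<^sup>2, \<Sum>i=d..<m. (y i)\<^sup>2))"
    by (rule distr_distr[symmetric]) measurable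
  also have "distr (gauss {..<d} \<Otimes>\<^sub>M gauss {d..<m}) (gauss ({..<d} \<union> {d..<m})) (merge {..<d} {d..<m}) = gauss {..<m}"
    using I by (subst gauss.distr_merge) auto
  finally show ?thesis ..
qed

lemma AE_gauss_coordinate_nonzero:
  assumes "i \<in> I"
  shows "AE y in gauss I. y i \<noteq> 0"
proof -
  have "AE x in std_normal_distribution. x \<noteq> 0"
    using AE_lborel_singleton[of "0::real"] by (subst AE_density) (auto elim: AE_mp)
  with assms show ?thesis by (intro AE_PiM_component prob_space_std_normal)
qed

text \<open>Complete \<open>U\<close> to an orthogonal matrix. The rotated vector is again standard
  Gaussian, \<open>p\<close> is the sum of squares of its first d coordinates and
  \<open>q - p\<close> that of the remaining ones. The resulting law does not depend on
  \<open>U\<close>, which is what makes it usable as a conditional law.\<close>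

lemma orthonormal_projection_of_gauss:
  fixes U :: "'d::finite \<Rightarrow> nat \<Rightarrow> real"
  assumes U: "ortho_rows {..<m} UNIV U" and d: "CARD('d) < m"
  defines "p \<equiv> \<lambda>g. \<Sum>i\<in>UNIV. (\<Sum>j<m. U i j * g j)\<^sup>2" and "q \<equiv> \<lambda>g. \<Sum>j<m. (g j)\<^sup>2"
  shows "distr (gauss {..<m}) borel (\<lambda>g. p g / (q g - p g)) =
      distr (chi_square_distribution CARD('d) \<Otimes>\<^sub>M chi_square_distribution (m - CARD('d))) borel (\<lambda>(u, v). u / v)"
    and "AE g in gauss {..<m}. p g < q g"
proof -
  let ?d = "CARD('d)"
  obtain h :: "nat \<Rightarrow> 'd" where h: "bij_betw h {..<?d} UNIV"
    using ex_bij_betw_nat_finite[of "UNIV :: 'd set"] by (auto simp: atLeast0LessThan)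
  have "ortho_rows {..<m} {..<?d} (\<lambda>i. U (h i))"
    using U h by (auto simp: ortho_rows_def bij_betw_def inj_on_def)
  then have "\<exists>u'. ortho_rows {..<m} ({..<?d} \<union> {?d..<m}) u' \<and> (\<forall>i\<in>{..<?d}. u' i = U (h i))"
    using d by (intro ortho_rows_extend) auto
  then obtain u where u: "ortho_rows {..<m} ({..<?d} \<union> {?d..<m}) u" "\<And>i. i < ?d \<Longrightarrow> u i = U (h i)" by auto
  have I: "{..<m} = {..<?d} \<union> {?d..<m}" "{..<?d} \<inter> {?d..<m} = {}" using d by auto
  with u have ort: "ortho_rows {..<m} {..<m} u" by simp
  define T where "T x = (\<lambda>i\<in>{..<m}. \<Sum>j<m. u i j * x j)" for x
  have T: "T \<in> measurable (gauss {..<m}) (gauss {..<m})"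
    unfolding T_def by (subst measurable_cong_sets[OF refl sets_gauss]) measurable
  have dT: "distr (gauss {..<m}) (gauss {..<m}) T = gauss {..<m}"
    unfolding T_def using d by (intro gauss_rotate ort) auto
  have p: "p g = (\<Sum>i<?d. (T g i)\<^sup>2)" for g
  proof -
    have "p g = (\<Sum>i<?d. (\<Sum>j<m. U (h i) j * g j)\<^sup>2)"
      unfolding p_def by (rule sum.reindex_bij_betw[OF h, symmetric])
    then show ?thesis using d by (simp add: T_def u(2))
  qed
  have "q g = (\<Sum>i<m. (T g i)\<^sup>2)" for g
    using ortho_rows_Parseval[OF _ ort, of g] by (simp add: T_def q_def)
  then have q: "q g - p g = (\<Sum>i=?d..<m. (T g i)\<^sup>2)" for g
    using I by (simp add: p sum.union_disjoint)
  have R: "(\<lambda>y. (\<Sum>i<?d. (y i)\<^sup>2, \<Sum>i=?d..<m. (y i)\<^sup>2)) \<in> measurable (gauss {..<m}) (borel \<Otimes>\<^sub>M borel)"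
    using d by (intro measurable_Pair borel_measurable_sum borel_measurable_power) auto
  have D: "(\<lambda>(u, v). u / v) \<in> measurable (borel \<Otimes>\<^sub>M borel) (borel :: real measure)"
    by measurable
  have "distr (gauss {..<m}) borel (\<lambda>g. p g / (q g - p g)) =
     distr (gauss {..<m}) borel (((\<lambda>(u, v). u / v) \<circ> (\<lambda>y. (\<Sum>i<?d. (y i)\<^sup>2, \<Sum>i=?d..<m. (y i)\<^sup>2))) \<circ> T)"
    by (intro distr_cong refl, simp only: q o_def prod.case, simp only: p)
  also have "\<dots> = distr (distr (gauss {..<m}) (gauss {..<m}) T) borel ((\<lambda>(u, v). u / v) \<circ> (\<lambda>y. (\<Sum>i<?d. (y i)\<^sup>2, \<Sum>i=?d..<m. (y i)\<^sup>2)))"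
    by (rule distr_distr[OF measurable_comp[OF R D] T, symmetric])
  also have "\<dots> = distr (gauss {..<m}) borel ((\<lambda>(u, v). u / v) \<circ> (\<lambda>y. (\<Sum>i<?d. (y i)\<^sup>2, \<Sum>i=?d..<m. (y i)\<^sup>2)))"
    by (simp only: dT)
  also have "\<dots> = distr (distr (gauss {..<m}) (borel \<Otimes>\<^sub>M borel) (\<lambda>y. (\<Sum>i<?d. (y i)\<^sup>2, \<Sum>i=?d..<m. (y i)\<^sup>2))) borel (\<lambda>(u, v). u / v)"
    by (rule distr_distr[OF D R, symmetric])
  finally show "distr (gauss {..<m}) borel (\<lambda>g. p g / (q g - p g)) =
      distr (chi_square_distribution CARD('d) \<Otimes>\<^sub>M chi_square_distribution (m - CARD('d))) borel (\<lambda>(u, v). u / v)"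
    using d by (simp add: distr_gauss_split_sum_squares)
  \<comment> \<open>Coordinate \<open>?d\<close>, counted from 0, is the first one not covered by
    the rows of \<open>U\<close>; it exists because d < m, and q - p is positive wherever it is
    nonzero.\<close>
  have "AE y in distr (gauss {..<m}) (gauss {..<m}) T. y ?d \<noteq> 0"
    unfolding dT using d by (intro AE_gauss_coordinate_nonzero) auto
  then have "AE g in gauss {..<m}. T g ?d \<noteq> 0"
    using T d by (subst (asm) AE_distr_iff) auto
  then show "AE g in gauss {..<m}. p g < q g"
  proof (rule AE_mp, intro AE_I2 impI)
    fix g assume "T g ?d \<noteq> 0"
    then have "0 < (\<Sum>i=?d..<m. (T g i)\<^sup>2)" using d by (intro sum_pos2[of _ ?d]) auto
    then show "p g < q g" using q[of g] by linarith
  qed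
qed

section \<open>Quadratic forms of inverse matrices\<close>

lemma matrix_inv_mult:
  fixes A :: "real^'n^'n"
  assumes "det A \<noteq> 0"
  shows "A ** matrix_inv A = mat 1" "matrix_inv A ** A = mat 1"
proof -
  have "invertible A" using assms by (simp add: invertible_det_nz)
  then have "A ** matrix_inv A = mat 1 \<and> matrix_inv A ** A = mat 1"
    unfolding matrix_inv_def invertible_def by (rule someI_ex)
  then show "A ** matrix_inv A = mat 1" "matrix_inv A ** A = mat 1" by auto
qed

text \<open>The predicate under the choice operator is then constantly false, so all singular
  matrices share one unknown value. A single value suffices for \<open>raw_form\<close> to be
  measurable on the singular set.\<close>

lemma matrix_inv_singular:
  fixes A :: "real^'n^'n"
  assumes "det A = 0"
  shows "matrix_inv A = (SOME A'. False)"
proof -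
  have "\<not> (A ** A' = mat 1 \<and> A' ** A = mat 1)" for A'
    using assms by (metis invertible_def invertible_det_nz)
  then have "(\<lambda>A'. A ** A' = mat 1 \<and> A' ** A = mat 1) = (\<lambda>A'. False)" by blast
  then show ?thesis unfolding matrix_inv_def by simp
qed

lemma det_nz_iff_kernel:
  fixes A :: "real^'n^'n"
  shows "det A \<noteq> 0 \<longleftrightarrow> (\<forall>x. A *v x = 0 \<longrightarrow> x = 0)"
  by (simp add: invertible_det_nz[symmetric] invertible_left_inverse matrix_left_invertible_ker)

text \<open>Zero on singular matrices, where the arbitrary value of \<^const>\<open>matrix_inv\<close> would destroy the
  homogeneity of the quadratic form.\<close>

definition inv_form :: "real^'d \<Rightarrow> real^'d^'d \<Rightarrow> real" where
  "inv_form u S = (if det S = 0 then 0 else u \<bullet> (matrix_inv S *v u))"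

text \<open>The form is evaluated throughout by exhibiting a solution of \<open>S *v x = u\<close>;
  no inverse is ever computed.\<close>

lemma inv_form_eqI:
  assumes "det S \<noteq> 0" "S *v x = u"
  shows "inv_form u S = u \<bullet> x"
proof -
  have "matrix_inv S *v u = x"
    using matrix_inv_mult(2)[OF assms(1)] assms(2) by (metis matrix_vector_mul_assoc matrix_vector_mul_lid)
  then show ?thesis using assms by (simp add: inv_form_def)
qed

lemma inv_form_solution:
  fixes S :: "real^'d^'d"
  assumes "det S \<noteq> 0"
  obtains x where "S *v x = u" "inv_form u S = u \<bullet> x"
proof -
  have "S *v (matrix_inv S *v u) = u"
    using matrix_inv_mult(1)[OF assms] by (simp add: matrix_vector_mul_assoc)
  from that[OF this inv_form_eqI[OF assms this]] show ?thesis .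
qed

text \<open>Cramer's rule reduces measurability and continuity to determinants, which are
  polynomials in the entries. For singular \<open>S\<close>, division by 0 gives 0, in agreement
  with the default value of \<open>inv_form\<close>.\<close>

lemma inv_form_cramer:
  "inv_form u S = u \<bullet> (\<chi> k. det (\<chi> i j. if j = k then u $ i else S $ i $ j) / det S)"
proof (cases "det S = 0")
  case True
  then show ?thesis by (simp add: inv_form_def inner_vec_def)
next
  case False
  have "S *v (\<chi> k. det (\<chi> i j. if j = k then u $ i else S $ i $ j) / det S) = u"
    using cramer[OF False, of "\<chi> k. det (\<chi> i j. if j = k then u $ i else S $ i $ j) / det S" u] by simp
  from inv_form_eqI[OF False this] show ?thesis .
qed

lemma det_measurable[measurable]:
  assumes "\<And>i j. (\<lambda>x. A x $ i $ j) \<in> borel_measurable M"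
  shows "(\<lambda>x. det (A x :: real^'n^'n)) \<in> borel_measurable M"
  unfolding det_def using assms by (intro borel_measurable_sum borel_measurable_times borel_measurable_prod) auto

lemma borel_measurable_vecI:
  fixes f :: "'a \<Rightarrow> 'b::euclidean_space^'n"
  assumes "\<And>i. (\<lambda>x. f x $ i) \<in> borel_measurable M"
  shows "f \<in> borel_measurable M"
  by (subst borel_measurable_euclidean_space)
     (auto simp: Basis_vec_def inner_axis intro!: borel_measurable_inner assms)

lemma vec_nth_measurable[measurable]: "(\<lambda>x :: real^'n. x $ i) \<in> borel_measurable borel"
  by (intro borel_measurable_continuous_onI continuous_intros)

lemma mat_nth_measurable[measurable]: "(\<lambda>x :: real^'n^'m. x $ i $ j) \<in> borel_measurable borel"
  by (intro borel_measurable_continuous_onI continuous_intros)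

lemma inv_form_measurable:
  fixes u :: "'a \<Rightarrow> real^'d"
  assumes [measurable]: "u \<in> borel_measurable M" "S \<in> borel_measurable M"
  shows "(\<lambda>x. inv_form (u x) (S x)) \<in> borel_measurable M"
proof -
  have 1[measurable]: "(\<lambda>x. S x $ i $ j) \<in> borel_measurable M" for i j
    using measurable_compose[OF assms(2) mat_nth_measurable] .
  have 2[measurable]: "(\<lambda>x. u x $ i) \<in> borel_measurable M" for i
    using measurable_compose[OF assms(1) vec_nth_measurable] .
  have 3: "(\<lambda>x. det (\<chi> i j. if j = k then u x $ i else S x $ i $ j)) \<in> borel_measurable M" for k
    by (rule det_measurable) simp
  have 4: "(\<lambda>x. det (S x)) \<in> borel_measurable M"
    by (rule det_measurable) simp
  show ?thesis
    unfolding inv_form_cramer inner_vec_def using 3 4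
    by (intro borel_measurable_sum) (simp add: inner_real_def 2)
qed

lemma continuous_on_det:
  assumes "\<And>i j. continuous_on T (\<lambda>x. A x $ i $ j)"
  shows "continuous_on T (\<lambda>x. det (A x :: real^'n^'n))"
  unfolding det_def using assms by (intro continuous_on_sum continuous_on_mult continuous_on_prod continuous_on_const) auto

lemma continuous_on_inv_form:
  fixes u :: "'a::topological_space \<Rightarrow> real^'d"
  assumes u: "continuous_on T u" and S: "continuous_on T S" and nz: "\<And>x. x \<in> T \<Longrightarrow> det (S x) \<noteq> 0"
  shows "continuous_on T (\<lambda>x. inv_form (u x) (S x))"
proof -
  have 1: "continuous_on T (\<lambda>x. S x $ i $ j)" for i j
    using S by (intro continuous_on_component)
  have 2: "continuous_on T (\<lambda>x. det (\<chi> i j. if j = k then u x $ i else S x $ i $ j))" for k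
  proof (rule continuous_on_det)
    fix i j
    show "continuous_on T (\<lambda>x. (\<chi> i j. if j = k then u x $ i else S x $ i $ j) $ i $ j)"
      using 1 u by (cases "j = k") (auto intro: continuous_on_component)
  qed
  have 3: "continuous_on T (\<lambda>x. det (S x))" by (rule continuous_on_det) (rule 1)
  show ?thesis
    unfolding inv_form_cramer inner_vec_def
    using 2 3 nz u by (auto intro!: continuous_intros)
qed

lemma outer_product_mult_vec: "outer_product v w *v x = (w \<bullet> x) *\<^sub>R v"
  by (simp add: vec_eq_iff outer_product_def matrix_vector_mult_def inner_vec_def sum_distrib_left ac_simps)

lemma sum_matrix_vector_mult:
  fixes A :: "'i \<Rightarrow> real^'n^'m"
  shows "(\<Sum>i\<in>I. A i) *v x = (\<Sum>i\<in>I. A i *v x)"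
  by (induction I rule: infinite_finite_induct) (auto simp: matrix_vector_mult_add_rdistrib)

lemma matrix_vector_mult_sum:
  fixes A :: "real^'n^'m"
  shows "A *v (\<Sum>i\<in>I. f i) = (\<Sum>i\<in>I. A *v f i)"
  by (rule linear_sum) simp

text \<open>Gram--Schmidt for the inner product \<open>x \<bullet> (S *v y)\<close>.\<close>

lemma whitening_basis:
  fixes S :: "real^'d^'d"
  assumes sym: "\<And>x y. x \<bullet> (S *v y) = y \<bullet> (S *v x)" and pos: "\<And>x. x \<noteq> 0 \<Longrightarrow> x \<bullet> (S *v x) > 0"
  shows "\<exists>w :: 'd \<Rightarrow> real^'d. (\<forall>i k. w i \<bullet> (S *v w k) = (if i = k then 1 else 0)) \<and>
    (\<forall>z. (\<forall>k. w k \<bullet> z = 0) \<longrightarrow> z = 0) \<and> (\<forall>z. (\<Sum>k\<in>UNIV. (w k \<bullet> (S *v z)) *\<^sub>R w k) = z)"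
proof -
  define ok where "ok I w \<longleftrightarrow> (\<forall>i\<in>I. \<forall>k\<in>I. w i \<bullet> (S *v w k) = (if i = k then 1 else 0))"
    for I and w :: "'d \<Rightarrow> real^'d"
  have proj: "w l \<bullet> (S *v (z - (\<Sum>i\<in>I. (w i \<bullet> (S *v z)) *\<^sub>R w i))) = 0" if "ok I w" "l \<in> I" "finite I" for I w l z
  proof -
    have "w l \<bullet> (S *v (\<Sum>i\<in>I. (w i \<bullet> (S *v z)) *\<^sub>R w i)) = (\<Sum>i\<in>I. (w i \<bullet> (S *v z)) * (w l \<bullet> (S *v w i)))"
      by (simp add: matrix_vector_mult_sum inner_sum_right matrix_vector_mult_scaleR)
    also have "\<dots> = (\<Sum>i\<in>I. (w i \<bullet> (S *v z)) * (if l = i then 1 else 0))"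
      using that by (intro sum.cong) (auto simp: ok_def)
    also have "\<dots> = w l \<bullet> (S *v z)" using that by (simp add: if_distrib cong: if_cong)
    finally show ?thesis by (simp add: matrix_vector_mult_diff_distrib inner_diff_right)
  qed
  have "\<exists>w. ok I w" if "finite I" for I
    using that
  proof induction
    case empty
    then show ?case by (simp add: ok_def)
  next
    case (insert k I)
    then obtain w where w: "ok I w" by auto
    \<comment> \<open>Fewer than d vectors do not span, so some z lies outside their span. Its
      residual y is nonzero, and positivity of the form allows y to be normalized.\<close>
    have "card I < CARD('d)" using insert by (metis UNIV_I finite_class.finite_UNIV psubset_card_mono psubsetI subset_UNIV)
    then have "dim (span (w ` I)) < DIM(real^'d)"
      using dim_le_card'[of "w ` I"] card_image_le[of I w] insert(1) by simp
    then have "span (w ` I) \<noteq> UNIV" by (metis dim_UNIV order_less_irrefl)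
    then obtain z where z: "z \<notin> span (w ` I)" by auto
    define y where "y = z - (\<Sum>i\<in>I. (w i \<bullet> (S *v z)) *\<^sub>R w i)"
    have "(\<Sum>i\<in>I. (w i \<bullet> (S *v z)) *\<^sub>R w i) \<in> span (w ` I)"
      by (intro span_sum span_scale span_base) auto
    with z have "y \<noteq> 0" by (auto simp: y_def)
    from pos[OF this] have c: "y \<bullet> (S *v y) > 0" .
    have "w l \<bullet> (S *v y) = 0" if "l \<in> I" for l
      using proj[OF w that insert(1)] by (simp add: y_def)
    then have "ok (insert k I) (w(k := (1 / sqrt (y \<bullet> (S *v y))) *\<^sub>R y))"
      using w c insert(2) sym by (auto simp: ok_def matrix_vector_mult_scaleR)
    then show ?case by blast
  qed
  then obtain w where w: "ok UNIV w" by (metis finite)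
  have full: "z = 0" if "\<And>k. w k \<bullet> z = 0" for z
  proof -
    have inv: "span (range w) = UNIV"
    proof -
      have inj: "inj w"
        by (rule injI) (metis (full_types) UNIV_I ok_def w zero_neq_one)
      have "independent (range w)"
      proof (rule independent_if_scalars_zero)
        fix f x assume f: "(\<Sum>x\<in>range w. f x *\<^sub>R x) = 0" and "x \<in> range w"
        then obtain k where x: "x = w k" by auto
        have "(\<Sum>i\<in>UNIV. f (w i) *\<^sub>R w i) = 0" using f inj by (simp add: sum.reindex)
        then have "w k \<bullet> (S *v (\<Sum>i\<in>UNIV. f (w i) *\<^sub>R w i)) = 0" by simp
        also have "w k \<bullet> (S *v (\<Sum>i\<in>UNIV. f (w i) *\<^sub>R w i)) = (\<Sum>i\<in>UNIV. f (w i) * (if k = i then 1 else 0))"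
          using w by (simp add: matrix_vector_mult_sum inner_sum_right matrix_vector_mult_scaleR ok_def)
        also have "\<dots> = f x" by (simp add: x if_distrib cong: if_cong)
        finally show "f x = 0" .
      qed simp
      moreover have "card (range w) = DIM(real^'d)" using inj by (simp add: card_image)
      ultimately show ?thesis
        by (metis dim_eq_card_independent dim_eq_full)
    qed
    have "z \<in> span (range w)" using inv by simp
    have "orthogonal z x" if "x \<in> range w" for x using that \<open>\<And>k. w k \<bullet> z = 0\<close> by (auto simp: orthogonal_def inner_commute)
    then have "orthogonal z z" by (metis orthogonal_to_span inv UNIV_I)
    then show ?thesis by (simp add: orthogonal_def)
  qed
  have rep: "(\<Sum>k\<in>UNIV. (w k \<bullet> (S *v z)) *\<^sub>R w k) = z" for z
  proof -
    \<comment> \<open>The residual of the expansion is orthogonal to every \<open>w k\<close> in the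
      inner product of \<open>S\<close>, so \<open>S *v ?y\<close> is orthogonal in the usual sense
      to a spanning family and vanishes; positivity then gives \<open>?y = 0\<close>.\<close>
    let ?y = "z - (\<Sum>k\<in>UNIV. (w k \<bullet> (S *v z)) *\<^sub>R w k)"
    have "S *v ?y = 0" by (rule full) (rule proj[OF w], simp_all)
    then have "?y \<bullet> (S *v ?y) = 0" by simp
    then have "?y = 0" using pos[of ?y] by (cases "?y = 0") auto
    then show ?thesis by simp
  qed
  show ?thesis using w full rep by (intro exI[of _ w]) (auto simp: ok_def)
qed

section \<open>Hotelling's statistic\<close>

abbreviation col_vec :: "('j \<times> 'd::finite \<Rightarrow> real) \<Rightarrow> 'j \<Rightarrow> real^'d" where
  "col_vec x j \<equiv> (\<chi> i. x (j, i))"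

text \<open>The matrix \<open>Y\<close> with columns \<open>col_vec x j\<close> enters through \<open>Y v\<close> and
  \<open>\<bar>v\<bar>\<^sup>2 Y Y\<^sup>T - (Y v) (Y v)\<^sup>T\<close>; the factor \<open>\<bar>v\<bar>\<^sup>2\<close> makes the quadratic form of the inverse
  invariant under scaling of \<open>v\<close>.\<close>

definition gram :: "nat \<Rightarrow> (nat \<times> 'd::finite \<Rightarrow> real) \<Rightarrow> real^'d^'d" where
  "gram m x = (\<Sum>j<m. outer_product (col_vec x j) (col_vec x j))"

definition along :: "nat \<Rightarrow> (nat \<Rightarrow> real) \<Rightarrow> (nat \<times> 'd::finite \<Rightarrow> real) \<Rightarrow> real^'d" where
  "along m v x = (\<Sum>j<m. v j *\<^sub>R col_vec x j)"

definition across :: "nat \<Rightarrow> (nat \<Rightarrow> real) \<Rightarrow> (nat \<times> 'd::finite \<Rightarrow> real) \<Rightarrow> real^'d^'d" where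
  "across m v x = (\<Sum>j<m. (v j)\<^sup>2) *\<^sub>R gram m x - outer_product (along m v x) (along m v x)"

lemma gram_nth: "gram m x $ i $ k = (\<Sum>j<m. x (j, i) * x (j, k))"
  by (simp add: gram_def outer_product_def)

lemma along_nth: "along m v x $ i = (\<Sum>j<m. v j * x (j, i))"
  by (simp add: along_def)

lemma across_nth:
  "across m v x $ i $ k = (\<Sum>j<m. (v j)\<^sup>2) * gram m x $ i $ k - along m v x $ i * along m v x $ k"
  by (simp add: across_def outer_product_def)

lemma gram_mult_vec: "gram m x *v y = (\<Sum>j<m. (col_vec x j \<bullet> y) *\<^sub>R col_vec x j)"
  by (simp add: gram_def sum_matrix_vector_mult outer_product_mult_vec)

lemma across_mult_vec:
  "across m v x *v y = (\<Sum>j<m. (v j)\<^sup>2) *\<^sub>R (gram m x *v y) - (along m v x \<bullet> y) *\<^sub>R along m v x"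
  by (simp add: across_def matrix_vector_mult_diff_rdistrib outer_product_mult_vec scaleR_matrix_vector_assoc[symmetric])

lemma inner_gram: "y \<bullet> (gram m x *v z) = (\<Sum>j<m. (col_vec x j \<bullet> y) * (col_vec x j \<bullet> z))"
  by (simp add: gram_mult_vec inner_sum_right inner_commute[of y] mult.commute)

lemma inner_along: "w \<bullet> along m v x = (\<Sum>j<m. (w \<bullet> col_vec x j) * v j)"
  by (simp add: along_def inner_sum_right mult.commute)

text \<open>In coordinates that orthonormalize the rows of \<open>x\<close>, \<^const>\<open>across\<close> is \<open>\<bar>v\<bar>\<^sup>2 I - b b\<^sup>T\<close> with \<open>b\<close>
  the projection of \<open>v\<close> to the row space.\<close>

lemma inv_form_across:
  fixes x :: "nat \<times> 'd::finite \<Rightarrow> real"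
  assumes "det (gram m x) \<noteq> 0"
  obtains U :: "'d \<Rightarrow> nat \<Rightarrow> real" where "ortho_rows {..<m} UNIV U"
    "\<And>v p q. p = (\<Sum>i\<in>UNIV. (\<Sum>j<m. U i j * v j)\<^sup>2) \<Longrightarrow> q = (\<Sum>j<m. (v j)\<^sup>2) \<Longrightarrow> p < q \<Longrightarrow>
       det (across m v x) \<noteq> 0 \<and> inv_form (along m v x) (across m v x) = p / (q - p)"
proof -
  let ?G = "gram m x"
  have sym: "y \<bullet> (?G *v z) = z \<bullet> (?G *v y)" for y z
    by (simp add: inner_gram mult.commute)
  have pos: "y \<bullet> (?G *v y) > 0" if "y \<noteq> 0" for y
  proof -
    have "\<exists>j<m. col_vec x j \<bullet> y \<noteq> 0"
    proof (rule ccontr)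
      assume "\<not> ?thesis"
      then have "?G *v y = 0" by (simp add: gram_mult_vec)
      then show False using assms that by (simp add: det_nz_iff_kernel)
    qed
    then obtain j where "j < m" "col_vec x j \<bullet> y \<noteq> 0" by auto
    then have "0 < (\<Sum>j<m. (col_vec x j \<bullet> y) * (col_vec x j \<bullet> y))"
      by (intro sum_pos2[of _ j]) (simp_all only: finite_lessThan lessThan_iff not_real_square_gt_zero[symmetric] not_not zero_le_square)
    then show ?thesis by (simp add: inner_gram)
  qed
  obtain w :: "'d \<Rightarrow> real^'d" where w: "\<And>i k. w i \<bullet> (?G *v w k) = (if i = k then 1 else 0)"
    "\<And>z. (\<And>k. w k \<bullet> z = 0) \<Longrightarrow> z = 0" "\<And>z. (\<Sum>k\<in>UNIV. (w k \<bullet> (?G *v z)) *\<^sub>R w k) = z"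
    using whitening_basis[OF sym pos] by blast
  show ?thesis
  proof (rule that[of "\<lambda>i j. w i \<bullet> col_vec x j"])
    show "ortho_rows {..<m} UNIV (\<lambda>i j. w i \<bullet> col_vec x j)"
      using w(1) by (simp add: ortho_rows_def inner_gram inner_commute)
    fix v p q assume p: "p = (\<Sum>i\<in>UNIV. (\<Sum>j<m. (w i \<bullet> col_vec x j) * v j)\<^sup>2)"
      and q: "q = (\<Sum>j<m. (v j)\<^sup>2)" and pq: "p < q"
    define a where "a = along m v x"
    have p: "p = (\<Sum>i\<in>UNIV. (w i \<bullet> a)\<^sup>2)" by (simp add: p a_def inner_along)
    have S: "across m v x *v y = q *\<^sub>R (?G *v y) - (a \<bullet> y) *\<^sub>R a" for y
      by (simp add: across_mult_vec a_def q)
    have wG: "w k \<bullet> (?G *v (\<Sum>i\<in>UNIV. c i *\<^sub>R w i)) = c k" for k c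
    proof -
      have "w k \<bullet> (?G *v (\<Sum>i\<in>UNIV. c i *\<^sub>R w i)) = (\<Sum>i\<in>UNIV. c i * (if k = i then 1 else 0))"
        by (simp add: matrix_vector_mult_sum matrix_vector_mult_scaleR inner_sum_right w(1))
      then show ?thesis by (simp add: if_distrib cong: if_cong)
    qed
    have nz: "det (across m v x) \<noteq> 0"
      unfolding det_nz_iff_kernel
    proof (intro allI impI)
      fix z assume z: "across m v x *v z = 0"
      define c where "c k = w k \<bullet> (?G *v z)" for k
      have zc: "z = (\<Sum>k\<in>UNIV. c k *\<^sub>R w k)" unfolding c_def by (rule w(3)[symmetric])
      have "z \<bullet> (?G *v z) = (\<Sum>k\<in>UNIV. c k *\<^sub>R w k) \<bullet> (?G *v z)" using zc by simp
      also have "\<dots> = (\<Sum>k\<in>UNIV. (c k)\<^sup>2)" by (simp add: inner_sum_left c_def power2_eq_square)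
      finally have zz: "z \<bullet> (?G *v z) = (\<Sum>k\<in>UNIV. (c k)\<^sup>2)" .
      have "a \<bullet> z = a \<bullet> (\<Sum>k\<in>UNIV. c k *\<^sub>R w k)" using zc by simp
      also have "\<dots> = (\<Sum>k\<in>UNIV. c k * (w k \<bullet> a))" by (simp add: inner_sum_right inner_commute)
      \<comment> \<open>For z in the kernel the quadratic form gives q |c|^2 = (a . z)^2, while
        Cauchy-Schwarz in the coordinates c bounds the right-hand side by p |c|^2. With p < q only c
        = 0 remains.\<close>
      finally have "(a \<bullet> z)\<^sup>2 \<le> (\<Sum>k\<in>UNIV. (c k)\<^sup>2) * p"
        unfolding p using Cauchy_Schwarz_ineq_sum[of c "\<lambda>k. w k \<bullet> a" UNIV] by simp
      moreover have "z \<bullet> (across m v x *v z) = 0" using z by simp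
      then have "q * (z \<bullet> (?G *v z)) = (a \<bullet> z)\<^sup>2"
        by (simp add: S inner_diff_right inner_commute power2_eq_square)
      ultimately have "(z \<bullet> (?G *v z)) * (q - p) \<le> 0" by (simp add: zz algebra_simps)
      then have "z \<bullet> (?G *v z) \<le> 0" using pq by (simp add: mult_le_0_iff)
      then show "z = 0" using pos[of z] by (cases "z = 0") auto
    qed
    \<comment> \<open>The witness: q I - b b^T with |b|^2 = p maps b to (q - p) b, so b / (q - p) is
      the preimage of b. Here b has the coordinates \<open>w i \<bullet> a\<close>.\<close>
    moreover have "across m v x *v ((1 / (q - p)) *\<^sub>R (\<Sum>i\<in>UNIV. (w i \<bullet> a) *\<^sub>R w i)) = a" (is "_ *v (_ *\<^sub>R ?y) = _")
    proof -
      have ay: "a \<bullet> ?y = p" by (simp add: inner_sum_right p power2_eq_square inner_commute)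
      have "across m v x *v ?y - (q - p) *\<^sub>R a = 0"
      proof (rule w(2))
        fix k
        show "w k \<bullet> (across m v x *v ?y - (q - p) *\<^sub>R a) = 0"
          by (simp add: S ay inner_diff_right wG algebra_simps)
      qed
      then show ?thesis using pq by (simp add: matrix_vector_mult_scaleR)
    qed
    ultimately have "inv_form a (across m v x) = a \<bullet> ((1 / (q - p)) *\<^sub>R (\<Sum>i\<in>UNIV. (w i \<bullet> a) *\<^sub>R w i))"
      by (rule inv_form_eqI)
    also have "\<dots> = p / (q - p)" by (simp add: inner_sum_right p power2_eq_square inner_commute)
    finally show "det (across m v x) \<noteq> 0 \<and> inv_form (along m v x) (across m v x) = p / (q - p)"
      using nz by (simp add: a_def)
  qed
qed

section \<open>Full rank of Gaussian matrices\<close>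

abbreviation mat_ix :: "nat \<Rightarrow> (nat \<times> 'd::finite) set" where
  "mat_ix m \<equiv> {..<m} \<times> UNIV"

lemma col_vec_measurable[measurable]:
  "j < m \<Longrightarrow> (\<lambda>x. col_vec x j :: real^'d::finite) \<in> borel_measurable (PiM (mat_ix m) (\<lambda>_. borel))"
  proof (rule borel_measurable_vecI)
  fix i :: 'd
  assume "j < m"
  then have "(j, i) \<in> mat_ix m" by simp
  then show "(\<lambda>x. col_vec x j $ i) \<in> borel_measurable (PiM (mat_ix m) (\<lambda>_. borel))"
    unfolding vec_lambda_beta by (rule measurable_component_singleton)
qed

text \<open>Integrate over coordinate \<open>i\<close> first. With all others fixed, slope and
  intercept are constants, and for nonzero slope the only bad value of the coordinate is - r / c, a
  null set.\<close>

lemma AE_gauss_affine_nonzero: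
  fixes c r :: "('i \<Rightarrow> real) \<Rightarrow> real"
  assumes I: "finite I" "i \<in> I"
    and [measurable]: "c \<in> borel_measurable (gauss I)" "r \<in> borel_measurable (gauss I)"
    and indep: "\<And>x t. c (x(i := t)) = c x" "\<And>x t. r (x(i := t)) = r x"
    and nz: "AE x in gauss I. c x \<noteq> 0"
  shows "AE x in gauss I. x i * c x + r x \<noteq> 0"
proof -
  define J where "J = I - {i}"
  have J: "finite J" "i \<notin> J" "I = insert i J" using I by (auto simp: J_def)
  define A where "A = {x \<in> space (gauss I). c x \<noteq> 0 \<and> x i * c x + r x = 0}"
  have [measurable]: "(\<lambda>x. x i) \<in> borel_measurable (gauss I)" using I by measurable
  have A[measurable]: "A \<in> sets (gauss I)" unfolding A_def by measurable
  have "emeasure (gauss I) A = (\<integral>\<^sup>+ x. indicator A x \<partial>gauss (insert i J))" using A J(3) by simp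
  also have "\<dots> = (\<integral>\<^sup>+ x. (\<integral>\<^sup>+ y. indicator A (x(i := y)) \<partial>std_normal_distribution) \<partial>gauss J)"
    using A J by (intro gauss.product_nn_integral_insert) auto
  also have "\<dots> = (\<integral>\<^sup>+ x. 0 \<partial>gauss J)"
  proof (rule nn_integral_cong)
    fix x assume "x \<in> space (gauss J)"
    have "AE y in std_normal_distribution. y \<noteq> - r x / c x"
      using AE_lborel_singleton[of "- r x / c x"] by (subst AE_density) (auto elim: AE_mp)
    then have "AE y in std_normal_distribution. indicator A (x(i := y)) = (0 :: ennreal)"
      by (rule AE_mp) (intro AE_I2, auto simp: A_def indicator_def indep field_simps)
    then have "(\<integral>\<^sup>+ y. indicator A (x(i := y)) \<partial>std_normal_distribution) = (\<integral>\<^sup>+ y. 0 \<partial>std_normal_distribution)"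
      by (rule nn_integral_cong_AE)
    then show "(\<integral>\<^sup>+ y. indicator A (x(i := y)) \<partial>std_normal_distribution) = 0" by simp
  qed
  finally have "AE x in gauss I. x \<notin> A" using A by (intro AE_not_in) (auto simp: null_sets_def)
  with nz AE_space show ?thesis by eventually_elim (simp add: A_def)
qed

text \<open>The rows of the identity matrix are replaced by Gaussian rows one at a time; each step changes
  the determinant by an affine function of one new coordinate, whose slope is the previous
  determinant.\<close>

lemma AE_gauss_det_nonzero:
  fixes h :: "'d::finite \<Rightarrow> nat"
  assumes h: "inj h" "\<And>k. h k < m"
  shows "AE x in gauss (mat_ix m). det (\<chi> k i::'d. x (h k, i)) \<noteq> 0"
proof -
  define Q :: "'d set \<Rightarrow> (nat \<times> 'd \<Rightarrow> real) \<Rightarrow> real^'d^'d"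
    where "Q J x = (\<chi> k. if k \<in> J then (\<chi> i. x (h k, i)) else axis k 1)" for J x
  \<comment> \<open>One formula covers two determinants: for \<open>l\<close> outside
    \<open>J\<close> it is \<open>det (Q J x)\<close>, and for \<open>insert l J\<close> in place of
    \<open>J\<close> it is the intercept \<open>r\<close> below.\<close>
  have meas: "(\<lambda>x. det (\<chi> k. if k \<in> J then (if k = l then (\<chi> i. if i = l then 0 else x (h k, i)) else (\<chi> i. x (h k, i))) else axis k 1))
     \<in> borel_measurable (gauss (mat_ix m))" for J and l :: 'd
  proof (rule det_measurable)
    fix a b :: 'd
    have "(h a, b) \<in> mat_ix m" using h by auto
    then have "(\<lambda>x. x (h a, b)) \<in> borel_measurable (gauss (mat_ix m))" by (rule gauss_coordinate_measurable)
    then show "(\<lambda>x. (\<chi> k. if k \<in> J then (if k = l then (\<chi> i. if i = l then 0 else x (h k, i)) else (\<chi> i. x (h k, i))) else axis k 1) $ a $ b)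
       \<in> borel_measurable (gauss (mat_ix m))"
      by (cases "a \<in> J"; cases "a = l"; cases "b = l") auto
  qed
  have "AE x in gauss (mat_ix m). det (Q J x) \<noteq> 0" if "finite J" for J
    using that
  proof induction
    case empty
    have "Q {} x = mat 1" for x by (simp add: Q_def mat_def axis_def vec_eq_iff)
    then show ?case by simp
  next
    case (insert l J)
    define r where "r x = det (\<chi> k. if k = l then (\<chi> i. if i = l then 0 else x (h k, i)) else Q J x $ k)" for x
    have eq: "det (Q (insert l J) x) = x (h l, l) * det (Q J x) + r x" for x
    proof -
      \<comment> \<open>Row \<open>l\<close> is its entry in column \<open>l\<close> times the unit
        row plus the same row with that entry set to zero. Multilinearity makes
        \<open>det (Q J x)\<close> the slope, because row \<open>l\<close> of \<open>Q J x\<close>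
        still is the unit row.\<close>
      have "Q (insert l J) x = (\<chi> k. if k = l then x (h l, l) *s axis l 1 + (\<chi> i. if i = l then 0 else x (h k, i)) else Q J x $ k)"
        by (auto simp: Q_def vec_eq_iff axis_def)
      then have "det (Q (insert l J) x) = x (h l, l) * det (\<chi> k. if k = l then axis l 1 else Q J x $ k) + r x"
        by (simp only: det_row_add det_row_mul r_def)
      also have "(\<chi> k. if k = l then axis l 1 else Q J x $ k) = Q J x"
        using insert by (auto simp: Q_def vec_eq_iff)
      finally show ?thesis .
    qed
    have "(h l, l) \<in> mat_ix m" using h by auto
    then show ?case unfolding eq
    proof (intro AE_gauss_affine_nonzero)
      show "(\<lambda>x. det (Q J x)) \<in> borel_measurable (gauss (mat_ix m))"
        using meas[of J l] insert(2)
        by (elim measurable_cong[THEN iffD1, rotated]) (auto simp: Q_def intro!: arg_cong[where f=det] simp: vec_eq_iff)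
      have "r = (\<lambda>x. det (\<chi> k. if k \<in> insert l J then (if k = l then (\<chi> i. if i = l then 0 else x (h k, i)) else (\<chi> i. x (h k, i))) else axis k 1))"
        using insert(2) by (auto simp: r_def Q_def vec_eq_iff fun_eq_iff intro!: arg_cong[where f=det])
      then show "r \<in> borel_measurable (gauss (mat_ix m))" using meas[of "insert l J" l] by (simp only:)
      show "det (Q J (x((h l, l) := t))) = det (Q J x)" for x t
        using insert(2) by (intro arg_cong[where f=det]) (auto simp: Q_def vec_eq_iff inj_eq[OF h(1)])
      show "r (x((h l, l) := t)) = r x" for x t
        unfolding r_def using insert(2) h(1)
        by (intro arg_cong[where f=det]) (auto simp: Q_def vec_eq_iff inj_eq[OF h(1)])
    qed (use insert in auto)
  qed
  from this[of UNIV] show ?thesis by (simp add: Q_def)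
qed

text \<open>A vector in the kernel of the Gram matrix is orthogonal to all m columns. The injection
  \<open>h\<close> picks d of them, and these are almost surely independent.\<close>

lemma AE_gauss_det_gram_nonzero:
  assumes "CARD('d::finite) \<le> m"
  shows "AE x in gauss (mat_ix m). det (gram m x :: real^'d^'d) \<noteq> 0"
proof -
  obtain h :: "'d \<Rightarrow> nat" where h: "inj h" "range h \<subseteq> {..<m}"
    using card_le_inj[of "UNIV :: 'd set" "{..<m}"] assms by auto
  have "AE x in gauss (mat_ix m). det (\<chi> k i::'d. x (h k, i)) \<noteq> 0"
    using h by (intro AE_gauss_det_nonzero) auto
  then show ?thesis
  proof eventually_elim
    case (elim x)
    show ?case unfolding det_nz_iff_kernel
    proof (intro allI impI)
      fix z :: "real^'d" assume "gram m x *v z = 0"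
      then have "(\<Sum>j<m. (col_vec x j \<bullet> z) * (col_vec x j \<bullet> z)) = 0"
        by (simp add: inner_gram[symmetric])
      then have "col_vec x j \<bullet> z = 0" if "j < m" for j
        using that by (subst (asm) sum_nonneg_eq_0_iff) auto
      then have "(\<chi> k i::'d. x (h k, i)) *v z = 0"
        using h by (auto simp: vec_eq_iff matrix_vector_mult_def inner_vec_def)
      with elim show "z = 0" by (simp add: det_nz_iff_kernel)
    qed
  qed
qed

section \<open>Exchanging the fixed direction for a random one\<close>

definition scale_invariant :: "((real^'d) \<times> (real^'d^'d)) set \<Rightarrow> bool" where
  "scale_invariant D \<longleftrightarrow> (\<forall>c>0. \<forall>u S. (c *\<^sub>R u, c\<^sup>2 *\<^sub>R S) \<in> D \<longleftrightarrow> (u, S) \<in> D)"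

lemma along_scale: "along m (\<lambda>j. c * v j) x = c *\<^sub>R along m v x"
  by (simp add: along_def scaleR_sum_right)

text \<open>\<open>along\<close> is linear and \<open>across\<close> quadratic in the direction,
  which is the transformation that \<open>scale_invariant\<close> refers to: a scale invariant event
  does not see the length of the direction.\<close>

lemma across_scale: "across m (\<lambda>j. c * v j) x = c\<^sup>2 *\<^sub>R across m v x"
  by (simp add: vec_eq_iff across_nth along_scale power_mult_distrib sum_distrib_left[symmetric])
     (simp add: algebra_simps power2_eq_square)

lemma along_measurable[measurable]:
  "(\<lambda>x. along m v x :: real^'d) \<in> borel_measurable (gauss (mat_ix m))"
  unfolding along_def by (intro borel_measurable_sum borel_measurable_scaleR) auto

lemma across_measurable[measurable]:
  "(\<lambda>x. across m v x :: real^'d^'d) \<in> borel_measurable (gauss (mat_ix m))"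
proof (intro borel_measurable_vecI)
  fix i k :: 'd
  have [measurable]: "(\<lambda>x. x (j, l)) \<in> borel_measurable (gauss (mat_ix m))" if "j < m" for j and l :: 'd
    using that by (intro gauss_coordinate_measurable) auto
  show "(\<lambda>x. across m v x $ i $ k) \<in> borel_measurable (gauss (mat_ix m))"
    unfolding across_nth gram_nth along_nth by measurable
qed

text \<open>The reflection in the hyperplane orthogonal to v - e interchanges the unit vectors v and
  e. Its formula divides by |v - e|^2, so v = e is treated apart with the identity.\<close>

lemma Householder:
  fixes v e :: "nat \<Rightarrow> real"
  assumes v: "(\<Sum>j<m. (v j)\<^sup>2) = 1" and e: "(\<Sum>j<m. (e j)\<^sup>2) = 1"
  obtains u where "ortho_rows {..<m} {..<m} u" "\<And>k. k < m \<Longrightarrow> (\<Sum>j<m. u j k * e j) = v k"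
proof (cases "\<forall>j<m. v j = e j")
  case True
  show ?thesis
    by (rule that[of "\<lambda>j k. if j = k then 1 else 0"])
       (use True in \<open>auto simp: ortho_rows_def if_distrib[of "\<lambda>z. z * _"] cong: if_cong\<close>)
next
  case False
  define w where "w j = v j - e j" for j
  define s where "s = (\<Sum>j<m. (w j)\<^sup>2)"
  obtain j0 where "j0 < m" "w j0 \<noteq> 0" using False by (auto simp: w_def)
  then have s: "s > 0" unfolding s_def by (intro sum_pos2[of _ j0]) auto
  \<comment> \<open>Since v = e + w, the number |w|^2 + 2 w . e equals |v|^2 - |e|^2 = 0.\<close>
  have we: "2 * (\<Sum>j<m. w j * e j) = - s"
  proof -
    have "s + 2 * (\<Sum>j<m. w j * e j) = (\<Sum>j<m. (v j)\<^sup>2 - (e j)\<^sup>2)"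
      unfolding s_def w_def sum_distrib_left sum.distrib[symmetric]
      by (intro sum.cong) (auto simp: power2_eq_square algebra_simps)
    then show ?thesis using v e by (simp add: sum_subtractf)
  qed
  define u where "u j k = (if j = k then 1 else 0) - 2 / s * w j * w k" for j k
  show ?thesis
  proof (rule that[of u])
    show "ortho_rows {..<m} {..<m} u"
      unfolding ortho_rows_def
    proof (intro ballI)
      fix i k assume ik: "i \<in> {..<m}" "k \<in> {..<m}"
      define A B C where "A = 2 / s * w k" and "B = 2 / s * w i" and "C = 4 / (s * s) * (w i * w k)"
      have "(\<Sum>j<m. u i j * u k j) = (\<Sum>j<m. (if i = j then 1 else 0) * (if k = j then 1 else 0)
          - A * ((if i = j then 1 else 0) * w j) - B * ((if k = j then 1 else 0) * w j) + C * (w j)\<^sup>2)"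
        unfolding u_def A_def B_def C_def by (intro sum.cong) (auto simp: algebra_simps power2_eq_square)
      also have "\<dots> = (if i = k then 1 else 0) - A * w i - B * w k + C * s"
        using ik by (simp add: sum.distrib sum_subtractf sum_distrib_left[symmetric] s_def
            if_distrib[of "\<lambda>z. z * _"] cong: if_cong)
      also have "\<dots> = (if i = k then 1 else 0)" using s by (simp add: A_def B_def C_def field_simps)
      finally show "(\<Sum>j<m. u i j * u k j) = (if i = k then 1 else 0)" .
    qed
    show "(\<Sum>j<m. u j k * e j) = v k" if "k < m" for k
    proof -
      define A where "A = 2 / s * w k"
      have "(\<Sum>j<m. u j k * e j) = (\<Sum>j<m. (if j = k then 1 else 0) * e j - A * (w j * e j))"
        unfolding u_def A_def by (intro sum.cong) (auto simp: algebra_simps)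
      also have "\<dots> = e k - A / 2 * (2 * (\<Sum>j<m. w j * e j))"
        using that by (simp add: sum_subtractf sum_distrib_left[symmetric] if_distrib[of "\<lambda>z. z * _"] cong: if_cong)
      also have "\<dots> = v k" using s by (simp only: we) (simp add: A_def w_def field_simps)
      finally show ?thesis .
    qed
  qed
qed

text \<open>Mixing the columns by \<open>u\<close> is the rotation of the d m entries by the
  Kronecker product of \<open>u\<close> with the identity; \<open>?U\<close> is that matrix, and its
  orthonormality is inherited from \<open>u\<close>.\<close>

lemma gauss_rotate_columns:
  assumes u: "ortho_rows {..<m} {..<m} u" and m: "m > 0"
  shows "distr (gauss (mat_ix m)) (gauss (mat_ix m))
    (\<lambda>x. \<lambda>(j, i)\<in>mat_ix m. \<Sum>k<m. u j k * x (k, i)) = gauss (mat_ix m :: (nat \<times> 'd::finite) set)"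
proof -
  let ?U = "\<lambda>(j, i) (k, l). if i = l then u j k else (0::real)"
  have "(\<lambda>x. \<lambda>(j, i)\<in>mat_ix m. \<Sum>k<m. u j k * x (k, i)) =
     (\<lambda>x. \<lambda>p\<in>(mat_ix m :: (nat \<times> 'd) set). \<Sum>q\<in>mat_ix m. ?U p q * x q)"
    by (intro ext) (auto simp: restrict_def sum.cartesian_product' if_distrib[of "\<lambda>z. z * _"] cong: if_cong)
  moreover have "ortho_rows (mat_ix m) (mat_ix m :: (nat \<times> 'd) set) ?U"
    unfolding ortho_rows_def
  proof (intro ballI)
    fix p q :: "nat \<times> 'd" assume pq: "p \<in> mat_ix m" "q \<in> mat_ix m"
    obtain j i k l where p: "p = (j, i)" and q: "q = (k, l)" by (metis surj_pair)
    with pq have jk: "j < m" "k < m" by auto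
    have "(\<Sum>q\<in>mat_ix m. ?U (j, i) q * ?U (k, l) q) = (\<Sum>a<m. \<Sum>b\<in>UNIV. (if i = b then u j a else 0) * (if l = b then u k a else 0))"
      by (simp add: sum.cartesian_product')
    also have "\<dots> = (if i = l then (\<Sum>a<m. u j a * u k a) else 0)"
      by (auto simp: if_distrib[of "\<lambda>z. z * _"] cong: if_cong)
    also have "\<dots> = (if j = k \<and> i = l then 1 else 0)" using u jk by (simp add: ortho_rows_def)
    finally show "(\<Sum>r\<in>mat_ix m. ?U p r * ?U q r) = (if p = q then 1 else 0)"
      by (simp only: p q prod.inject)
  qed
  ultimately show ?thesis using gauss_rotate[of "mat_ix m :: (nat \<times> 'd) set" ?U] m by auto
qed

text \<open>The new matrix is Y u^T. Hence its product with e is Y (u^T e) = Y v, and its Gram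
  matrix Y u^T u Y^T = Y Y^T is unchanged.\<close>

lemma along_across_rotate:
  fixes x :: "nat \<times> 'd::finite \<Rightarrow> real"
  assumes u: "ortho_rows {..<m} {..<m} u" and ev: "\<And>k. k < m \<Longrightarrow> (\<Sum>j<m. u j k * e j) = v k"
    and n: "(\<Sum>j<m. (e j)\<^sup>2) = (\<Sum>j<m. (v j)\<^sup>2)"
  defines "y \<equiv> (\<lambda>(j, i)\<in>mat_ix m. \<Sum>k<m. u j k * x (k, i))"
  shows "along m e y = along m v x" "across m e y = across m v x"
proof -
  have y: "y (j, i) = (\<Sum>k<m. u j k * x (k, i))" if "j < m" for j i using that by (simp add: y_def)
  show a: "along m e y = along m v x"
  proof (subst vec_eq_iff, intro allI)
    fix i
    have "along m e y $ i = (\<Sum>j<m. \<Sum>k<m. e j * (u j k * x (k, i)))" by (simp add: along_nth y sum_distrib_left)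
    also have "\<dots> = (\<Sum>k<m. (\<Sum>j<m. u j k * e j) * x (k, i))"
      by (subst sum.swap) (simp add: sum_distrib_left sum_distrib_right ac_simps)
    also have "\<dots> = along m v x $ i" by (simp add: ev along_nth)
    finally show "along m e y $ i = along m v x $ i" .
  qed
  have g: "gram m y = gram m x"
  proof (subst vec_eq_iff, intro allI, subst vec_eq_iff, intro allI)
    fix i l
    have "gram m y $ i $ l = (\<Sum>j<m. \<Sum>k<m. \<Sum>k'<m. (u j k * u j k') * (x (k, i) * x (k', l)))"
      by (simp add: gram_nth y sum_product ac_simps)
    also have "\<dots> = (\<Sum>k<m. \<Sum>k'<m. (\<Sum>j<m. u j k * u j k') * (x (k, i) * x (k', l)))"
      by (subst sum.swap, rule sum.cong[OF refl], subst sum.swap) (simp add: sum_distrib_right)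
    also have "\<dots> = (\<Sum>k<m. \<Sum>k'<m. (if k' = k then 1 else 0) * (x (k, i) * x (k', l)))"
      using ortho_rows_square_columns[OF _ u] by (intro sum.cong) auto
    also have "\<dots> = gram m x $ i $ l" by (simp add: gram_nth if_distrib[of "\<lambda>z. z * _"] cong: if_cong)
    finally show "gram m y $ i $ l = gram m x $ i $ l" .
  qed
  show "across m e y = across m v x" by (simp add: across_def a g n)
qed

text \<open>Scale invariance reduces to unit vectors. A reflection carries one direction to the
  other and preserves the Gaussian law of the matrix, so the probability is the same for all nonzero
  directions.\<close>

lemma measure_along_across_direction:
  fixes D :: "((real^'d) \<times> (real^'d^'d)) set"
  assumes D[measurable]: "D \<in> sets borel" and inv: "scale_invariant D"
    and v: "(\<Sum>j<m. (v j)\<^sup>2) > 0" and e: "(\<Sum>j<m. (e j)\<^sup>2) > 0"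
  shows "emeasure (gauss (mat_ix m)) {x \<in> space (gauss (mat_ix m)). (along m v x, across m v x) \<in> D} =
         emeasure (gauss (mat_ix m)) {x \<in> space (gauss (mat_ix m)). (along m e x, across m e x) \<in> D}"
proof -
  let ?P = "gauss (mat_ix m :: (nat \<times> 'd) set)"
  have m: "m > 0" using v by (cases m) auto
  have norm: "((along m v x :: real^'d), across m v x) \<in> D \<longleftrightarrow> (along m v' x, across m v' x) \<in> D" "(\<Sum>j<m. (v' j)\<^sup>2) = 1"
    if "(\<Sum>j<m. (v j)\<^sup>2) > 0" "v' = (\<lambda>j. (1 / sqrt (\<Sum>j<m. (v j)\<^sup>2)) * v j)" for v v' x
  proof -
    show "((along m v x :: real^'d), across m v x) \<in> D \<longleftrightarrow> (along m v' x, across m v' x) \<in> D"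
      using inv that unfolding that(2) along_scale across_scale scale_invariant_def
      by (metis real_sqrt_gt_zero zero_less_divide_1_iff)
    show "(\<Sum>j<m. (v' j)\<^sup>2) = 1" using that by (simp add: power_mult_distrib power_divide sum_divide_distrib[symmetric])
  qed
  define v' where "v' = (\<lambda>j. (1 / sqrt (\<Sum>j<m. (v j)\<^sup>2)) * v j)"
  define e' where "e' = (\<lambda>j. (1 / sqrt (\<Sum>j<m. (e j)\<^sup>2)) * e j)"
  note nv = norm[OF v v'_def] and ne = norm[OF e e'_def]
  obtain u where u: "ortho_rows {..<m} {..<m} u" "\<And>k. k < m \<Longrightarrow> (\<Sum>j<m. u j k * e' j) = v' k"
    using Householder[OF nv(2) ne(2)] by blast
  define T :: "_ \<Rightarrow> (nat \<times> 'd \<Rightarrow> real)" where "T x = (\<lambda>(j, i)\<in>mat_ix m. \<Sum>k<m. u j k * x (k, i))" for x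
  have dT: "distr ?P ?P T = ?P" unfolding T_def by (rule gauss_rotate_columns[OF u(1) m])
  have T[measurable]: "T \<in> measurable ?P ?P"
  proof -
    have [measurable]: "(\<lambda>x. x (k, i)) \<in> borel_measurable ?P" if "k < m" for k and i :: 'd
      using that by (intro gauss_coordinate_measurable) auto
    show ?thesis unfolding T_def
      by (subst measurable_cong_sets[OF refl sets_gauss], rule measurable_restrict) auto
  qed
  have K: "along m e' (T x) = along m v' x" "across m e' (T x) = across m v' x" for x
    unfolding T_def using along_across_rotate[OF u] nv(2) ne(2) by auto
  define E where "E = {x \<in> space ?P. (along m e' x, across m e' x) \<in> D}"
  have [measurable]: "E \<in> sets ?P"
    unfolding E_def by measurable
  have "emeasure ?P {x \<in> space ?P. (along m e x, across m e x) \<in> D} = emeasure (distr ?P ?P T) E"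
    unfolding dT by (simp add: E_def ne(1))
  also have "\<dots> = emeasure ?P (T -` E \<inter> space ?P)" by (rule emeasure_distr) auto
  also have "T -` E \<inter> space ?P = {x \<in> space ?P. (along m v x, across m v x) \<in> D}"
    using measurable_space[OF T] by (auto simp: E_def K nv(1))
  finally show ?thesis ..
qed

text \<open>Both constants are the product measure of \<open>A\<close>, computed by Tonelli in the
  two orders. One section will fix the matrix, the other the direction.\<close>

lemma pair_prob_measure_eq:
  assumes P: "prob_space P" and Q: "prob_space Q" and A: "A \<in> sets (P \<Otimes>\<^sub>M Q)"
    and 1: "AE x in P. emeasure Q (Pair x -` A) = a"
    and 2: "AE y in Q. emeasure P ((\<lambda>x. (x, y)) -` A) = b"
  shows "a = b"
proof -
  interpret P: prob_space P by fact
  interpret Q: prob_space Q by fact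
  interpret pair_sigma_finite P Q ..
  have "emeasure (P \<Otimes>\<^sub>M Q) A = (\<integral>\<^sup>+x. a \<partial>P)"
    using 1 by (subst Q.emeasure_pair_measure_alt[OF A]) (rule nn_integral_cong_AE)
  moreover have "emeasure (P \<Otimes>\<^sub>M Q) A = (\<integral>\<^sup>+y. b \<partial>Q)"
    using 2 by (subst emeasure_pair_measure_alt2[OF A]) (rule nn_integral_cong_AE)
  ultimately show ?thesis by (simp add: P.emeasure_space_1 Q.emeasure_space_1)
qed

lemma along_across_joint_measurable:
  "(\<lambda>(x, g). (along m g x :: real^'d, across m g x)) \<in>
     borel_measurable (gauss (mat_ix m :: (nat \<times> 'd) set) \<Otimes>\<^sub>M gauss {..<m})"
proof -
  let ?M = "gauss (mat_ix m :: (nat \<times> 'd) set) \<Otimes>\<^sub>M gauss {..<m}"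
  have 1[measurable]: "(\<lambda>p. fst p (j, i)) \<in> borel_measurable ?M" if "j < m" for j and i :: 'd
    using that by (intro measurable_compose[OF measurable_fst] gauss_coordinate_measurable) auto
  have 2[measurable]: "(\<lambda>p. snd p j) \<in> borel_measurable ?M" if "j < m" for j
    using that by (intro measurable_compose[OF measurable_snd] gauss_coordinate_measurable) auto
  have "(\<lambda>p. along m (snd p) (fst p) :: real^'d) \<in> borel_measurable ?M"
    by (rule borel_measurable_vecI) (simp add: along_nth)
  moreover have "(\<lambda>p. across m (snd p) (fst p) :: real^'d^'d) \<in> borel_measurable ?M"
    by (intro borel_measurable_vecI) (simp add: across_nth along_nth gram_nth)
  ultimately show ?thesis by (simp add: case_prod_beta borel_measurable_Pair)
qed

text \<open>The fixed direction \<open>e\<close> may be replaced by an independent Gaussian one; conditionally on the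
  matrix, the statistic then only involves the projection of that direction to the row space.\<close>

lemma emeasure_along_across:
  fixes D :: "((real^'d) \<times> (real^'d^'d)) set"
  assumes D[measurable]: "D \<in> sets borel" and inv: "scale_invariant D"
    and e: "(\<Sum>j<m. (e j)\<^sup>2) > 0" and m: "CARD('d) < m"
    and c: "AE x in gauss (mat_ix m). emeasure (gauss {..<m}) {g \<in> space (gauss {..<m}). (along m g x, across m g x) \<in> D} = c"
  shows "emeasure (gauss (mat_ix m)) {x \<in> space (gauss (mat_ix m)). (along m e x, across m e x) \<in> D} = c"
proof -
  let ?P = "gauss (mat_ix m :: (nat \<times> 'd) set)" and ?Q = "gauss {..<m}"
  define A where "A = {p \<in> space (?P \<Otimes>\<^sub>M ?Q). (case p of (x, g) \<Rightarrow> (along m g x, across m g x)) \<in> D}"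
  have A: "A \<in> sets (?P \<Otimes>\<^sub>M ?Q)"
    unfolding A_def using measurable_sets[OF along_across_joint_measurable[of m] D] by (simp add: vimage_def Int_def conj_commute)
  have "c = emeasure ?P {x \<in> space ?P. (along m e x, across m e x) \<in> D}"
  proof (rule pair_prob_measure_eq[OF prob_space_gauss prob_space_gauss A])
    show "AE x in ?P. emeasure ?Q (Pair x -` A) = c"
      using c AE_space
    proof eventually_elim
      case (elim x)
      then have "Pair x -` A = {g \<in> space ?Q. (along m g x, across m g x) \<in> D}"
        by (auto simp: A_def space_pair_measure)
      then show ?case using elim by simp
    qed
    have "AE g in ?Q. g 0 \<noteq> 0" using m by (intro AE_gauss_coordinate_nonzero) auto
    then show "AE g in ?Q. emeasure ?P ((\<lambda>x. (x, g)) -` A) = emeasure ?P {x \<in> space ?P. (along m e x, across m e x) \<in> D}"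
      using AE_space
    proof eventually_elim
      case (elim g)
      have g: "(\<Sum>j<m. (g j)\<^sup>2) > 0" using elim m by (intro sum_pos2[of _ 0]) auto
      have "(\<lambda>x. (x, g)) -` A = {x \<in> space ?P. (along m g x, across m g x) \<in> D}"
        using elim by (auto simp: A_def space_pair_measure)
      then show ?case using measure_along_across_direction[OF D inv g e] by simp
    qed
  qed
  then show ?thesis ..
qed

lemma det_scaleR_zero_iff:
  fixes S :: "real^'n^'n"
  assumes "c \<noteq> 0"
  shows "det (c *\<^sub>R S) = 0 \<longleftrightarrow> det S = 0"
proof -
  have "det (c *\<^sub>R S) \<noteq> 0 \<longleftrightarrow> det S \<noteq> 0"
    unfolding det_nz_iff_kernel using assms by (simp add: scaleR_matrix_vector_assoc[symmetric])
  then show ?thesis by blast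
qed

lemma inv_form_scale:
  assumes "c > 0"
  shows "inv_form (c *\<^sub>R u) (c\<^sup>2 *\<^sub>R S) = inv_form u S"
proof (cases "det S = 0")
  case True
  then show ?thesis using assms by (simp add: inv_form_def det_scaleR_zero_iff)
next
  case False
  obtain x where x: "S *v x = u" "inv_form u S = u \<bullet> x" by (rule inv_form_solution[OF False])
  have "inv_form (c *\<^sub>R u) (c\<^sup>2 *\<^sub>R S) = (c *\<^sub>R u) \<bullet> ((1 / c) *\<^sub>R x)"
    using x False assms
    by (intro inv_form_eqI) (auto simp: det_scaleR_zero_iff scaleR_matrix_vector_assoc[symmetric] matrix_vector_mult_scaleR power2_eq_square)
  then show ?thesis using assms x by simp
qed

lemma fst_snd_borel_measurable:
  "(fst :: 'a::euclidean_space \<times> 'b::euclidean_space \<Rightarrow> 'a) \<in> borel_measurable borel"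
  "(snd :: 'a \<times> 'b \<Rightarrow> 'b) \<in> borel_measurable borel"
  by (intro borel_measurable_continuous_onI continuous_intros)+

text \<open>Both claims are about scale invariant events: singularity of \<open>across\<close>, and
  membership of the form in a set \<open>B\<close>. Given a matrix of full rank, the probability
  over a random direction comes from \<open>orthonormal_projection_of_gauss\<close>, whose law is
  the same for every orthonormal family, hence for every such matrix.\<close>

theorem Hotelling:
  fixes e :: "nat \<Rightarrow> real"
  assumes m: "CARD('d::finite) < m" and e: "(\<Sum>j<m. (e j)\<^sup>2) > 0"
  shows "AE x in gauss (mat_ix m). det (across m e x :: real^'d^'d) \<noteq> 0"
    and "distr (gauss (mat_ix m)) borel (\<lambda>x. inv_form (along m e x :: real^'d) (across m e x)) =
      distr (chi_square_distribution CARD('d) \<Otimes>\<^sub>M chi_square_distribution (m - CARD('d))) borel (\<lambda>(u, v). u / v)"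
      (is "_ = ?R")
proof -
  let ?P = "gauss (mat_ix m :: (nat \<times> 'd) set)" and ?Q = "gauss {..<m}"
  define K :: "(nat \<times> 'd \<Rightarrow> real) \<Rightarrow> (nat \<Rightarrow> real) \<Rightarrow> (real^'d) \<times> (real^'d^'d)"
    where "K x g = (along m g x, across m g x)" for x g
  have Ke[measurable]: "(\<lambda>x. K x e) \<in> borel_measurable ?P"
    unfolding K_def by (intro borel_measurable_Pair along_measurable across_measurable)
  have Kg: "K x \<in> borel_measurable ?Q" if "x \<in> space ?P" for x
    using measurable_compose[OF measurable_Pair1'[OF that, of ?Q] along_across_joint_measurable[of m]]
    by (simp add: K_def[abs_def])
  have full: "AE x in ?P. det (gram m x :: real^'d^'d) \<noteq> 0"
    using m by (intro AE_gauss_det_gram_nonzero) simp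
  have mdet: "(\<lambda>p :: (real^'d) \<times> (real^'d^'d). det (snd p)) \<in> borel_measurable borel"
    by (intro det_measurable measurable_compose[OF fst_snd_borel_measurable(2) mat_nth_measurable])
  have minv: "(\<lambda>p :: (real^'d) \<times> (real^'d^'d). inv_form (fst p) (snd p)) \<in> borel_measurable borel"
    by (intro inv_form_measurable fst_snd_borel_measurable)
  have cond: "\<exists>U :: 'd \<Rightarrow> nat \<Rightarrow> real. ortho_rows {..<m} UNIV U \<and> (AE g in ?Q. det (snd (K x g)) \<noteq> 0 \<and>
      inv_form (fst (K x g)) (snd (K x g)) =
        (\<Sum>i\<in>UNIV. (\<Sum>j<m. U i j * g j)\<^sup>2) / ((\<Sum>j<m. (g j)\<^sup>2) - (\<Sum>i\<in>UNIV. (\<Sum>j<m. U i j * g j)\<^sup>2)))"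
    if nz: "det (gram m x) \<noteq> 0" for x
  proof -
    obtain U :: "'d \<Rightarrow> nat \<Rightarrow> real" where U: "ortho_rows {..<m} UNIV U"
      "\<And>v p q. p = (\<Sum>i\<in>UNIV. (\<Sum>j<m. U i j * v j)\<^sup>2) \<Longrightarrow> q = (\<Sum>j<m. (v j)\<^sup>2) \<Longrightarrow> p < q \<Longrightarrow>
        det (across m v x) \<noteq> 0 \<and> inv_form (along m v x) (across m v x) = p / (q - p)"
      using inv_form_across[OF nz] by blast
    have "AE g in ?Q. det (snd (K x g)) \<noteq> 0 \<and>
      inv_form (fst (K x g)) (snd (K x g)) =
        (\<Sum>i\<in>UNIV. (\<Sum>j<m. U i j * g j)\<^sup>2) / ((\<Sum>j<m. (g j)\<^sup>2) - (\<Sum>i\<in>UNIV. (\<Sum>j<m. U i j * g j)\<^sup>2))"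
      using orthonormal_projection_of_gauss(2)[OF U(1) m]
      by eventually_elim (simp only: K_def fst_conv snd_conv, rule U(2)[OF refl refl])
    with U(1) show ?thesis by blast
  qed
  show "AE x in ?P. det (across m e x :: real^'d^'d) \<noteq> 0"
  proof -
    define D :: "((real^'d) \<times> (real^'d^'d)) set" where "D = {p. det (snd p) = 0}"
    have D[measurable]: "D \<in> sets borel"
      unfolding D_def using borel_measurable_vimage[OF mdet, of 0] by (simp add: vimage_def)
    have Di: "scale_invariant D" by (auto simp: scale_invariant_def D_def det_scaleR_zero_iff)
    have "emeasure ?P {x \<in> space ?P. (along m e x, across m e x) \<in> D} = 0"
    proof (rule emeasure_along_across[OF D Di e m])
      show "AE x in ?P. emeasure ?Q {g \<in> space ?Q. (along m g x, across m g x) \<in> D} = 0"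
        using full AE_space
      proof eventually_elim
        case (elim x)
        note [measurable] = Kg[OF elim(2)]
        have "AE g in ?Q. K x g \<notin> D" using cond[OF elim(1)] by (auto simp: D_def elim: AE_mp)
        then have "emeasure ?Q {g \<in> space ?Q. K x g \<in> D} = 0"
          by (subst (asm) AE_iff_measurable[OF _ refl]) auto
        then show ?case by (simp add: K_def)
      qed
    qed
    then have "emeasure ?P {x \<in> space ?P. \<not> K x e \<notin> D} = 0" by (simp add: K_def)
    then have "AE x in ?P. K x e \<notin> D"
      by (subst AE_iff_measurable[OF _ refl]) auto
    then show ?thesis by (simp add: K_def D_def)
  qed
  show "distr ?P borel (\<lambda>x. inv_form (along m e x :: real^'d) (across m e x)) = ?R"
  proof (rule measure_eqI)
    fix B assume "B \<in> sets (distr ?P borel (\<lambda>x. inv_form (along m e x :: real^'d) (across m e x)))"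
    then have B[measurable]: "B \<in> sets borel" by simp
    define D :: "((real^'d) \<times> (real^'d^'d)) set" where "D = {p. inv_form (fst p) (snd p) \<in> B}"
    have D[measurable]: "D \<in> sets borel"
      unfolding D_def using measurable_sets[OF minv B] by (simp add: vimage_def)
    have Di: "scale_invariant D" by (auto simp: scale_invariant_def D_def inv_form_scale)
    have "emeasure ?P {x \<in> space ?P. (along m e x, across m e x) \<in> D} = emeasure ?R B"
    proof (rule emeasure_along_across[OF D Di e m])
      show "AE x in ?P. emeasure ?Q {g \<in> space ?Q. (along m g x, across m g x) \<in> D} = emeasure ?R B"
        using full AE_space
      proof eventually_elim
        case (elim x)
        note [measurable] = Kg[OF elim(2)]
        obtain U :: "'d \<Rightarrow> nat \<Rightarrow> real" where U: "ortho_rows {..<m} UNIV U" "AE g in ?Q. det (snd (K x g)) \<noteq> 0 \<and>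
          inv_form (fst (K x g)) (snd (K x g)) =
          (\<Sum>i\<in>UNIV. (\<Sum>j<m. U i j * g j)\<^sup>2) / ((\<Sum>j<m. (g j)\<^sup>2) - (\<Sum>i\<in>UNIV. (\<Sum>j<m. U i j * g j)\<^sup>2))"
          using cond[OF elim(1)] by blast
        define f where "f g = (\<Sum>i\<in>UNIV. (\<Sum>j<m. U i j * g j)\<^sup>2) / ((\<Sum>j<m. (g j)\<^sup>2) - (\<Sum>i\<in>UNIV. (\<Sum>j<m. U i j * g j)\<^sup>2))" for g
        have [measurable]: "(\<lambda>g. g j) \<in> borel_measurable ?Q" if "j < m" for j
          using that by (intro gauss_coordinate_measurable) auto
        have f[measurable]: "f \<in> borel_measurable ?Q" unfolding f_def by measurable
        have "emeasure ?Q {g \<in> space ?Q. K x g \<in> D} = emeasure ?Q {g \<in> space ?Q. f g \<in> B}"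
        proof (rule emeasure_eq_AE)
          show "AE g in ?Q. g \<in> {g \<in> space ?Q. K x g \<in> D} \<longleftrightarrow> g \<in> {g \<in> space ?Q. f g \<in> B}"
            using U(2) by (auto simp: D_def f_def elim: AE_mp)
        qed measurable
        also have "\<dots> = emeasure (distr ?Q borel f) B"
          by (subst emeasure_distr) (auto simp: vimage_def Int_def conj_commute)
        also have "distr ?Q borel f = ?R"
          unfolding f_def by (rule orthonormal_projection_of_gauss(1)[OF U(1) m])
        finally show ?case by (simp add: K_def)
      qed
    qed
    moreover have "(\<lambda>x. inv_form (fst (K x e)) (snd (K x e))) \<in> borel_measurable ?P"
      by (rule measurable_compose[OF Ke minv])
    ultimately show "emeasure (distr ?P borel (\<lambda>x. inv_form (along m e x :: real^'d) (across m e x))) B = emeasure ?R B"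
      by (subst emeasure_distr) (auto simp: D_def K_def vimage_def Int_def conj_commute)
  qed simp
qed

section \<open>The limit law of the quadratic form\<close>

definition raw_form :: "(real^'d) \<times> (real^'d^'d) \<Rightarrow> real" where
  "raw_form p = fst p \<bullet> (matrix_inv (snd p) *v fst p)"

text \<open>\<open>raw_form\<close> is the form as it occurs in the theorem, with the arbitrary
  inverse of a singular matrix; here it is split into one fixed quadratic form on the singular set
  and \<open>inv_form\<close> elsewhere.\<close>

lemma raw_form_eq:
  "raw_form p = (if det (snd p) = 0 then fst p \<bullet> ((SOME A. False) *v fst p) else inv_form (fst p) (snd p))"
  by (simp add: raw_form_def inv_form_def matrix_inv_singular)

lemma matrix_vector_measurable:
  fixes A :: "real^'n^'m"
  shows "(\<lambda>x. A *v x) \<in> borel_measurable borel"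
  by (intro borel_measurable_continuous_onI linear_continuous_on linear_conv_bounded_linear[THEN iffD1]) simp

lemma raw_form_measurable[measurable]: "raw_form \<in> borel_measurable borel"
proof -
  note [measurable] = fst_snd_borel_measurable matrix_vector_measurable
  have 1[measurable]: "(\<lambda>p :: (real^'d) \<times> (real^'d^'d). det (snd p)) \<in> borel_measurable borel"
    by (intro det_measurable measurable_compose[OF fst_snd_borel_measurable(2) mat_nth_measurable])
  have 2[measurable]: "(\<lambda>p :: (real^'d) \<times> (real^'d^'d). inv_form (fst p) (snd p)) \<in> borel_measurable borel"
    by (intro inv_form_measurable fst_snd_borel_measurable)
  have 3[measurable]: "(\<lambda>p :: (real^'d) \<times> (real^'d^'d). A *v fst p) \<in> borel_measurable borel" for A :: "real^'d^'d"
    by (rule measurable_compose[OF fst_snd_borel_measurable(1) matrix_vector_measurable])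
  show ?thesis unfolding raw_form_eq[abs_def] by measurable
qed

text \<open>For \<open>p = (\<Sum>\<^sub>j G\<^sub>j, \<Sum>\<^sub>j G\<^sub>j G\<^sub>j\<^sup>T)\<close> with the normalized block sums \<open>G\<^sub>j\<close>, these are the asymptotic
  equivalents of the normalized estimation error and of the jackknife matrix.\<close>

definition mean_scatter :: "nat \<Rightarrow> (real^'d) \<times> (real^'d^'d) \<Rightarrow> (real^'d) \<times> (real^'d^'d)" where
  "mean_scatter m p = ((1 / sqrt (real m)) *\<^sub>R fst p,
     (1 / (real m - 1)) *\<^sub>R (snd p - (1 / real m) *\<^sub>R outer_product (fst p) (fst p)))"

definition vec_moments :: "real^'d \<Rightarrow> (real^'d) \<times> (real^'d^'d)" where
  "vec_moments v = (v, outer_product v v)"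

lemma continuous_on_outer_product[continuous_intros]:
  assumes "continuous_on T f" "continuous_on T g"
  shows "continuous_on T (\<lambda>x. outer_product (f x) (g x))"
  unfolding outer_product_def using assms by (intro continuous_on_vec_lambda continuous_on_mult continuous_on_component)

lemma norm_outer_product: "norm (outer_product v w :: real^'n^'k) = norm v * norm w"
proof -
  have "outer_product v w $ i = v $ i *\<^sub>R w" for i by (simp add: outer_product_def vec_eq_iff)
  then have "norm (outer_product v w) = L2_set (\<lambda>i. \<bar>v $ i\<bar> * norm w) UNIV" by (simp add: norm_vec_def[of "outer_product v w"])
  also have "\<dots> = L2_set (\<lambda>i. \<bar>v $ i\<bar>) UNIV * norm w" by (rule L2_set_left_distrib[symmetric]) simp
  also have "L2_set (\<lambda>i. \<bar>v $ i\<bar>) UNIV = norm v" by (simp add: norm_vec_def[of v])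
  finally show ?thesis .
qed

lemma continuous_on_mean_scatter: "continuous_on T (mean_scatter m)"
  unfolding mean_scatter_def[abs_def] by (intro continuous_intros)

lemma continuous_on_vec_moments: "continuous_on T vec_moments"
  unfolding vec_moments_def[abs_def] by (intro continuous_intros)

lemma mean_scatter_measurable: "mean_scatter m \<in> borel_measurable borel"
  by (intro borel_measurable_continuous_onI continuous_on_mean_scatter)

lemma vec_moments_measurable: "vec_moments \<in> borel_measurable borel"
  by (intro borel_measurable_continuous_onI continuous_on_vec_moments)

lemma inner_matrix_vec: "(B *v x) \<bullet> y = x \<bullet> (transpose B *v (y::real^'n))"
  by (metis dot_lmul_matrix inner_commute transpose_matrix_vector)

lemma F_distribution_scaled:
  assumes d: "0 < d" "d < m"
  shows "distr (F_distribution d (m - d)) borel (\<lambda>f. real d * (real m - 1) * f / (real m - real d)) =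
    distr (chi_square_distribution d \<Otimes>\<^sub>M chi_square_distribution (m - d)) borel (\<lambda>(u, v). (real m - 1) * (u / v))"
proof -
  have [measurable]: "(\<lambda>(u, v). (u / real d) / (v / real (m - d))) \<in> borel_measurable (chi_square_distribution d \<Otimes>\<^sub>M chi_square_distribution (m - d))"
    by measurable
  have "distr (F_distribution d (m - d)) borel (\<lambda>f. real d * (real m - 1) * f / (real m - real d)) =
    distr (chi_square_distribution d \<Otimes>\<^sub>M chi_square_distribution (m - d)) borel
     ((\<lambda>f. real d * (real m - 1) * f / (real m - real d)) \<circ> (\<lambda>(u, v). (u / real d) / (v / real (m - d))))"
    unfolding F_distribution_def by (rule distr_distr) measurable
  also have "\<dots> = distr (chi_square_distribution d \<Otimes>\<^sub>M chi_square_distribution (m - d)) borel (\<lambda>(u, v). (real m - 1) * (u / v))"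
  proof (intro distr_cong refl)
    \<comment> \<open>The degrees of freedom cancel. For v = 0 both sides are 0, so the identity
      holds everywhere and not only almost everywhere.\<close>
    have "real d * (real m - 1) * ((u / real d) / (v / s)) / s = (real m - 1) * (u / v)" if "s > 0" for u v s :: real
      using that d by (cases "v = 0") (auto simp: field_simps)
    from this[of "real m - real d"]
    show "((\<lambda>f. real d * (real m - 1) * f / (real m - real d)) \<circ> (\<lambda>(u, v). (u / real d) / (v / real (m - d)))) x =
        (\<lambda>(u, v). (real m - 1) * (u / v)) x" for x
      using d by (cases x) (simp add: of_nat_diff)
  qed
  finally show ?thesis .
qed

text \<open>With a and A standing for \<open>along\<close> and \<open>across\<close> in the unit
  direction (1, ..., 1) / sqrt m, the normalized mean is B a and the scatter matrix is B A B^T / (m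
  - 1). In the quadratic form B cancels, so the covariance drops out and m - 1 times Hotelling's
  ratio remains.\<close>

theorem mean_scatter_limit_law:
  fixes B :: "real^'d^'d"
  assumes B: "det B \<noteq> 0" and m: "CARD('d) < m"
  defines "H \<equiv> \<lambda>x :: nat \<times> 'd \<Rightarrow> real. \<Sum>j<m. vec_moments (B *v col_vec x j)"
  shows "AE x in gauss (mat_ix m). det (snd (mean_scatter m (H x))) \<noteq> 0"
    and "distr (gauss (mat_ix m)) borel (\<lambda>x. raw_form (mean_scatter m (H x))) =
      distr (F_distribution CARD('d) (m - CARD('d))) borel
        (\<lambda>f. real CARD('d) * (real m - 1) * f / (real m - real CARD('d)))"
    and "H \<in> borel_measurable (gauss (mat_ix m))"
proof -
  let ?P = "gauss (mat_ix m :: (nat \<times> 'd) set)"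
  define e where "e j = 1 / sqrt (real m)" for j :: nat
  have d: "0 < CARD('d)" by simp
  have m1: "real m > 1" "m > 0" using m d by linarith+
  have e1: "(\<Sum>j<m. (e j)\<^sup>2) = 1" using m1 by (simp add: e_def power_divide)
  have fstH: "fst (H x) = B *v (\<Sum>j<m. col_vec x j)" for x
    by (simp add: H_def fst_sum vec_moments_def matrix_vector_mult_sum)
  have sndH: "snd (H x) = (\<Sum>j<m. outer_product (B *v col_vec x j) (B *v col_vec x j))" for x
    by (simp add: H_def snd_sum vec_moments_def)
  have along: "along m e x = (1 / sqrt (real m)) *\<^sub>R (\<Sum>j<m. col_vec x j)" for x :: "nat \<times> 'd \<Rightarrow> real"
    by (simp add: along_def e_def scaleR_sum_right)
  have U: "fst (mean_scatter m (H x)) = B *v along m e x" for x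
    by (simp add: mean_scatter_def fstH along matrix_vector_mult_scaleR)
  have S: "snd (mean_scatter m (H x)) *v y = (1 / (real m - 1)) *\<^sub>R (B *v (across m e x *v (transpose B *v y)))" for x y
  proof -
    let ?s = "\<Sum>j<m. col_vec x j"
    have "snd (mean_scatter m (H x)) *v y = (1 / (real m - 1)) *\<^sub>R
      ((\<Sum>j<m. ((B *v col_vec x j) \<bullet> y) *\<^sub>R (B *v col_vec x j)) - (1 / real m) *\<^sub>R (((B *v ?s) \<bullet> y) *\<^sub>R (B *v ?s)))"
      by (simp add: mean_scatter_def fstH sndH scaleR_matrix_vector_assoc[symmetric] matrix_vector_mult_diff_rdistrib
          sum_matrix_vector_mult outer_product_mult_vec)
    also have "(1 / real m) *\<^sub>R (((B *v ?s) \<bullet> y) *\<^sub>R (B *v ?s)) = ((B *v along m e x) \<bullet> y) *\<^sub>R (B *v along m e x)"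
      using m1 by (simp add: along matrix_vector_mult_scaleR)
    also have "(\<Sum>j<m. ((B *v col_vec x j) \<bullet> y) *\<^sub>R (B *v col_vec x j)) = B *v (gram m x *v (transpose B *v y))"
      by (simp add: gram_mult_vec matrix_vector_mult_sum matrix_vector_mult_scaleR inner_matrix_vec)
    finally show ?thesis
      by (simp add: across_mult_vec e1 matrix_vector_mult_diff_distrib matrix_vector_mult_scaleR inner_matrix_vec)
  qed
  have Bt: "det (transpose B) \<noteq> 0" using B by simp
  have nz: "det (snd (mean_scatter m (H x))) \<noteq> 0" if "det (across m e x) \<noteq> 0" for x
    unfolding det_nz_iff_kernel
  proof (intro allI impI)
    fix y assume "snd (mean_scatter m (H x)) *v y = 0"
    then have "B *v (across m e x *v (transpose B *v y)) = 0" using m1 by (simp add: S)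
    then have "across m e x *v (transpose B *v y) = 0" using B unfolding det_nz_iff_kernel by blast
    then have "transpose B *v y = 0" using that unfolding det_nz_iff_kernel by blast
    then show "y = 0" using Bt unfolding det_nz_iff_kernel by blast
  qed
  have AEnz: "AE x in ?P. det (across m e x) \<noteq> 0" using m e1 by (intro Hotelling(1)) auto
  then show "AE x in ?P. det (snd (mean_scatter m (H x))) \<noteq> 0"
    by eventually_elim (rule nz)
  have val: "raw_form (mean_scatter m (H x)) = (real m - 1) * inv_form (along m e x) (across m e x)"
    if c: "det (across m e x) \<noteq> 0" for x
  proof -
    obtain z where z: "across m e x *v z = along m e x" "inv_form (along m e x) (across m e x) = along m e x \<bullet> z"
      by (rule inv_form_solution[OF c])
    \<comment> \<open>If z solves A z = a, then y = (m - 1) B^{-T} z solves the equation for the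
      scatter matrix, as B A B^T y / (m - 1) = B A z = B a.\<close>
    define y where "y = (real m - 1) *\<^sub>R (matrix_inv (transpose B) *v z)"
    have y: "transpose B *v y = (real m - 1) *\<^sub>R z"
      using matrix_inv_mult(1)[OF Bt] by (simp add: y_def matrix_vector_mult_scaleR matrix_vector_mul_assoc)
    have "raw_form (mean_scatter m (H x)) = inv_form (fst (mean_scatter m (H x))) (snd (mean_scatter m (H x)))"
      using nz[OF c] by (simp add: raw_form_eq)
    also have "\<dots> = fst (mean_scatter m (H x)) \<bullet> y"
      by (rule inv_form_eqI[OF nz[OF c]]) (simp only: S U y matrix_vector_mult_scaleR z, use m1 in simp)
    also have "\<dots> = (real m - 1) * (along m e x \<bullet> z)" by (simp only: U inner_matrix_vec y inner_scaleR_right)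
    finally show ?thesis by (simp add: z)
  qed
  have [measurable]: "(\<lambda>x. col_vec x j :: real^'d) \<in> borel_measurable ?P" if "j < m" for j
    using col_vec_measurable[OF that] by (simp add: measurable_cong_sets[OF sets_gauss refl])
  have [measurable]: "(\<lambda>x. vec_moments (B *v col_vec x j)) \<in> borel_measurable ?P" if "j < m" for j
    using that by (intro measurable_compose[OF _ vec_moments_measurable] measurable_compose[OF _ matrix_vector_measurable]) auto
  show H[measurable]: "H \<in> borel_measurable ?P"
    unfolding H_def by (intro borel_measurable_sum) auto
  have ms[measurable]: "mean_scatter m \<in> borel_measurable (borel :: ((real^'d) \<times> (real^'d^'d)) measure)"
    by (rule mean_scatter_measurable)
  have [measurable]: "(\<lambda>x. inv_form (along m e x :: real^'d) (across m e x)) \<in> borel_measurable ?P"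
    by (intro inv_form_measurable along_measurable across_measurable)
  have "distr ?P borel (\<lambda>x. raw_form (mean_scatter m (H x))) =
    distr ?P borel (\<lambda>x. (real m - 1) * inv_form (along m e x :: real^'d) (across m e x))"
  proof (rule distr_cong_AE)
    show "AE x in ?P. raw_form (mean_scatter m (H x)) = (real m - 1) * inv_form (along m e x) (across m e x)"
      using AEnz by eventually_elim (rule val)
  qed auto
  also have "\<dots> = distr (distr ?P borel (\<lambda>x. inv_form (along m e x :: real^'d) (across m e x))) borel ((*) (real m - 1))"
    by (subst distr_distr) (auto simp: o_def)
  also have "\<dots> = distr (distr (chi_square_distribution CARD('d) \<Otimes>\<^sub>M chi_square_distribution (m - CARD('d))) borel (\<lambda>(u, v). u / v)) borel ((*) (real m - 1))"
    using m e1 by (subst Hotelling(2)) auto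
  also have "\<dots> = distr (chi_square_distribution CARD('d) \<Otimes>\<^sub>M chi_square_distribution (m - CARD('d))) borel (\<lambda>(u, v). (real m - 1) * (u / v))"
    by (subst distr_distr) (auto simp: o_def case_prod_unfold)
  finally show "distr ?P borel (\<lambda>x. raw_form (mean_scatter m (H x))) =
      distr (F_distribution CARD('d) (m - CARD('d))) borel
        (\<lambda>f. real CARD('d) * (real m - 1) * f / (real m - real CARD('d)))"
    by (subst F_distribution_scaled[OF d m])
qed

section \<open>Convergence in probability and in law\<close>

context prob_space begin

lemma eventually_prob_mono_le:
  assumes "\<forall>\<^sub>F n in sequentially. prob (B n) \<le> e" "\<And>n. A n \<subseteq> B n" "\<And>n. B n \<in> events"
  shows "\<forall>\<^sub>F n in sequentially. prob (A n) \<le> e"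
  using assms(1) by eventually_elim (meson assms(2,3) finite_measure_mono order_trans)

lemma in_probability_iff:
  "in_probability_to_zero M Z \<longleftrightarrow>
     (\<forall>\<epsilon>>0. \<forall>\<delta>>0. \<forall>\<^sub>F n in sequentially. prob {\<omega> \<in> space M. norm (Z n \<omega>) > \<epsilon>} \<le> \<delta>)"
proof -
  have "(\<lambda>n. prob (A n)) \<longlonglongrightarrow> 0 \<longleftrightarrow> (\<forall>\<delta>>0. \<forall>\<^sub>F n in sequentially. prob (A n) \<le> \<delta>)" for A :: "nat \<Rightarrow> 'a set"
  proof
    assume "(\<lambda>n. prob (A n)) \<longlonglongrightarrow> 0"
    then show "\<forall>\<delta>>0. \<forall>\<^sub>F n in sequentially. prob (A n) \<le> \<delta>"
      by (auto dest!: order_tendstoD(2) elim: eventually_mono)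
  next
    assume *: "\<forall>\<delta>>0. \<forall>\<^sub>F n in sequentially. prob (A n) \<le> \<delta>"
    show "(\<lambda>n. prob (A n)) \<longlonglongrightarrow> 0"
    proof (rule tendstoI)
      fix e :: real assume "e > 0"
      then have "\<forall>\<^sub>F n in sequentially. prob (A n) \<le> e / 2" using *[rule_format, of "e / 2"] \<open>e > 0\<close> by simp
      then show "\<forall>\<^sub>F n in sequentially. dist (prob (A n)) 0 < e"
        by eventually_elim (use \<open>e > 0\<close> in \<open>auto simp: dist_real_def\<close>)
    qed
  qed
  then show ?thesis by (simp add: in_probability_to_zero_def)
qed

lemma in_probabilityD:
  "in_probability_to_zero M Z \<Longrightarrow> \<epsilon> > 0 \<Longrightarrow> \<delta> > 0 \<Longrightarrow>
    \<forall>\<^sub>F n in sequentially. prob {\<omega> \<in> space M. norm (Z n \<omega>) > \<epsilon>} \<le> \<delta>"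
  by (simp add: in_probability_iff)

lemma in_probability_to_zero_le:
  assumes "in_probability_to_zero M Z" and [measurable]: "\<And>n. Z n \<in> borel_measurable M"
    and le: "\<And>n \<omega>. \<omega> \<in> space M \<Longrightarrow> norm (W n \<omega>) \<le> norm (Z n \<omega>)"
  shows "in_probability_to_zero M W"
  unfolding in_probability_iff
proof (intro allI impI)
  fix \<epsilon> \<delta> :: real assume "\<epsilon> > 0" "\<delta> > 0"
  then have "\<forall>\<^sub>F n in sequentially. prob {\<omega> \<in> space M. norm (Z n \<omega>) > \<epsilon>} \<le> \<delta>"
    using assms(1) by (simp add: in_probability_iff)
  then show "\<forall>\<^sub>F n in sequentially. prob {\<omega> \<in> space M. norm (W n \<omega>) > \<epsilon>} \<le> \<delta>"
  proof (rule eventually_prob_mono_le)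
    show "{\<omega> \<in> space M. norm (W n \<omega>) > \<epsilon>} \<subseteq> {\<omega> \<in> space M. norm (Z n \<omega>) > \<epsilon>}" for n
      using le[of _ n] by force
  qed measurable
qed

lemma in_probability_to_zero_add:
  fixes Z W :: "nat \<Rightarrow> 'a \<Rightarrow> 'b::{real_normed_vector, second_countable_topology}"
  assumes Z: "in_probability_to_zero M Z" and W: "in_probability_to_zero M W"
    and [measurable]: "\<And>n. Z n \<in> borel_measurable M" "\<And>n. W n \<in> borel_measurable M"
  shows "in_probability_to_zero M (\<lambda>n \<omega>. Z n \<omega> + W n \<omega>)"
  unfolding in_probability_iff
proof (intro allI impI)
  fix \<epsilon> \<delta> :: real assume e: "\<epsilon> > 0" "\<delta> > 0"
  have "\<forall>\<^sub>F n in sequentially. prob {\<omega> \<in> space M. norm (Z n \<omega>) > \<epsilon>/2} \<le> \<delta>/2"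
    "\<forall>\<^sub>F n in sequentially. prob {\<omega> \<in> space M. norm (W n \<omega>) > \<epsilon>/2} \<le> \<delta>/2"
    by (rule in_probabilityD[OF Z] in_probabilityD[OF W]; use e in simp)+
  then show "\<forall>\<^sub>F n in sequentially. prob {\<omega> \<in> space M. norm (Z n \<omega> + W n \<omega>) > \<epsilon>} \<le> \<delta>"
  proof eventually_elim
    case (elim n)
    have "prob {\<omega> \<in> space M. norm (Z n \<omega> + W n \<omega>) > \<epsilon>} \<le>
      prob ({\<omega> \<in> space M. norm (Z n \<omega>) > \<epsilon>/2} \<union> {\<omega> \<in> space M. norm (W n \<omega>) > \<epsilon>/2})"
    proof (rule finite_measure_mono)
      show "{\<omega> \<in> space M. norm (Z n \<omega> + W n \<omega>) > \<epsilon>} \<subseteq>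
        {\<omega> \<in> space M. norm (Z n \<omega>) > \<epsilon>/2} \<union> {\<omega> \<in> space M. norm (W n \<omega>) > \<epsilon>/2}"
      proof
        fix \<omega> assume w: "\<omega> \<in> {\<omega> \<in> space M. norm (Z n \<omega> + W n \<omega>) > \<epsilon>}"
        then have "norm (Z n \<omega>) > \<epsilon>/2 \<or> norm (W n \<omega>) > \<epsilon>/2"
          using norm_triangle_ineq[of "Z n \<omega>" "W n \<omega>"] by (simp, linarith)
        with w show "\<omega> \<in> {\<omega> \<in> space M. norm (Z n \<omega>) > \<epsilon>/2} \<union> {\<omega> \<in> space M. norm (W n \<omega>) > \<epsilon>/2}" by auto
      qed
    qed measurable
    also have "\<dots> \<le> prob {\<omega> \<in> space M. norm (Z n \<omega>) > \<epsilon>/2} + prob {\<omega> \<in> space M. norm (W n \<omega>) > \<epsilon>/2}"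
      by (rule measure_Un_le) measurable
    finally show ?case using elim by simp
  qed
qed

lemma in_probability_to_zero_sum:
  fixes Z :: "'i \<Rightarrow> nat \<Rightarrow> 'a \<Rightarrow> 'b::{real_normed_vector, second_countable_topology}"
  assumes "\<And>i. i \<in> I \<Longrightarrow> in_probability_to_zero M (Z i)" "\<And>i n. i \<in> I \<Longrightarrow> Z i n \<in> borel_measurable M"
  shows "in_probability_to_zero M (\<lambda>n \<omega>. \<Sum>i\<in>I. Z i n \<omega>)"
  using assms
proof (induction I rule: infinite_finite_induct)
  case (insert i I)
  then show ?case by (simp add: in_probability_to_zero_add)
qed (auto simp: in_probability_to_zero_def)

lemma in_probability_to_zero_norm:
  "in_probability_to_zero M (\<lambda>n \<omega>. norm (Z n \<omega>)) \<longleftrightarrow> in_probability_to_zero M Z"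
  by (simp add: in_probability_to_zero_def)

lemma in_probability_to_zero_mult_tight:
  fixes Z :: "nat \<Rightarrow> 'a \<Rightarrow> 'b::{real_normed_vector, second_countable_topology}"
    and W :: "nat \<Rightarrow> 'a \<Rightarrow> 'c::{real_normed_vector, second_countable_topology}"
  assumes Z: "in_probability_to_zero M Z" and W: "tight_seq M W"
    and [measurable]: "\<And>n. Z n \<in> borel_measurable M" "\<And>n. W n \<in> borel_measurable M"
  shows "in_probability_to_zero M (\<lambda>n \<omega>. norm (Z n \<omega>) * norm (W n \<omega>))"
  unfolding in_probability_iff
proof (intro allI impI)
  fix \<epsilon> \<delta> :: real assume e: "\<epsilon> > 0" "\<delta> > 0"
  obtain R where R: "\<forall>\<^sub>F n in sequentially. prob {\<omega> \<in> space M. norm (W n \<omega>) > R} \<le> \<delta>/2"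
    using W e unfolding tight_seq_def by (meson half_gt_zero)
  \<comment> \<open>The tightness threshold R may be zero or negative; |R| + 1 is positive and
    dominates it.\<close>
  define r where "r = \<epsilon> / (\<bar>R\<bar> + 1)"
  have r: "r > 0" using e by (simp add: r_def)
  have "\<forall>\<^sub>F n in sequentially. prob {\<omega> \<in> space M. norm (Z n \<omega>) > r} \<le> \<delta>/2"
    by (rule in_probabilityD[OF Z]; use e r in simp)
  with R show "\<forall>\<^sub>F n in sequentially. prob {\<omega> \<in> space M. norm (norm (Z n \<omega>) * norm (W n \<omega>)) > \<epsilon>} \<le> \<delta>"
  proof eventually_elim
    case (elim n)
    have "prob {\<omega> \<in> space M. norm (norm (Z n \<omega>) * norm (W n \<omega>)) > \<epsilon>} \<le>
      prob ({\<omega> \<in> space M. norm (W n \<omega>) > R} \<union> {\<omega> \<in> space M. norm (Z n \<omega>) > r})"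
    proof (rule finite_measure_mono)
      have "norm (Z n \<omega>) * norm (W n \<omega>) \<le> \<epsilon>" if "norm (W n \<omega>) \<le> R" "norm (Z n \<omega>) \<le> r" for \<omega>
      proof -
        have "norm (Z n \<omega>) * norm (W n \<omega>) \<le> r * (\<bar>R\<bar> + 1)" using that r by (intro mult_mono) auto
        also have "\<dots> = \<epsilon>" by (simp add: r_def)
        finally show ?thesis .
      qed
      then show "{\<omega> \<in> space M. norm (norm (Z n \<omega>) * norm (W n \<omega>)) > \<epsilon>} \<subseteq>
        {\<omega> \<in> space M. norm (W n \<omega>) > R} \<union> {\<omega> \<in> space M. norm (Z n \<omega>) > r}"
        by (fastforce simp: abs_mult not_le[symmetric])
    qed measurable
    also have "\<dots> \<le> prob {\<omega> \<in> space M. norm (W n \<omega>) > R} + prob {\<omega> \<in> space M. norm (Z n \<omega>) > r}"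
      by (rule measure_Un_le) measurable
    finally show ?case using elim by simp
  qed
qed

lemma in_probability_to_zero_const:
  assumes "c \<longlonglongrightarrow> (0 :: 'b::real_normed_vector)"
  shows "in_probability_to_zero M (\<lambda>n \<omega>. c n)"
  unfolding in_probability_iff
proof (intro allI impI)
  fix \<epsilon> \<delta> :: real assume e: "\<epsilon> > 0" "\<delta> > 0"
  have "\<forall>\<^sub>F n in sequentially. norm (c n) < \<epsilon>" using assms e by (auto simp: tendsto_iff)
  then show "\<forall>\<^sub>F n in sequentially. prob {\<omega> \<in> space M. norm (c n) > \<epsilon>} \<le> \<delta>"
    by eventually_elim (use e in auto)
qed

lemma tight_seq_add:
  fixes Z W :: "nat \<Rightarrow> 'a \<Rightarrow> 'b::{real_normed_vector, second_countable_topology}"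
  assumes Z: "tight_seq M Z" and W: "tight_seq M W"
    and [measurable]: "\<And>n. Z n \<in> borel_measurable M" "\<And>n. W n \<in> borel_measurable M"
  shows "tight_seq M (\<lambda>n \<omega>. Z n \<omega> + W n \<omega>)"
  unfolding tight_seq_def
proof (intro allI impI)
  fix \<delta> :: real assume e: "\<delta> > 0"
  obtain R where R: "\<forall>\<^sub>F n in sequentially. prob {\<omega> \<in> space M. norm (Z n \<omega>) > R} \<le> \<delta>/2"
    using Z e unfolding tight_seq_def by (meson half_gt_zero)
  obtain R' where R': "\<forall>\<^sub>F n in sequentially. prob {\<omega> \<in> space M. norm (W n \<omega>) > R'} \<le> \<delta>/2"
    using W e unfolding tight_seq_def by (meson half_gt_zero)
  from R R' have "\<forall>\<^sub>F n in sequentially. prob {\<omega> \<in> space M. norm (Z n \<omega> + W n \<omega>) > R + R'} \<le> \<delta>"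
  proof eventually_elim
    case (elim n)
    have "prob {\<omega> \<in> space M. norm (Z n \<omega> + W n \<omega>) > R + R'} \<le>
      prob ({\<omega> \<in> space M. norm (Z n \<omega>) > R} \<union> {\<omega> \<in> space M. norm (W n \<omega>) > R'})"
    proof (rule finite_measure_mono)
      show "{\<omega> \<in> space M. norm (Z n \<omega> + W n \<omega>) > R + R'} \<subseteq>
        {\<omega> \<in> space M. norm (Z n \<omega>) > R} \<union> {\<omega> \<in> space M. norm (W n \<omega>) > R'}"
      proof
        fix \<omega> assume w: "\<omega> \<in> {\<omega> \<in> space M. norm (Z n \<omega> + W n \<omega>) > R + R'}"
        then have "norm (Z n \<omega>) > R \<or> norm (W n \<omega>) > R'"
          using norm_triangle_ineq[of "Z n \<omega>" "W n \<omega>"] by (simp, linarith)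
        with w show "\<omega> \<in> {\<omega> \<in> space M. norm (Z n \<omega>) > R} \<union> {\<omega> \<in> space M. norm (W n \<omega>) > R'}" by auto
      qed
    qed measurable
    also have "\<dots> \<le> prob {\<omega> \<in> space M. norm (Z n \<omega>) > R} + prob {\<omega> \<in> space M. norm (W n \<omega>) > R'}"
      by (rule measure_Un_le) measurable
    finally show ?case using elim by simp
  qed
  then show "\<exists>R. \<forall>\<^sub>F n in sequentially. prob {\<omega> \<in> space M. norm (Z n \<omega> + W n \<omega>) > R} \<le> \<delta>" by blast
qed

lemma tight_seq_sum:
  fixes Z :: "'i \<Rightarrow> nat \<Rightarrow> 'a \<Rightarrow> 'b::{real_normed_vector, second_countable_topology}"
  assumes "\<And>i. i \<in> I \<Longrightarrow> tight_seq M (Z i)" "\<And>i n. i \<in> I \<Longrightarrow> Z i n \<in> borel_measurable M"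
  shows "tight_seq M (\<lambda>n \<omega>. \<Sum>i\<in>I. Z i n \<omega>)"
  using assms
proof (induction I rule: infinite_finite_induct)
  case (insert i I)
  then show ?case by (simp add: tight_seq_add)
qed (auto simp: tight_seq_def intro!: exI[of _ 0])

lemma in_probability_to_zero_imp_tight: "in_probability_to_zero M Z \<Longrightarrow> tight_seq M Z"
  unfolding in_probability_iff tight_seq_def by (meson zero_less_one)

lemma tight_seq_continuous_image:
  fixes Z :: "nat \<Rightarrow> 'a \<Rightarrow> 'b::euclidean_space" and g :: "'b \<Rightarrow> 'c::real_normed_vector"
  assumes Z: "tight_seq M Z" and [measurable]: "\<And>n. Z n \<in> borel_measurable M"
    and g: "continuous_on UNIV g"
  shows "tight_seq M (\<lambda>n \<omega>. g (Z n \<omega>))"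
  unfolding tight_seq_def
proof (intro allI impI)
  fix \<delta> :: real assume e: "\<delta> > 0"
  obtain R where R: "\<forall>\<^sub>F n in sequentially. prob {\<omega> \<in> space M. norm (Z n \<omega>) > R} \<le> \<delta>"
    using Z e unfolding tight_seq_def by meson
  have "bounded (g ` cball 0 R)"
    by (intro compact_imp_bounded compact_continuous_image continuous_on_subset[OF g]) auto
  then obtain C where "\<forall>y\<in>g ` cball 0 R. norm y \<le> C" unfolding bounded_iff by blast
  then have C: "norm (g x) \<le> C" if "norm x \<le> R" for x using that by simp
  have "\<forall>\<^sub>F n in sequentially. prob {\<omega> \<in> space M. norm (g (Z n \<omega>)) > C} \<le> \<delta>"
    using R by (rule eventually_prob_mono_le) (use C in \<open>auto simp: not_le[symmetric]\<close>)
  then show "\<exists>R. \<forall>\<^sub>F n in sequentially. prob {\<omega> \<in> space M. norm (g (Z n \<omega>)) > R} \<le> \<delta>" by blast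
qed

lemma tight_seq_scaleR:
  fixes Z :: "nat \<Rightarrow> 'a \<Rightarrow> 'b::euclidean_space"
  assumes "tight_seq M Z" "\<And>n. Z n \<in> borel_measurable M"
  shows "tight_seq M (\<lambda>n \<omega>. c *\<^sub>R Z n \<omega>)"
  by (rule tight_seq_continuous_image[OF assms]) (intro continuous_intros)

lemma in_probability_to_zero_scaleR:
  fixes Z :: "nat \<Rightarrow> 'a \<Rightarrow> 'b::{real_normed_vector, second_countable_topology}"
  assumes "in_probability_to_zero M Z" "\<And>n. Z n \<in> borel_measurable M"
  shows "in_probability_to_zero M (\<lambda>n \<omega>. c *\<^sub>R Z n \<omega>)"
proof -
  have "tight_seq M (\<lambda>n \<omega>. c)" by (auto simp: tight_seq_def intro!: exI[of _ "norm c"])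
  from in_probability_to_zero_mult_tight[OF assms(1) this assms(2)]
  show ?thesis by (simp add: in_probability_to_zero_def mult.commute)
qed

text \<open>Domination almost everywhere is needed because the draw is a list of the right length
  with distinct entries only almost surely.\<close>

lemma in_probability_to_zero_AE_le:
  assumes "in_probability_to_zero M Z" and [measurable]: "\<And>n. Z n \<in> borel_measurable M"
    and le: "\<And>n. AE \<omega> in M. norm (W n \<omega>) \<le> norm (Z n \<omega>)"
  shows "in_probability_to_zero M W"
  unfolding in_probability_iff
proof (intro allI impI)
  fix \<epsilon> \<delta> :: real assume "\<epsilon> > 0" "\<delta> > 0"
  then have "\<forall>\<^sub>F n in sequentially. prob {\<omega> \<in> space M. norm (Z n \<omega>) > \<epsilon>} \<le> \<delta>"
    using assms(1) by (rule in_probabilityD[rotated])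
  then show "\<forall>\<^sub>F n in sequentially. prob {\<omega> \<in> space M. norm (W n \<omega>) > \<epsilon>} \<le> \<delta>"
  proof eventually_elim
    case (elim n)
    have "AE \<omega> in M. \<omega> \<in> {\<omega> \<in> space M. norm (W n \<omega>) > \<epsilon>} \<longrightarrow> \<omega> \<in> {\<omega> \<in> space M. norm (Z n \<omega>) > \<epsilon>}"
      using le[of n] by eventually_elim auto
    then have "prob {\<omega> \<in> space M. norm (W n \<omega>) > \<epsilon>} \<le> prob {\<omega> \<in> space M. norm (Z n \<omega>) > \<epsilon>}"
      by (rule finite_measure_mono_AE) measurable
    with elim show ?case by simp
  qed
qed

lemma tight_seq_second_moment:
  fixes Z :: "nat \<Rightarrow> 'a \<Rightarrow> 'b::{real_normed_vector, second_countable_topology}"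
  assumes [measurable]: "\<And>n. Z n \<in> borel_measurable M"
    and int: "\<And>n. integrable M (\<lambda>\<omega>. (norm (Z n \<omega>))\<^sup>2)" and C: "\<And>n. (\<integral>\<omega>. (norm (Z n \<omega>))\<^sup>2 \<partial>M) \<le> C"
  shows "tight_seq M Z"
  unfolding tight_seq_def
proof (intro allI impI)
  fix \<delta> :: real assume e: "\<delta> > 0"
  define R where "R = sqrt ((\<bar>C\<bar> + 1) / \<delta>)"
  have R: "R > 0" "R\<^sup>2 = (\<bar>C\<bar> + 1) / \<delta>" using e by (auto simp: R_def)
  have "prob {\<omega> \<in> space M. norm (Z n \<omega>) > R} \<le> \<delta>" for n
  proof -
    have "prob {\<omega> \<in> space M. norm (Z n \<omega>) > R} \<le> prob {\<omega> \<in> space M. (norm (Z n \<omega>))\<^sup>2 \<ge> R\<^sup>2}"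
      using R(1) by (intro finite_measure_mono) (auto intro!: power_mono)
    also have "\<dots> \<le> (\<integral>\<omega>. (norm (Z n \<omega>))\<^sup>2 \<partial>M) / R\<^sup>2"
      using R(1) by (intro integral_Markov_inequality_measure[OF int, of "space M"]) auto
    also have "\<dots> \<le> (\<bar>C\<bar> + 1) / R\<^sup>2" using C[of n] by (intro divide_right_mono) auto
    also have "\<dots> = \<delta>" using e by (simp add: R)
    finally show ?thesis .
  qed
  then show "\<exists>R. \<forall>\<^sub>F n in sequentially. prob {\<omega> \<in> space M. norm (Z n \<omega>) > R} \<le> \<delta>"
    by (intro exI[of _ R]) simp
qed

end

section \<open>Slutsky's theorem and mapping theorems\<close>

lemma cmod_cis_diff_le: "cmod (cis a - cis b) \<le> \<bar>a - b\<bar>"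
proof -
  have "cis a - cis b = cis b * (cis (a - b) - 1)" by (simp add: algebra_simps cis_mult)
  then have "cmod (cis a - cis b) = cmod (cis (a - b) - 1)" by (simp add: norm_mult)
  also have "\<dots> \<le> \<bar>a - b\<bar>" using iexp_approx1[of "a - b" 0] by (simp add: cis_conv_exp)
  finally show ?thesis .
qed

lemma integrable_cis:
  assumes "prob_space M" "f \<in> borel_measurable M"
  shows "integrable M (\<lambda>x. cis (f x))"
proof -
  interpret prob_space M by fact
  show ?thesis using assms(2) by (intro integrable_const_bound[of _ 1]) (auto simp: cis_conv_exp)
qed

lemma conv_in_lawD:
  "conv_in_law M V \<nu> \<Longrightarrow> continuous_on UNIV f \<Longrightarrow> bounded (range f) \<Longrightarrow>
    (\<lambda>n. \<integral>\<omega>. f (V n \<omega>) \<partial>M) \<longlonglongrightarrow> (\<integral>x. f x \<partial>\<nu>)" for f :: "'v::euclidean_space \<Rightarrow> real"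
  by (simp add: conv_in_law_def)

lemma conv_in_law_cis:
  assumes M: "prob_space M" and \<nu>: "prob_space \<nu>" and s\<nu>[measurable_cong]: "sets \<nu> = sets borel"
    and [measurable]: "\<And>n. V n \<in> borel_measurable M"
    and V: "conv_in_law M V \<nu>" and g: "continuous_on UNIV (g :: 'v::euclidean_space \<Rightarrow> real)"
  shows "(\<lambda>n. \<integral>\<omega>. cis (g (V n \<omega>)) \<partial>M) \<longlonglongrightarrow> (\<integral>x. cis (g x) \<partial>\<nu>)"
proof -
  have gm[measurable]: "g \<in> borel_measurable borel" using g by (rule borel_measurable_continuous_onI)
  have i: "integrable M (\<lambda>\<omega>. cis (g (V n \<omega>)))" for n by (rule integrable_cis[OF M]) measurable
  have j: "integrable \<nu> (\<lambda>x. cis (g x))" by (rule integrable_cis[OF \<nu>]) measurable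
  have c: "continuous_on UNIV (\<lambda>x. cos (g x))" "continuous_on UNIV (\<lambda>x. sin (g x))"
    using g by (auto intro!: continuous_intros)
  have b: "bounded (range (\<lambda>x. cos (g x)))" "bounded (range (\<lambda>x. sin (g x)))"
    by (auto intro!: boundedI[of _ 1])
  show ?thesis
    unfolding tendsto_complex_iff
    using conv_in_lawD[OF V c(1) b(1)] conv_in_lawD[OF V c(2) b(2)]
    by (simp add: integral_Re[OF i, symmetric] integral_Im[OF i, symmetric] integral_Re[OF j, symmetric] integral_Im[OF j, symmetric])
qed

text \<open>The characteristic functions of the two sequences at t differ by at most |t| r + 2 P(|W
  - V| > r), which can be made small, and tightness passes from V to W. The continuity theorem then
  applies to W.\<close>

theorem conv_in_law_Slutsky:
  fixes V W :: "nat \<Rightarrow> 'a \<Rightarrow> 'v::euclidean_space"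
  assumes M: "prob_space M" and \<nu>: "prob_space \<nu>" "sets \<nu> = sets borel"
    and V[measurable]: "\<And>n. V n \<in> borel_measurable M" and W[measurable]: "\<And>n. W n \<in> borel_measurable M"
    and conv: "conv_in_law M V \<nu>" and tight: "tight_seq M V"
    and diff: "in_probability_to_zero M (\<lambda>n \<omega>. W n \<omega> - V n \<omega>)"
  shows "conv_in_law M W \<nu>"
proof (rule conv_in_law_Levy[OF M \<nu> W])
  interpret prob_space M by fact
  have "tight_seq M (\<lambda>n \<omega>. (W n \<omega> - V n \<omega>) + V n \<omega>)"
    by (intro tight_seq_add in_probability_to_zero_imp_tight diff tight) measurable
  then show "tight_seq M W" by simp
  fix t :: 'v
  have cV: "(\<lambda>n. \<integral>\<omega>. cis (t \<bullet> V n \<omega>) \<partial>M) \<longlonglongrightarrow> (\<integral>x. cis (t \<bullet> x) \<partial>\<nu>)"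
    by (rule conv_in_law_cis[OF M \<nu> V conv]) (intro continuous_intros)
  have "(\<lambda>n. (\<integral>\<omega>. cis (t \<bullet> W n \<omega>) \<partial>M) - (\<integral>\<omega>. cis (t \<bullet> V n \<omega>) \<partial>M)) \<longlonglongrightarrow> 0"
  proof (rule tendstoI)
    fix e :: real assume e: "e > 0"
    \<comment> \<open>The phase difference costs at most e/4 and the exceptional event 2 (e/8) =
      e/4. The + 1 covers t = 0.\<close>
    define r where "r = e / (4 * (norm t + 1))"
    have t: "norm t + 1 > 0" by (simp add: add_nonneg_pos)
    have "norm t * r \<le> (norm t + 1) * r" using e t by (intro mult_right_mono) (auto simp: r_def)
    also have "\<dots> = e / 4" using t by (simp add: r_def field_simps)
    finally have r: "r > 0" "norm t * r \<le> e / 4" using e t by (auto simp: r_def)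
    have "\<forall>\<^sub>F n in sequentially. prob {\<omega> \<in> space M. norm (W n \<omega> - V n \<omega>) > r} \<le> e / 8"
      by (rule in_probabilityD[OF diff]; use e r in simp)
    then show "\<forall>\<^sub>F n in sequentially. dist ((\<integral>\<omega>. cis (t \<bullet> W n \<omega>) \<partial>M) - (\<integral>\<omega>. cis (t \<bullet> V n \<omega>) \<partial>M)) 0 < e"
    proof eventually_elim
      case (elim n)
      define A where "A = {\<omega> \<in> space M. norm (W n \<omega> - V n \<omega>) > r}"
      have [measurable]: "A \<in> events" unfolding A_def by measurable
      have i: "integrable M (\<lambda>\<omega>. cis (t \<bullet> W n \<omega>))" "integrable M (\<lambda>\<omega>. cis (t \<bullet> V n \<omega>))"
        by (rule integrable_cis[OF M]; measurable)+
      have "cmod ((\<integral>\<omega>. cis (t \<bullet> W n \<omega>) \<partial>M) - (\<integral>\<omega>. cis (t \<bullet> V n \<omega>) \<partial>M)) =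
         cmod (\<integral>\<omega>. cis (t \<bullet> W n \<omega>) - cis (t \<bullet> V n \<omega>) \<partial>M)" using i by simp
      also have "\<dots> \<le> (\<integral>\<omega>. cmod (cis (t \<bullet> W n \<omega>) - cis (t \<bullet> V n \<omega>)) \<partial>M)" by (rule integral_norm_bound)
      also have "\<dots> \<le> (\<integral>\<omega>. e / 4 + 2 * indicator A \<omega> \<partial>M)"
      proof (rule integral_mono)
        fix \<omega> assume w: "\<omega> \<in> space M"
        show "cmod (cis (t \<bullet> W n \<omega>) - cis (t \<bullet> V n \<omega>)) \<le> e / 4 + 2 * indicator A \<omega>"
        proof (cases "\<omega> \<in> A")
          case True
          have "cmod (cis (t \<bullet> W n \<omega>) - cis (t \<bullet> V n \<omega>)) \<le> 2"
            using norm_triangle_ineq4[of "cis (t \<bullet> W n \<omega>)" "cis (t \<bullet> V n \<omega>)"] by simp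
          then show ?thesis using True e by simp
        next
          case False
          have "cmod (cis (t \<bullet> W n \<omega>) - cis (t \<bullet> V n \<omega>)) \<le> \<bar>t \<bullet> (W n \<omega> - V n \<omega>)\<bar>"
            using cmod_cis_diff_le[of "t \<bullet> W n \<omega>" "t \<bullet> V n \<omega>"] by (simp add: inner_diff_right)
          also have "\<dots> \<le> norm t * norm (W n \<omega> - V n \<omega>)" by (rule Cauchy_Schwarz_ineq2)
          also have "\<dots> \<le> norm t * r" using False w by (intro mult_left_mono) (auto simp: A_def)
          finally show ?thesis using r False by simp
        qed
      qed (use i in \<open>auto simp: less_top[symmetric]\<close>)
      also have "\<dots> = e / 4 + 2 * prob A"
        by (subst Bochner_Integration.integral_add) (auto simp: prob_space less_top[symmetric])
      also have "\<dots> < e" using elim e by (simp add: A_def)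
      finally show ?case by (simp add: dist_norm)
    qed
  qed
  from tendsto_add[OF this cV] show "(\<lambda>n. \<integral>\<omega>. cis (t \<bullet> W n \<omega>) \<partial>M) \<longlonglongrightarrow> (\<integral>x. cis (t \<bullet> x) \<partial>\<nu>)" by simp
qed

lemma conv_in_law_continuous_image:
  fixes V :: "nat \<Rightarrow> 'a \<Rightarrow> 'v::euclidean_space" and h :: "'v \<Rightarrow> 'w::euclidean_space"
  assumes "conv_in_law M V \<nu>" "continuous_on UNIV h" and s\<nu>[measurable_cong]: "sets \<nu> = sets borel"
  shows "conv_in_law M (\<lambda>n \<omega>. h (V n \<omega>)) (distr \<nu> borel h)"
  unfolding conv_in_law_def
proof (intro allI impI, elim conjE)
  fix f :: "'w \<Rightarrow> real" assume f: "continuous_on UNIV f" "bounded (range f)"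
  have [measurable]: "h \<in> borel_measurable borel" "f \<in> borel_measurable borel"
    using assms(2) f(1) by (auto intro: borel_measurable_continuous_onI)
  have "continuous_on UNIV (\<lambda>x. f (h x))" by (rule continuous_on_compose2[OF f(1) assms(2)]) auto
  moreover have "bounded (range (\<lambda>x. f (h x)))" using f(2) by (rule bounded_subset) auto
  ultimately show "(\<lambda>n. \<integral>\<omega>. f (h (V n \<omega>)) \<partial>M) \<longlonglongrightarrow> (\<integral>x. f x \<partial>distr \<nu> borel h)"
    using conv_in_lawD[OF assms(1)] by (simp add: integral_distr)
qed

text \<open>The test function is multiplied by the cutoff \<open>min 1 (\<bar>D\<bar> / \<delta>)\<close>, which vanishes wherever \<open>h\<close>
  may be discontinuous.\<close>

theorem conv_in_law_discontinuous_image: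
  fixes V :: "nat \<Rightarrow> 'a \<Rightarrow> 'v::euclidean_space" and h D :: "'v \<Rightarrow> real"
  assumes M: "prob_space M" and \<nu>: "prob_space \<nu>" and s\<nu>[measurable_cong]: "sets \<nu> = sets borel"
    and V[measurable]: "\<And>n. V n \<in> borel_measurable M"
    and conv: "conv_in_law M V \<nu>"
    and h[measurable]: "h \<in> borel_measurable borel" and hc: "continuous_on {x. D x \<noteq> 0} h"
    and D: "continuous_on UNIV D" and nz: "AE x in \<nu>. D x \<noteq> 0"
  shows "conv_in_law M (\<lambda>n \<omega>. h (V n \<omega>)) (distr \<nu> borel h)"
  unfolding conv_in_law_def
proof (intro allI impI, elim conjE)
  fix f :: "real \<Rightarrow> real" assume f: "continuous_on UNIV f" and "bounded (range f)"
  then obtain B where B: "B > 0" "\<And>x. \<bar>f x\<bar> \<le> B" by (auto simp: bounded_pos)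
  interpret M: prob_space M by fact
  interpret N: prob_space \<nu> by fact
  have [measurable]: "f \<in> borel_measurable borel" "D \<in> borel_measurable borel"
    using f D by (auto intro: borel_measurable_continuous_onI)
  \<comment> \<open>The cutoff has width 1 / (k + 1), so \<open>c k\<close> increases to 1 wherever
    \<open>D\<close> is nonzero.\<close>
  define c where "c k x = min 1 (real (Suc k) * \<bar>D x\<bar>)" for k x
  have c01: "0 \<le> c k x" "c k x \<le> 1" for k x by (auto simp: c_def)
  have fcB0: "\<bar>f (h x) * c k x\<bar> \<le> B * c k x" for k x
    unfolding abs_mult using B(2)[of "h x"] c01[of k x] by (simp add: mult_right_mono)
  have fcB: "\<bar>f (h x) * c k x\<bar> \<le> B" for k x
    using fcB0[of x k] mult_left_mono[OF c01(2)[of k x], of B] B(1) by linarith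
  have cc: "continuous_on UNIV (c k)" for k unfolding c_def using D by (intro continuous_intros)
  have [measurable]: "c k \<in> borel_measurable borel" for k using cc by (rule borel_measurable_continuous_onI)
  have fc: "continuous_on UNIV (\<lambda>x. f (h x) * c k x)" for k
  proof (subst continuous_on_eq_continuous_at[OF open_UNIV], intro ballI)
    fix x
    show "isCont (\<lambda>x. f (h x) * c k x) x"
    proof (cases "D x = 0")
      case False
      have "open {x. D x \<noteq> 0}" using D by (intro open_Collect_neq) auto
      then have "isCont h x" using hc False by (simp add: continuous_on_eq_continuous_at)
      moreover have "isCont f (h x)" using f by (simp add: continuous_on_eq_continuous_at)
      moreover have "isCont (c k) x" using cc by (simp add: continuous_on_eq_continuous_at)
      ultimately show ?thesis using isCont_o2[of x h f] by (intro isCont_mult) auto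
    next
      case True
      \<comment> \<open>At a zero of \<open>D\<close> nothing is known about \<open>h\<close>, but
        the product is at most \<open>B * c k\<close> in absolute value, and this tends to 0
        there.\<close>
      have "(c k \<longlongrightarrow> c k x) (at x)" using cc by (simp add: continuous_on_eq_continuous_at isCont_def)
      moreover have "c k x = 0" using True by (simp add: c_def)
      ultimately have 0: "((\<lambda>y. B * c k y) \<longlongrightarrow> 0) (at x)" by (intro tendsto_mult_right_zero) simp
      have "((\<lambda>y. f (h y) * c k y) \<longlongrightarrow> 0) (at x)"
        by (rule Lim_null_comparison[OF _ 0]) (use fcB0 in simp)
      then show ?thesis using True by (simp add: isCont_def c_def)
    qed
  qed
  have fb: "bounded (range (\<lambda>x. f (h x) * c k x))" for k
    by (rule boundedI[of _ B]) (use fcB in auto)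
  have cb: "bounded (range (c k))" for k by (rule boundedI[of _ 1]) (use c01 in auto)
  \<comment> \<open>The cost of the cutoff is bounded by the integral of 1 - c. As
    \<open>c k\<close> is itself bounded and continuous, smallness of this integral under the limit
    law carries over to large n.\<close>
  have err: "\<bar>(\<integral>\<omega>. f (h (W \<omega>)) \<partial>Q) - (\<integral>\<omega>. f (h (W \<omega>)) * c k (W \<omega>) \<partial>Q)\<bar> \<le> B * (1 - (\<integral>\<omega>. c k (W \<omega>) \<partial>Q))"
    if Q: "prob_space Q" and [measurable]: "W \<in> borel_measurable Q" for Q :: "'q measure" and W k
  proof -
    interpret Q: prob_space Q by fact
    have i: "integrable Q (\<lambda>\<omega>. f (h (W \<omega>)))" by (rule Q.integrable_const_bound[of _ B]) (use B in auto)
    have j: "integrable Q (\<lambda>\<omega>. c k (W \<omega>))" by (rule Q.integrable_const_bound[of _ 1]) (use c01 in auto)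
    have l: "integrable Q (\<lambda>\<omega>. f (h (W \<omega>)) * c k (W \<omega>))"
      by (rule Q.integrable_const_bound[of _ B]) (use fcB in auto)
    have "\<bar>(\<integral>\<omega>. f (h (W \<omega>)) \<partial>Q) - (\<integral>\<omega>. f (h (W \<omega>)) * c k (W \<omega>) \<partial>Q)\<bar> = \<bar>\<integral>\<omega>. f (h (W \<omega>)) - f (h (W \<omega>)) * c k (W \<omega>) \<partial>Q\<bar>"
      using i l by simp
    also have "\<dots> \<le> (\<integral>\<omega>. \<bar>f (h (W \<omega>)) - f (h (W \<omega>)) * c k (W \<omega>)\<bar> \<partial>Q)" by (rule integral_abs_bound)
    also have "\<dots> \<le> (\<integral>\<omega>. B * (1 - c k (W \<omega>)) \<partial>Q)"
    proof (rule integral_mono)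
      fix \<omega>
      have "\<bar>f (h (W \<omega>)) * (1 - c k (W \<omega>))\<bar> \<le> B * (1 - c k (W \<omega>))"
        unfolding abs_mult using B c01[of k "W \<omega>"] by (intro mult_mono) auto
      then show "\<bar>f (h (W \<omega>)) - f (h (W \<omega>)) * c k (W \<omega>)\<bar> \<le> B * (1 - c k (W \<omega>))" by (simp add: right_diff_distrib)
    qed (use i j l in auto)
    also have "\<dots> = B * (1 - (\<integral>\<omega>. c k (W \<omega>) \<partial>Q))" using j by (simp add: Q.prob_space)
    finally show ?thesis .
  qed
  have c1: "(\<lambda>k. \<integral>x. c k x \<partial>\<nu>) \<longlonglongrightarrow> (\<integral>x. 1 \<partial>\<nu>)"
  proof (rule integral_dominated_convergence[of _ _ _ "\<lambda>_. 1"])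
    show "AE x in \<nu>. (\<lambda>k. c k x) \<longlonglongrightarrow> 1"
      using nz
    proof eventually_elim
      case (elim x)
      obtain K :: nat where K: "1 / \<bar>D x\<bar> < real K" using reals_Archimedean2 by blast
      have "\<forall>\<^sub>F k in sequentially. c k x = 1"
        using eventually_ge_at_top[of K]
      proof eventually_elim
        case (elim k)
        have "1 / \<bar>D x\<bar> \<le> real (Suc k)" using K elim by linarith
        then have "1 \<le> real (Suc k) * \<bar>D x\<bar>" using \<open>D x \<noteq> 0\<close> by (simp add: field_simps)
        then show ?case by (simp add: c_def)
      qed
      then show ?case by (rule tendsto_eventually)
    qed
    show "AE x in \<nu>. norm (c k x) \<le> 1" for k using c01 by simp
  qed auto
  show "(\<lambda>n. \<integral>\<omega>. f (h (V n \<omega>)) \<partial>M) \<longlonglongrightarrow> (\<integral>x. f x \<partial>distr \<nu> borel h)"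
  proof (subst integral_distr, simp, simp, rule tendstoI)
    fix e :: real assume e: "e > 0"
    have "\<forall>\<^sub>F k in sequentially. \<bar>(\<integral>x. c k x \<partial>\<nu>) - 1\<bar> < e / (8 * B)"
      using c1 e B by (auto dest!: tendstoD[where e="e / (8 * B)"] simp: dist_real_def N.prob_space)
    then obtain k where k: "\<bar>(\<integral>x. c k x \<partial>\<nu>) - 1\<bar> < e / (8 * B)" by (auto simp: eventually_sequentially)
    have "(\<lambda>n. \<integral>\<omega>. f (h (V n \<omega>)) * c k (V n \<omega>) \<partial>M) \<longlonglongrightarrow> (\<integral>x. f (h x) * c k x \<partial>\<nu>)"
      by (rule conv_in_lawD[OF conv fc fb])
    then have 1: "\<forall>\<^sub>F n in sequentially. \<bar>(\<integral>\<omega>. f (h (V n \<omega>)) * c k (V n \<omega>) \<partial>M) - (\<integral>x. f (h x) * c k x \<partial>\<nu>)\<bar> < e / 4"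
      using e by (auto dest!: tendstoD[where e="e / 4"] simp: dist_real_def)
    have "(\<lambda>n. \<integral>\<omega>. c k (V n \<omega>) \<partial>M) \<longlonglongrightarrow> (\<integral>x. c k x \<partial>\<nu>)"
      by (rule conv_in_lawD[OF conv cc cb])
    then have 2: "\<forall>\<^sub>F n in sequentially. \<bar>(\<integral>\<omega>. c k (V n \<omega>) \<partial>M) - (\<integral>x. c k x \<partial>\<nu>)\<bar> < e / (8 * B)"
      using e B by (auto dest!: tendstoD[where e="e / (8 * B)"] simp: dist_real_def)
    from 1 2 show "\<forall>\<^sub>F n in sequentially. dist (\<integral>\<omega>. f (h (V n \<omega>)) \<partial>M) (\<integral>x. f (h x) \<partial>\<nu>) < e"
    proof eventually_elim
      case (elim n)
      have "1 - (\<integral>\<omega>. c k (V n \<omega>) \<partial>M) \<le> 2 * (e / (8 * B))" "1 - (\<integral>x. c k x \<partial>\<nu>) \<le> e / (8 * B)"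
        using elim(2) k by linarith+
      then have "B * (1 - (\<integral>\<omega>. c k (V n \<omega>) \<partial>M)) \<le> B * (2 * (e / (8 * B)))"
        "B * (1 - (\<integral>x. c k x \<partial>\<nu>)) \<le> B * (e / (8 * B))" using B(1) by (intro mult_left_mono; simp)+
      moreover have "B * (2 * (e / (8 * B))) = e / 4" "B * (e / (8 * B)) = e / 8" using B(1) by auto
      ultimately have b: "B * (1 - (\<integral>\<omega>. c k (V n \<omega>) \<partial>M)) \<le> e / 4" "B * (1 - (\<integral>x. c k x \<partial>\<nu>)) \<le> e / 8"
        by simp_all
      have [measurable]: "(\<lambda>x. x) \<in> borel_measurable \<nu>" by measurable
      have "\<bar>(\<integral>x. f (h x) \<partial>\<nu>) - (\<integral>x. f (h x) * c k x \<partial>\<nu>)\<bar> \<le> B * (1 - (\<integral>x. c k x \<partial>\<nu>))"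
        by (rule err[OF \<nu>]) measurable
      then show ?case
        using err[OF M V, of n k] b elim(1) e
        unfolding dist_real_def by linarith
    qed
  qed
qed

lemma conv_in_law_imp_weak_conv:
  assumes M: "prob_space M" and \<nu>: "prob_space \<nu>" "sets \<nu> = sets borel"
    and V[measurable]: "\<And>n. V n \<in> borel_measurable M" and conv: "conv_in_law M V \<nu>"
  shows "weak_conv_m (\<lambda>n. distr M borel (V n)) \<nu>"
proof (rule integral_bdd_continuous_conv_imp_weak_conv)
  interpret prob_space M by fact
  show "real_distribution (distr M borel (V n))" for n by (rule real_distribution_distr) measurable
  show "real_distribution \<nu>"
    using \<nu> sets_eq_imp_space_eq[OF \<nu>(2)] by (simp add: real_distribution_def real_distribution_axioms_def)
next
  fix f :: "real \<Rightarrow> real" assume f: "\<And>x. isCont f x" "\<And>x. \<bar>f x\<bar> \<le> 1"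
  then have "continuous_on UNIV f" "bounded (range f)"
    by (auto simp: continuous_on_eq_continuous_at intro!: boundedI[of _ 1])
  moreover from this have "f \<in> borel_measurable borel" by (intro borel_measurable_continuous_onI)
  ultimately show "(\<lambda>n. integral\<^sup>L (distr M borel (V n)) f) \<longlonglongrightarrow> integral\<^sup>L \<nu> f"
    using conv_in_lawD[OF conv] by (simp add: integral_distr)
qed

section \<open>Central limit theorem for the influence function\<close>

locale iid_sample = prob_space M for M :: "'a measure" +
  fixes P :: "'x measure" and X :: "nat \<Rightarrow> 'a \<Rightarrow> 'x" and \<phi> :: "'x \<Rightarrow> real^'d"
  assumes indep: "indep_vars (\<lambda>_. P) X UNIV"
    and ident: "\<And>i. distr M P (X i) = P"
    and phi_meas[measurable]: "\<phi> \<in> borel_measurable P"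
    and phi_square: "integrable P (\<lambda>x. (norm (\<phi> x))\<^sup>2)"
    and phi_mean: "(\<integral>x. \<phi> x \<partial>P) = 0"
    and phi_nonsing: "invertible (\<integral>x. outer_product (\<phi> x) (\<phi> x) \<partial>P)"
begin

lemma X_meas[measurable]: "X i \<in> measurable M P"
  using indep by (auto simp: indep_vars_def2)

lemma prob_space_P: "prob_space P"
  using prob_space_distr[OF X_meas[of 0]] by (simp add: ident)

sublocale P: prob_space P by (rule prob_space_P)

text \<open>The whole sequence has the product law, and reading a product law along an injection
  gives a product law. Blocks, samples with one block omitted, and draws with a fixed outcome are
  all injective selections.\<close>

lemma distr_subsample:
  assumes "inj_on f I"
  shows "distr M (PiM I (\<lambda>_. P)) (\<lambda>\<omega>. \<lambda>i\<in>I. X (f i) \<omega>) = PiM I (\<lambda>_. P)"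
proof -
  have "distr M (PiM UNIV (\<lambda>_. P)) (\<lambda>\<omega>. \<lambda>i\<in>UNIV. X i \<omega>) = PiM UNIV (\<lambda>_. P)"
    using indep by (subst (asm) indep_vars_iff_distr_eq_PiM) (auto simp: ident)
  then have "PiM I (\<lambda>_. P) = distr (distr M (PiM UNIV (\<lambda>_. P)) (\<lambda>\<omega>. \<lambda>i\<in>UNIV. X i \<omega>)) (PiM I (\<lambda>_. P)) (\<lambda>\<omega>. \<lambda>n\<in>I. \<omega> (f n))"
    using distr_PiM_reindex[of UNIV "\<lambda>_. P" f I] prob_space_P assms by simp
  also have "\<dots> = distr M (PiM I (\<lambda>_. P)) ((\<lambda>\<omega>. \<lambda>n\<in>I. \<omega> (f n)) \<circ> (\<lambda>\<omega>. \<lambda>i\<in>UNIV. X i \<omega>))"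
    by (rule distr_distr) (auto intro!: measurable_restrict)
  finally show ?thesis by (simp add: o_def)
qed

lemma integral_X: "f \<in> borel_measurable P \<Longrightarrow> (\<integral>\<omega>. f (X i \<omega>) \<partial>M) = (\<integral>x. f x \<partial>P)"
  for f :: "'x \<Rightarrow> 'b::{banach, second_countable_topology}"
  using integral_distr[OF X_meas[of i], of f] by (simp add: ident)

lemma integrable_X: "integrable P f \<Longrightarrow> integrable M (\<lambda>\<omega>. f (X i \<omega>))"
  for f :: "'x \<Rightarrow> 'b::{banach, second_countable_topology}"
  using integrable_distr[OF X_meas[of i], of f] by (simp add: ident)

definition Cov :: "real^'d^'d" where
  "Cov = (\<integral>x. outer_product (\<phi> x) (\<phi> x) \<partial>P)"

lemma integrable_phi: "integrable P \<phi>"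
proof (rule integrable_norm_cancel)
  show "integrable P (\<lambda>x. norm (\<phi> x))"
    by (rule P.square_integrable_imp_integrable[OF _ phi_square]) measurable
qed measurable

lemma outer_phi_meas[measurable]: "(\<lambda>x. outer_product (\<phi> x) (\<phi> x)) \<in> borel_measurable P"
  by (rule measurable_compose[OF phi_meas, of "\<lambda>v. outer_product v v" borel])
     (intro borel_measurable_continuous_onI continuous_intros)

lemma integrable_outer: "integrable P (\<lambda>x. outer_product (\<phi> x) (\<phi> x))"
  by (rule Bochner_Integration.integrable_bound[OF phi_square]) (auto simp: norm_outer_product power2_eq_square)

lemma inner_Cov: "t \<bullet> (Cov *v s) = (\<integral>x. (t \<bullet> \<phi> x) * (s \<bullet> \<phi> x) \<partial>P)"
proof -
  have "linear (\<lambda>A :: real^'d^'d. t \<bullet> (A *v s))"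
    by (rule linearI) (auto simp: matrix_vector_mult_add_rdistrib inner_add_right scaleR_matrix_vector_assoc[symmetric])
  then have bl: "bounded_linear (\<lambda>A :: real^'d^'d. t \<bullet> (A *v s))" by (simp add: linear_conv_bounded_linear)
  have "t \<bullet> (Cov *v s) = (\<integral>x. t \<bullet> (outer_product (\<phi> x) (\<phi> x) *v s) \<partial>P)"
    unfolding Cov_def by (rule integral_bounded_linear[OF bl integrable_outer, symmetric])
  then show ?thesis by (simp add: outer_product_mult_vec inner_commute mult.commute)
qed

lemma integrable_inner_phi: "integrable P (\<lambda>x. t \<bullet> \<phi> x)" "(\<integral>x. t \<bullet> \<phi> x \<partial>P) = 0"
  using integrable_phi phi_mean by (auto simp: integrable_inner_right)

lemma integrable_inner_phi_square: "integrable P (\<lambda>x. (t \<bullet> \<phi> x)\<^sup>2)"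
proof (rule Bochner_Integration.integrable_bound)
  show "integrable P (\<lambda>x. (norm t)\<^sup>2 * (norm (\<phi> x))\<^sup>2)" using phi_square by simp
  show "AE x in P. norm ((t \<bullet> \<phi> x)\<^sup>2) \<le> norm ((norm t)\<^sup>2 * (norm (\<phi> x))\<^sup>2)"
    using Cauchy_Schwarz_ineq2[of t] by (intro AE_I2) (simp add: power_mult_distrib[symmetric] abs_le_square_iff[symmetric])
qed measurable

text \<open>The form is E (t . \<phi>)^2 \<ge> 0. If it vanishes, then t . \<phi> = 0 almost
  everywhere, so Cov t = 0, which contradicts invertibility.\<close>

lemma Cov_pos: "t \<noteq> 0 \<Longrightarrow> t \<bullet> (Cov *v t) > 0"
proof -
  assume t: "t \<noteq> 0"
  have nn: "t \<bullet> (Cov *v t) \<ge> 0" by (simp add: inner_Cov)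
  have "t \<bullet> (Cov *v t) \<noteq> 0"
  proof
    assume "t \<bullet> (Cov *v t) = 0"
    then have "(\<integral>x. (t \<bullet> \<phi> x)\<^sup>2 \<partial>P) = 0" by (simp add: inner_Cov power2_eq_square)
    then have ae: "AE x in P. t \<bullet> \<phi> x = 0"
      using integrable_inner_phi_square[of t] by (subst (asm) integral_nonneg_eq_0_iff_AE) auto
    have "s \<bullet> (Cov *v t) = 0" for s
    proof -
      have "s \<bullet> (Cov *v t) = (\<integral>x. 0 \<partial>P)" unfolding inner_Cov
        by (rule integral_cong_AE) (use ae in \<open>auto elim: AE_mp\<close>)
      then show ?thesis by simp
    qed
    then have "Cov *v t = 0" by (metis inner_eq_zero_iff)
    moreover have "det Cov \<noteq> 0" using phi_nonsing by (simp add: Cov_def invertible_det_nz)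
    ultimately show False using t by (simp add: det_nz_iff_kernel)
  qed
  with nn show ?thesis by simp
qed

text \<open>The norm identity says B B^T = Cov. If w is orthonormal for the inner product of Cov,
  let B^T have the rows \<open>Cov *v w k\<close>: then B^T t lists the coefficients of t in the
  basis w, and Parseval gives the identity.\<close>

lemma Cov_root:
  obtains B :: "real^'d^'d" where "det B \<noteq> 0" "\<And>t. (norm (transpose B *v t))\<^sup>2 = t \<bullet> (Cov *v t)"
proof -
  have sym: "x \<bullet> (Cov *v y) = y \<bullet> (Cov *v x)" for x y by (simp add: inner_Cov mult.commute)
  obtain w :: "'d \<Rightarrow> real^'d" where w: "\<And>i k. w i \<bullet> (Cov *v w k) = (if i = k then 1 else 0)"
    "\<And>z. (\<Sum>k\<in>UNIV. (w k \<bullet> (Cov *v z)) *\<^sub>R w k) = z"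
    using whitening_basis[OF sym Cov_pos] by blast
  define B where "B = transpose (\<chi> k. Cov *v w k)"
  have tB: "transpose B *v t = (\<chi> k. w k \<bullet> (Cov *v t))" for t
  proof -
    have "transpose B *v t = (\<chi> k. (Cov *v w k) \<bullet> t)"
      unfolding B_def transpose_transpose by (simp add: vec_eq_iff matrix_vector_mul_component)
    also have "\<dots> = (\<chi> k. w k \<bullet> (Cov *v t))" by (simp only: inner_commute[of "Cov *v _"] sym[of t])
    finally show ?thesis .
  qed
  have n: "(norm (transpose B *v t))\<^sup>2 = t \<bullet> (Cov *v t)" for t
  proof -
    have "t \<bullet> (Cov *v t) = (\<Sum>k\<in>UNIV. (w k \<bullet> (Cov *v t)) *\<^sub>R w k) \<bullet> (Cov *v t)" by (simp add: w(2))
    also have "\<dots> = (\<Sum>k\<in>UNIV. (w k \<bullet> (Cov *v t))\<^sup>2)" by (simp add: inner_sum_left power2_eq_square)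
    also have "\<dots> = (norm (transpose B *v t))\<^sup>2" unfolding tB power2_norm_eq_inner inner_vec_def by (simp add: power2_eq_square)
    finally show ?thesis ..
  qed
  have "det (transpose B) \<noteq> 0" unfolding det_nz_iff_kernel
  proof (intro allI impI)
    fix t assume "transpose B *v t = 0"
    then have "t \<bullet> (Cov *v t) = 0" by (simp flip: n)
    then show "t = 0" using Cov_pos[of t] by (cases "t = 0") auto
  qed
  then have "det B \<noteq> 0" by simp
  then show ?thesis by (rule that[OF _ n])
qed

definition scaled_sum :: "nat \<Rightarrow> (nat \<Rightarrow> 'x) \<Rightarrow> real^'d" where
  "scaled_sum k y = (1 / sqrt (real k)) *\<^sub>R (\<Sum>i<k. \<phi> (y i))"

lemma scaled_sum_meas: "scaled_sum k \<in> borel_measurable (PiM {..<k} (\<lambda>_. P))"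
  unfolding scaled_sum_def by measurable

lemma scaled_sum_X_meas[measurable]: "(\<lambda>\<omega>. scaled_sum k (\<lambda>i. X i \<omega>)) \<in> borel_measurable M"
  unfolding scaled_sum_def by measurable

lemma indep_inner: "indep_vars (\<lambda>_. borel) (\<lambda>i \<omega>. t \<bullet> \<phi> (X i \<omega>)) UNIV"
  by (rule indep_vars_compose2[OF indep, of "\<lambda>_ x. t \<bullet> \<phi> x" "\<lambda>_. borel"]) measurable

lemma inner_sum_second_moment:
  "integrable M (\<lambda>\<omega>. (t \<bullet> (\<Sum>i<k. \<phi> (X i \<omega>)))\<^sup>2)"
  "(\<integral>\<omega>. (t \<bullet> (\<Sum>i<k. \<phi> (X i \<omega>)))\<^sup>2 \<partial>M) = real k * (\<integral>x. (t \<bullet> \<phi> x)\<^sup>2 \<partial>P)"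
proof -
  define Y where "Y i \<omega> = t \<bullet> \<phi> (X i \<omega>)" for i \<omega>
  have i1: "integrable M (Y i)" "(\<integral>\<omega>. Y i \<omega> \<partial>M) = 0" for i
    unfolding Y_def using integrable_X[OF integrable_inner_phi(1)] integral_X[of "\<lambda>x. t \<bullet> \<phi> x" i] integrable_inner_phi(2)
    by auto
  have ij: "integrable M (\<lambda>\<omega>. Y i \<omega> * Y j \<omega>) \<and>
    (\<integral>\<omega>. Y i \<omega> * Y j \<omega> \<partial>M) = (if i = j then (\<integral>x. (t \<bullet> \<phi> x)\<^sup>2 \<partial>P) else 0)" for i j
  proof (cases "i = j")
    case True
    then show ?thesis
      using integrable_X[OF integrable_inner_phi_square, of t j] integral_X[of "\<lambda>x. (t \<bullet> \<phi> x)\<^sup>2" j]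
      by (simp add: Y_def power2_eq_square)
  next
    case False
    have iv: "indep_vars (\<lambda>_. borel) Y {i, j}"
      unfolding Y_def by (rule indep_vars_subset[OF indep_inner]) simp
    have "(\<integral>\<omega>. (\<Prod>l\<in>{i, j}. Y l \<omega>) \<partial>M) = (\<Prod>l\<in>{i, j}. \<integral>\<omega>. Y l \<omega> \<partial>M)"
      "integrable M (\<lambda>\<omega>. (\<Prod>l\<in>{i, j}. Y l \<omega>))"
      by (rule indep_vars_lebesgue_integral[OF _ iv] indep_vars_integrable[OF _ iv]; use i1 in auto)+
    then show ?thesis using False i1 by simp
  qed
  have sq: "(t \<bullet> (\<Sum>i<k. \<phi> (X i \<omega>)))\<^sup>2 = (\<Sum>i<k. \<Sum>j<k. Y i \<omega> * Y j \<omega>)" for \<omega>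
    by (simp add: Y_def inner_sum_right power2_eq_square sum_product)
  show "integrable M (\<lambda>\<omega>. (t \<bullet> (\<Sum>i<k. \<phi> (X i \<omega>)))\<^sup>2)"
    unfolding sq using ij by (intro Bochner_Integration.integrable_sum) auto
  have "(\<integral>\<omega>. (t \<bullet> (\<Sum>i<k. \<phi> (X i \<omega>)))\<^sup>2 \<partial>M) = (\<Sum>i<k. \<Sum>j<k. \<integral>\<omega>. Y i \<omega> * Y j \<omega> \<partial>M)"
    unfolding sq using ij by (subst Bochner_Integration.integral_sum; (subst Bochner_Integration.integral_sum)?) auto
  also have "\<dots> = real k * (\<integral>x. (t \<bullet> \<phi> x)\<^sup>2 \<partial>P)" using ij by simp
  finally show "(\<integral>\<omega>. (t \<bullet> (\<Sum>i<k. \<phi> (X i \<omega>)))\<^sup>2 \<partial>M) = real k * (\<integral>x. (t \<bullet> \<phi> x)\<^sup>2 \<partial>P)" .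
qed

lemma scaled_sum_tight: "tight_seq M (\<lambda>k \<omega>. scaled_sum k (\<lambda>i. X i \<omega>))"
proof (rule tight_seq_second_moment)
  fix k
  have sq: "(norm (scaled_sum k (\<lambda>i. X i \<omega>)))\<^sup>2 = (\<Sum>b\<in>Basis. 1 / real k * (b \<bullet> (\<Sum>i<k. \<phi> (X i \<omega>)))\<^sup>2)" for \<omega>
  proof -
    have "(norm (scaled_sum k (\<lambda>i. X i \<omega>)))\<^sup>2 = 1 / real k * (norm (\<Sum>i<k. \<phi> (X i \<omega>)))\<^sup>2"
      by (simp add: scaled_sum_def power_mult_distrib power_divide)
    also have "(norm (\<Sum>i<k. \<phi> (X i \<omega>)))\<^sup>2 = (\<Sum>b\<in>Basis. (b \<bullet> (\<Sum>i<k. \<phi> (X i \<omega>)))\<^sup>2)"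
      by (subst power2_norm_eq_inner, subst euclidean_inner) (simp add: power2_eq_square inner_commute)
    finally show ?thesis by (simp add: sum_distrib_left)
  qed
  show "integrable M (\<lambda>\<omega>. (norm (scaled_sum k (\<lambda>i. X i \<omega>)))\<^sup>2)"
    unfolding sq using inner_sum_second_moment(1) by (intro Bochner_Integration.integrable_sum integrable_mult_right) auto
  have "(\<integral>\<omega>. (norm (scaled_sum k (\<lambda>i. X i \<omega>)))\<^sup>2 \<partial>M) = (\<Sum>b\<in>Basis. 1 / real k * (real k * (\<integral>x. (b \<bullet> \<phi> x)\<^sup>2 \<partial>P)))"
    unfolding sq inner_sum_second_moment(2)[symmetric] using inner_sum_second_moment(1)
    by (subst Bochner_Integration.integral_sum) auto
  \<comment> \<open>Equality holds for k > 0, and for k = 0 the left-hand side is 0, so the second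
    moments are bounded uniformly in k by the trace of Cov.\<close>
  also have "\<dots> \<le> (\<Sum>b\<in>Basis. \<integral>x. (b \<bullet> \<phi> x)\<^sup>2 \<partial>P)" by (intro sum_mono) auto
  finally show "(\<integral>\<omega>. (norm (scaled_sum k (\<lambda>i. X i \<omega>)))\<^sup>2 \<partial>M) \<le> (\<Sum>b\<in>Basis. \<integral>x. (b \<bullet> \<phi> x)\<^sup>2 \<partial>P)" .
qed measurable

text \<open>Cramer-Wold: the one-dimensional central limit theorem for t . \<phi>, with its
  characteristic function taken at the standard deviation \<sigma>. It needs \<sigma> > 0, hence the
  separate case t = 0.\<close>

lemma scaled_sum_cis:
  "(\<lambda>k. \<integral>\<omega>. cis (t \<bullet> scaled_sum k (\<lambda>i. X i \<omega>)) \<partial>M) \<longlonglongrightarrow> complex_of_real (exp (- (t \<bullet> (Cov *v t)) / 2))"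
proof (cases "t = 0")
  case True
  then show ?thesis by (simp add: prob_space)
next
  case False
  define \<sigma> where "\<sigma> = sqrt (t \<bullet> (Cov *v t))"
  have s: "\<sigma> > 0" "\<sigma>\<^sup>2 = t \<bullet> (Cov *v t)" using Cov_pos[OF False] by (auto simp: \<sigma>_def)
  define S where "S k \<omega> = (\<Sum>i<k. t \<bullet> \<phi> (X i \<omega>))" for k \<omega>
  have [measurable]: "S k \<in> borel_measurable M" for k unfolding S_def by measurable
  have mean: "(\<integral>\<omega>. t \<bullet> \<phi> (X n \<omega>) \<partial>M) = 0" for n
    using integral_X[of "\<lambda>x. t \<bullet> \<phi> x" n] integrable_inner_phi(2) by simp
  have "weak_conv_m (\<lambda>k. distr M borel (\<lambda>\<omega>. S k \<omega> / sqrt (real k * \<sigma>\<^sup>2))) std_normal_distribution"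
    unfolding S_def
  proof (rule central_limit_theorem_zero_mean[OF indep_inner])
    show "(\<integral>\<omega>. t \<bullet> \<phi> (X n \<omega>) \<partial>M) = 0" for n by (rule mean)
    show "integrable M (\<lambda>\<omega>. (t \<bullet> \<phi> (X n \<omega>))\<^sup>2)" for n
      by (rule integrable_X[OF integrable_inner_phi_square])
    show "variance (\<lambda>\<omega>. t \<bullet> \<phi> (X n \<omega>)) = \<sigma>\<^sup>2" for n
      using integral_X[of "\<lambda>x. (t \<bullet> \<phi> x)\<^sup>2" n] by (simp add: mean s(2)) (simp add: inner_Cov power2_eq_square)
    show "distr M borel (\<lambda>\<omega>. t \<bullet> \<phi> (X n \<omega>)) = distr P borel (\<lambda>x. t \<bullet> \<phi> x)" for n
      using distr_distr[of "\<lambda>x. t \<bullet> \<phi> x" P borel "X n" M] by (simp add: ident o_def)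
  qed (rule s)
  then have "(\<lambda>k. char (distr M borel (\<lambda>\<omega>. S k \<omega> / sqrt (real k * \<sigma>\<^sup>2))) \<sigma>) \<longlonglongrightarrow> char std_normal_distribution \<sigma>"
    by (intro levy_continuity1 real_distribution_distr real_dist_normal_dist) measurable
  moreover have "char (distr M borel (\<lambda>\<omega>. S k \<omega> / sqrt (real k * \<sigma>\<^sup>2))) \<sigma> = (\<integral>\<omega>. cis (t \<bullet> scaled_sum k (\<lambda>i. X i \<omega>)) \<partial>M)" for k
    unfolding char_def
  proof (subst integral_distr)
    have "\<sigma> * (S k \<omega> / sqrt (real k * \<sigma>\<^sup>2)) = t \<bullet> scaled_sum k (\<lambda>i. X i \<omega>)" for \<omega>
      using s(1) by (simp add: real_sqrt_mult scaled_sum_def S_def inner_sum_right)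
    then show "(\<integral>\<omega>. iexp (\<sigma> * (S k \<omega> / sqrt (real k * \<sigma>\<^sup>2))) \<partial>M) = (\<integral>\<omega>. cis (t \<bullet> scaled_sum k (\<lambda>i. X i \<omega>)) \<partial>M)"
      by (simp add: cis_conv_exp del: of_real_mult of_real_divide)
  qed measurable
  ultimately show ?thesis by (simp add: char_std_normal_distribution s)
qed

end

section \<open>Gaussian limit of one block, and independence of several\<close>

definition vec_of :: "('d::finite \<Rightarrow> real) \<Rightarrow> real^'d" where
  "vec_of z = (\<chi> i. z i)"

text \<open>The centered normal law with covariance B B^T, as the image of a standard Gaussian
  vector.\<close>

definition normal_law :: "real^'d^'d \<Rightarrow> (real^'d) measure" where
  "normal_law B = distr (gauss UNIV) borel (\<lambda>z. B *v vec_of z)"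

lemma vec_of_measurable[measurable]: "vec_of \<in> borel_measurable (gauss UNIV)"
  unfolding vec_of_def by (intro borel_measurable_vecI) (simp add: gauss_coordinate_measurable)

lemma matrix_vec_of_measurable: "(\<lambda>z. B *v vec_of z) \<in> borel_measurable (gauss UNIV)"
  by (rule measurable_compose[OF vec_of_measurable matrix_vector_measurable])

lemma prob_space_normal_law: "prob_space (normal_law B)"
  unfolding normal_law_def by (rule prob_space.prob_space_distr[OF prob_space_gauss matrix_vec_of_measurable])

lemma sets_normal_law[measurable_cong, simp]: "sets (normal_law B) = sets borel"
  by (simp add: normal_law_def)

lemma normal_law_cis:
  "(\<integral>x. cis (t \<bullet> x) \<partial>normal_law B) = complex_of_real (exp (- (norm (transpose B *v t))\<^sup>2 / 2))"
proof -
  have "(\<integral>x. cis (t \<bullet> x) \<partial>normal_law B) = (\<integral>z. cis (t \<bullet> (B *v vec_of z)) \<partial>gauss UNIV)"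
    unfolding normal_law_def
    by (rule integral_distr[OF matrix_vec_of_measurable]) (simp add: cis_conv_exp)
  also have "\<dots> = (\<integral>z. cis (\<Sum>i\<in>UNIV. (transpose B *v t) $ i * z i) \<partial>gauss UNIV)"
  proof -
    have "t \<bullet> (B *v vec_of z) = (\<Sum>i\<in>UNIV. (transpose B *v t) $ i * z i)" for z
      using inner_matrix_vec[of B "vec_of z" t]
      by (simp only: inner_commute[of t]) (simp add: inner_vec_def vec_of_def mult.commute)
    then show ?thesis by simp
  qed
  also have "\<dots> = complex_of_real (exp (- (\<Sum>i\<in>UNIV. ((transpose B *v t) $ i)\<^sup>2) / 2))"
    by (rule integral_cis_gauss) simp
  also have "(\<Sum>i\<in>UNIV. ((transpose B *v t) $ i)\<^sup>2) = (norm (transpose B *v t))\<^sup>2"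
    unfolding power2_norm_eq_inner inner_vec_def by (simp add: power2_eq_square)
  finally show ?thesis .
qed

lemma (in iid_sample) scaled_sum_conv_in_law:
  assumes "\<And>t. (norm (transpose B *v t))\<^sup>2 = t \<bullet> (Cov *v t)"
  shows "conv_in_law M (\<lambda>k \<omega>. scaled_sum k (\<lambda>i. X i \<omega>)) (normal_law B)"
proof (rule conv_in_law_Levy[OF prob_space_axioms prob_space_normal_law sets_normal_law scaled_sum_X_meas scaled_sum_tight])
  show "(\<lambda>k. \<integral>\<omega>. cis (t \<bullet> scaled_sum k (\<lambda>i. X i \<omega>)) \<partial>M) \<longlonglongrightarrow> (\<integral>x. cis (t \<bullet> x) \<partial>normal_law B)" for t
    using scaled_sum_cis[of t] by (simp add: normal_law_cis assms del: transpose_matrix_vector)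
qed

text \<open>Functions of disjoint groups of independent variables are independent, so the
  expectation factorizes. It serves both the blocks of the sample and the columns of the Gaussian
  matrix.\<close>

lemma integral_cis_indep_blocks:
  fixes m :: nat
  assumes "prob_space M" and ind: "prob_space.indep_vars M N X I"
    and K: "\<And>j. j < m \<Longrightarrow> K j \<subseteq> I" "disjoint_family_on K {..<m}"
    and g: "\<And>j. j < m \<Longrightarrow> g j \<in> borel_measurable (PiM (K j) N)"
  shows "(\<integral>\<omega>. cis (\<Sum>j<m. g j (\<lambda>i\<in>K j. X i \<omega>)) \<partial>M) = (\<Prod>j<m. \<integral>\<omega>. cis (g j (\<lambda>i\<in>K j. X i \<omega>)) \<partial>M)"
proof -
  interpret prob_space M by fact
  have "indep_vars (\<lambda>j. PiM (K j) N) (\<lambda>j \<omega>. \<lambda>i\<in>K j. X i \<omega>) {..<m}"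
    by (rule indep_vars_restrict[OF ind]) (use K in auto)
  then have iv: "indep_vars (\<lambda>_. borel) (\<lambda>j \<omega>. cis (g j (\<lambda>i\<in>K j. X i \<omega>))) {..<m}"
    by (rule indep_vars_compose2[where Y="\<lambda>j x. cis (g j x)"])
       (use g in \<open>auto simp: cis_conv_exp\<close>)
  have "integrable M (\<lambda>\<omega>. cis (g j (\<lambda>i\<in>K j. X i \<omega>)))" if "j < m" for j
  proof (rule integrable_const_bound[of _ 1])
    show "(\<lambda>\<omega>. cis (g j (\<lambda>i\<in>K j. X i \<omega>))) \<in> borel_measurable M"
      using iv that by (auto simp: indep_vars_def2)
  qed simp
  then have "(\<integral>\<omega>. (\<Prod>j<m. cis (g j (\<lambda>i\<in>K j. X i \<omega>))) \<partial>M) = (\<Prod>j<m. \<integral>\<omega>. cis (g j (\<lambda>i\<in>K j. X i \<omega>)) \<partial>M)"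
    by (intro indep_vars_lebesgue_integral[OF finite_lessThan iv]) simp
  then show ?thesis by (simp add: cis_sum)
qed

lemma gauss_indep_coordinates:
  assumes "I \<noteq> {}"
  shows "prob_space.indep_vars (gauss I) (\<lambda>_. borel) (\<lambda>i x. x i) I"
proof -
  interpret prob_space "gauss I" by (rule prob_space_gauss)
  have "distr (gauss I) borel (\<lambda>x. x i) = std_normal_distribution" if "i \<in> I" for i
  proof -
    have "distr (gauss I) borel (\<lambda>x. x i) = distr (gauss I) std_normal_distribution (\<lambda>x. x i)"
      by (rule distr_cong) auto
    also have "\<dots> = std_normal_distribution"
      using that prob_space_std_normal by (intro distr_PiM_component) auto
    finally show ?thesis .
  qed
  then have "PiM I (\<lambda>i. distr (gauss I) borel (\<lambda>x. x i)) = gauss I" by (intro PiM_cong) auto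
  moreover have "distr (gauss I) (PiM I (\<lambda>_. borel)) (\<lambda>x. \<lambda>i\<in>I. x i) = distr (gauss I) (gauss I) (\<lambda>x. x)"
    by (intro distr_cong) (auto simp: sets_gauss space_PiM PiE_iff extensional_restrict)
  ultimately show ?thesis
    by (subst indep_vars_iff_distr_eq_PiM'[OF assms]) (auto simp: distr_id intro: gauss_coordinate_measurable)
qed

text \<open>\<open>g\<close> need not be linear: it will be v \<mapsto> t .
  \<open>vec_moments v\<close>, which is quadratic in v, so that the sum of the outer products is
  included.\<close>

lemma integral_cis_gauss_columns:
  fixes g :: "real^'d \<Rightarrow> real"
  assumes [measurable]: "g \<in> borel_measurable borel" and m: "m > 0"
  shows "(\<integral>x. cis (\<Sum>j<m. g (B *v col_vec x j)) \<partial>gauss (mat_ix m)) = (\<integral>x. cis (g x) \<partial>normal_law B) ^ m"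
proof -
  let ?P = "gauss (mat_ix m :: (nat \<times> 'd) set)"
  define K where "K j = {j} \<times> (UNIV :: 'd set)" for j :: nat
  have col: "(\<lambda>x. col_vec x j :: real^'d) \<in> borel_measurable (PiM (K j) (\<lambda>_. borel))" for j
    by (rule borel_measurable_vecI) (simp add: K_def)
  have gm: "(\<lambda>x. g (B *v col_vec x j)) \<in> borel_measurable (PiM (K j) (\<lambda>_. borel))" for j
    by (intro measurable_compose[OF _ assms(1)] measurable_compose[OF col matrix_vector_measurable])
  have res: "col_vec (\<lambda>p\<in>K j. x p) j = col_vec x j" for j and x :: "nat \<times> 'd \<Rightarrow> real"
    by (simp add: K_def vec_eq_iff)
  have "(\<integral>x. cis (\<Sum>j<m. g (B *v col_vec (\<lambda>p\<in>K j. x p) j)) \<partial>?P) = (\<Prod>j<m. \<integral>x. cis (g (B *v col_vec (\<lambda>p\<in>K j. x p) j)) \<partial>?P)"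
    using m by (intro integral_cis_indep_blocks[OF prob_space_gauss gauss_indep_coordinates] gm)
      (auto simp: K_def disjoint_family_on_def)
  also have "\<dots> = (\<Prod>j<m. \<integral>x. cis (g x) \<partial>normal_law B)"
  proof (rule prod.cong[OF refl])
    fix j assume j: "j \<in> {..<m}"
    have inj: "inj_on (\<lambda>i :: 'd. (j, i)) UNIV" "(\<lambda>i :: 'd. (j, i)) \<in> UNIV \<rightarrow> mat_ix m" using j by (auto simp: inj_on_def)
    have T: "(\<lambda>x. \<lambda>n\<in>UNIV. x (j, n)) \<in> measurable ?P (gauss (UNIV :: 'd set))"
      using j by (intro measurable_restrict measurable_component_singleton) auto
    have "gauss (UNIV :: 'd set) = distr ?P (gauss UNIV) (\<lambda>x. \<lambda>n\<in>UNIV. x (j, n))"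
      using distr_PiM_reindex[OF prob_space_std_normal inj] by simp
    then have "normal_law B = distr (distr ?P (gauss UNIV) (\<lambda>x. \<lambda>n\<in>UNIV. x (j, n))) borel (\<lambda>z. B *v vec_of z)"
      by (simp add: normal_law_def)
    also have "\<dots> = distr ?P borel (\<lambda>x. B *v col_vec x j)"
    proof -
      have "vec_of (\<lambda>n\<in>UNIV. x (j, n)) = col_vec x j" for x :: "nat \<times> 'd \<Rightarrow> real" by (simp add: vec_of_def vec_eq_iff)
      then show ?thesis by (subst distr_distr[OF matrix_vec_of_measurable T]) (simp add: o_def)
    qed
    finally have nl: "normal_law B = distr ?P borel (\<lambda>x. B *v col_vec x j)" .
    have "(\<lambda>x. B *v col_vec x j) \<in> borel_measurable ?P"
      using j
      by (intro measurable_compose[OF _ matrix_vector_measurable])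
        (simp add: measurable_cong_sets[OF sets_gauss refl] col_vec_measurable)
    then show "(\<integral>x. cis (g (B *v col_vec (\<lambda>p\<in>K j. x p) j)) \<partial>?P) = (\<integral>x. cis (g x) \<partial>normal_law B)"
      unfolding nl res by (subst integral_distr) (auto simp: cis_conv_exp)
  qed
  finally show ?thesis by (simp only: res prod_constant card_lessThan)
qed

lemma sum_blocks: "(\<Sum>i<m * k. f i) = (\<Sum>j<m. \<Sum>l<k. f (l * m + j))" for f :: "nat \<Rightarrow> 'b::comm_monoid_add"
proof -
  have "(\<Sum>i<m * k. f i) = (\<Sum>l<k. \<Sum>i=l*m..<l*m+m. f i)"
    using sum.nat_group[of f m k] by (simp add: mult.commute)
  also have "\<dots> = (\<Sum>l<k. \<Sum>j<m. f (l * m + j))"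
  proof (rule sum.cong[OF refl])
    fix l
    show "(\<Sum>i=l*m..<l*m+m. f i) = (\<Sum>j<m. f (l * m + j))"
      by (rule sum.reindex_bij_witness[of _ "\<lambda>j. l * m + j" "\<lambda>i. i - l * m"]) auto
  qed
  also have "\<dots> = (\<Sum>j<m. \<Sum>l<k. f (l * m + j))" by (rule sum.swap)
  finally show ?thesis .
qed

section \<open>Block sums of the sample and of triangular arrays\<close>

context iid_sample
begin

lemma scaled_sum_restrict: "scaled_sum k (\<lambda>i\<in>{..<k}. y i) = scaled_sum k y"
  by (simp add: scaled_sum_def)

definition block_sum :: "nat \<Rightarrow> nat \<Rightarrow> nat \<Rightarrow> (nat \<Rightarrow> 'x) \<Rightarrow> real^'d" where
  "block_sum m k j y = scaled_sum k (\<lambda>l. y (l * m + j))"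

definition block_moments :: "nat \<Rightarrow> nat \<Rightarrow> (nat \<Rightarrow> 'x) \<Rightarrow> (real^'d) \<times> (real^'d^'d)" where
  "block_moments m k y = (\<Sum>j<m. vec_moments (block_sum m k j y))"

lemma block_index_less: "j < m \<Longrightarrow> l < k \<Longrightarrow> l * m + j < m * (k::nat)"
proof -
  assume "j < m" "l < k"
  then have "l * m + j < Suc l * m" by simp
  also have "\<dots> \<le> k * m" using \<open>l < k\<close> by (intro mult_le_mono1) simp
  finally show ?thesis by (simp add: mult.commute)
qed

lemma block_sum_meas:
  assumes "j < m"
  shows "block_sum m k j \<in> borel_measurable (PiM {..<m * k} (\<lambda>_. P))"
proof -
  have [measurable]: "(\<lambda>y. y (l * m + j)) \<in> measurable (PiM {..<m * k} (\<lambda>_. P)) P" if "l < k" for l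
    using block_index_less[OF assms that] by (intro measurable_component_singleton) simp
  show ?thesis unfolding block_sum_def scaled_sum_def by measurable
qed

lemma block_moments_meas: "block_moments m k \<in> borel_measurable (PiM {..<m * k} (\<lambda>_. P))"
  unfolding block_moments_def
  by (intro borel_measurable_sum measurable_compose[OF block_sum_meas vec_moments_measurable]) simp

lemma restrict_sample_measurable:
  assumes "\<And>i. Y i \<in> measurable M P"
  shows "(\<lambda>\<omega>. \<lambda>i\<in>I. Y i \<omega>) \<in> measurable M (PiM I (\<lambda>_. P))"
  using assms by (intro measurable_restrict)

lemma block_sum_restrict:
  "j < m \<Longrightarrow> block_sum m k j (\<lambda>i\<in>{..<m * k}. y i) = block_sum m k j y"
  by (simp add: block_sum_def scaled_sum_def block_index_less)

lemma block_moments_restrict: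
  "block_moments m k (\<lambda>i\<in>{..<m * k}. y i) = block_moments m k y"
  by (simp add: block_moments_def block_sum_restrict)

lemma integral_cis_vec_moments_block_sum:
  fixes t :: "(real^'d) \<times> (real^'d^'d)"
  assumes "j < m"
  shows "(\<integral>\<omega>. cis (t \<bullet> vec_moments (block_sum m k j (\<lambda>i. X i \<omega>))) \<partial>M) =
    (\<integral>\<omega>. cis (t \<bullet> vec_moments (scaled_sum k (\<lambda>i. X i \<omega>))) \<partial>M)"
proof -
  note [measurable] = scaled_sum_meas vec_moments_measurable
  have f: "inj_on (\<lambda>l. l * m + j) {..<k}" using assms by (auto simp: inj_on_def)
  have 1: "(\<integral>\<omega>. cis (t \<bullet> vec_moments (scaled_sum k (\<lambda>i. X (h i) \<omega>))) \<partial>M) =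
     (\<integral>y. cis (t \<bullet> vec_moments (scaled_sum k y)) \<partial>PiM {..<k} (\<lambda>_. P))" if "inj_on h {..<k}" for h
  proof -
    have g: "(\<lambda>y. cis (t \<bullet> vec_moments (scaled_sum k y))) \<in> borel_measurable (PiM {..<k} (\<lambda>_. P))"
      by (simp add: cis_conv_exp)
    have "(\<integral>y. cis (t \<bullet> vec_moments (scaled_sum k y)) \<partial>PiM {..<k} (\<lambda>_. P)) =
      (\<integral>\<omega>. cis (t \<bullet> vec_moments (scaled_sum k (\<lambda>i\<in>{..<k}. X (h i) \<omega>))) \<partial>M)"
      by (subst distr_subsample[OF that, symmetric], rule integral_distr[OF restrict_sample_measurable g]) measurable
    moreover have "scaled_sum k (\<lambda>i\<in>{..<k}. X (h i) \<omega>) = scaled_sum k (\<lambda>i. X (h i) \<omega>)" for \<omega>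
      by (simp add: scaled_sum_def)
    ultimately show ?thesis by simp
  qed
  from 1[OF f] 1[of "\<lambda>i. i"] show ?thesis by (simp add: block_sum_def)
qed

lemma integral_cis_block_moments:
  fixes t :: "(real^'d) \<times> (real^'d^'d)"
  shows "(\<integral>\<omega>. cis (t \<bullet> block_moments m k (\<lambda>i. X i \<omega>)) \<partial>M) =
    (\<integral>\<omega>. cis (t \<bullet> vec_moments (scaled_sum k (\<lambda>i. X i \<omega>))) \<partial>M) ^ m"
proof -
  define K where "K j = (\<lambda>l. l * m + j) ` {..<k}" for j
  have dis: "disjoint_family_on K {..<m}"
  proof (unfold disjoint_family_on_def, intro ballI impI)
    fix i j assume ij: "i \<in> {..<m}" "j \<in> {..<m}" "i \<noteq> j"
    have "False" if "l * m + i = l' * m + j" for l l'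
    proof -
      have "(l * m + i) mod m = (l' * m + j) mod m" using that by simp
      then show False using ij by simp
    qed
    then show "K i \<inter> K j = {}" by (auto simp: K_def)
  qed
  have bm: "block_sum m k j \<in> borel_measurable (PiM (K j) (\<lambda>_. P))" for j
    unfolding block_sum_def scaled_sum_def by (intro borel_measurable_scaleR borel_measurable_sum measurable_compose[OF _ phi_meas]
      measurable_component_singleton borel_measurable_const) (auto simp: K_def)
  have res: "block_sum m k j (\<lambda>i\<in>K j. y i) = block_sum m k j y" for j y
  proof -
    have "l * m + j \<in> K j" if "l < k" for l using that by (auto simp: K_def)
    then show ?thesis by (simp add: block_sum_def scaled_sum_def)
  qed
  have "(\<integral>\<omega>. cis (\<Sum>j<m. t \<bullet> vec_moments (block_sum m k j (\<lambda>i\<in>K j. X i \<omega>))) \<partial>M) =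
      (\<Prod>j<m. \<integral>\<omega>. cis (t \<bullet> vec_moments (block_sum m k j (\<lambda>i\<in>K j. X i \<omega>))) \<partial>M)"
    by (intro integral_cis_indep_blocks[OF prob_space_axioms indep] dis borel_measurable_inner
        measurable_compose[OF bm vec_moments_measurable]) auto
  then show ?thesis
    by (simp add: res block_moments_def inner_sum_right integral_cis_vec_moments_block_sum)
qed

text \<open>A triangular array: row n has the law of an i.i.d. sample in its first m * (n div m)
  entries, and nothing is said about the joint law of different rows. This suffices, because the
  integrals and tail probabilities below involve one row at a time.\<close>

definition iid_rows :: "nat \<Rightarrow> (nat \<Rightarrow> nat \<Rightarrow> 'a \<Rightarrow> 'x) \<Rightarrow> bool" where
  "iid_rows m Y \<longleftrightarrow> (\<forall>n i. Y n i \<in> measurable M P) \<and>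
    (\<forall>n. distr M (PiM {..<m * (n div m)} (\<lambda>_. P)) (\<lambda>\<omega>. \<lambda>i\<in>{..<m * (n div m)}. Y n i \<omega>) = PiM {..<m * (n div m)} (\<lambda>_. P))"

lemma integral_iid_rows:
  fixes g :: "(nat \<Rightarrow> 'x) \<Rightarrow> 'b::{banach, second_countable_topology}"
  assumes Y: "iid_rows m Y" and g: "g \<in> borel_measurable (PiM {..<m * (n div m)} (\<lambda>_. P))"
  shows "(\<integral>\<omega>. g (\<lambda>i\<in>{..<m * (n div m)}. Y n i \<omega>) \<partial>M) = (\<integral>\<omega>. g (\<lambda>i\<in>{..<m * (n div m)}. X i \<omega>) \<partial>M)"
proof -
  let ?N = "{..<m * (n div m)}"
  have Ym: "(\<lambda>\<omega>. \<lambda>i\<in>?N. Y n i \<omega>) \<in> measurable M (PiM ?N (\<lambda>_. P))"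
    using Y by (intro measurable_restrict) (simp add: iid_rows_def)
  have Xm: "(\<lambda>\<omega>. \<lambda>i\<in>?N. X i \<omega>) \<in> measurable M (PiM ?N (\<lambda>_. P))"
    by (intro measurable_restrict) simp
  have "distr M (PiM ?N (\<lambda>_. P)) (\<lambda>\<omega>. \<lambda>i\<in>?N. Y n i \<omega>) = distr M (PiM ?N (\<lambda>_. P)) (\<lambda>\<omega>. \<lambda>i\<in>?N. X i \<omega>)"
    using Y distr_subsample[of "\<lambda>i. i" ?N] by (simp add: iid_rows_def)
  then show ?thesis using integral_distr[OF Ym g] integral_distr[OF Xm g] by simp
qed

lemma prob_iid_rows:
  assumes Y: "iid_rows m Y" and g[measurable]: "g \<in> borel_measurable (PiM {..<m * (n div m)} (\<lambda>_. P))"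
  shows "prob {\<omega> \<in> space M. g (\<lambda>i\<in>{..<m * (n div m)}. Y n i \<omega>) > (\<epsilon>::real)} =
    prob {\<omega> \<in> space M. g (\<lambda>i\<in>{..<m * (n div m)}. X i \<omega>) > \<epsilon>}"
proof -
  let ?N = "{..<m * (n div m)}"
  have Ym[measurable]: "(\<lambda>\<omega>. \<lambda>i\<in>?N. Y n i \<omega>) \<in> measurable M (PiM ?N (\<lambda>_. P))"
    using Y by (intro measurable_restrict) (simp add: iid_rows_def)
  have Xm[measurable]: "(\<lambda>\<omega>. \<lambda>i\<in>?N. X i \<omega>) \<in> measurable M (PiM ?N (\<lambda>_. P))"
    by (intro measurable_restrict) simp
  have eq: "(\<integral>\<omega>. indicator {y. g y > \<epsilon>} (W \<omega>) \<partial>M) = prob {\<omega> \<in> space M. g (W \<omega>) > \<epsilon>}"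
    if W[measurable]: "W \<in> measurable M (PiM ?N (\<lambda>_. P))" for W
  proof -
    have "(\<integral>\<omega>. indicator {y. g y > \<epsilon>} (W \<omega>) \<partial>M) = (\<integral>\<omega>. indicator {\<omega> \<in> space M. g (W \<omega>) > \<epsilon>} \<omega> \<partial>M :: real)"
      by (intro Bochner_Integration.integral_cong) (auto simp: indicator_def)
    then show ?thesis by simp
  qed
  have "(\<lambda>y. indicator {y. g y > \<epsilon>} y :: real) \<in> borel_measurable (PiM ?N (\<lambda>_. P))"
    unfolding indicator_def by measurable
  from integral_iid_rows[OF Y this] eq[OF Ym] eq[OF Xm] show ?thesis by simp
qed

lemma tight_iid_rows:
  fixes g :: "nat \<Rightarrow> (nat \<Rightarrow> 'x) \<Rightarrow> 'b::{real_normed_vector, second_countable_topology}"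
  assumes Y: "iid_rows m Y" and [measurable]: "\<And>n. g n \<in> borel_measurable (PiM {..<m * (n div m)} (\<lambda>_. P))"
    and "tight_seq M (\<lambda>n \<omega>. g n (\<lambda>i\<in>{..<m * (n div m)}. X i \<omega>))"
  shows "tight_seq M (\<lambda>n \<omega>. g n (\<lambda>i\<in>{..<m * (n div m)}. Y n i \<omega>))"
  using assms(3) prob_iid_rows[OF Y, of "\<lambda>y. norm (g _ y)"] by (simp add: tight_seq_def)

lemma in_probability_iid_rows:
  fixes g :: "nat \<Rightarrow> (nat \<Rightarrow> 'x) \<Rightarrow> 'b::{real_normed_vector, second_countable_topology}"
  assumes Y: "iid_rows m Y" and [measurable]: "\<And>n. g n \<in> borel_measurable (PiM {..<m * (n div m)} (\<lambda>_. P))"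
    and "in_probability_to_zero M (\<lambda>n \<omega>. g n (\<lambda>i\<in>{..<m * (n div m)}. X i \<omega>))"
  shows "in_probability_to_zero M (\<lambda>n \<omega>. g n (\<lambda>i\<in>{..<m * (n div m)}. Y n i \<omega>))"
  using assms(3) prob_iid_rows[OF Y, of "\<lambda>y. norm (g _ y)"] by (simp add: in_probability_to_zero_def)

end

lemma tight_seq_subseq:
  assumes "tight_seq M Z" "filterlim r at_top sequentially"
  shows "tight_seq M (\<lambda>n. Z (r n))"
  unfolding tight_seq_def
proof (intro allI impI)
  fix e :: real assume "e > 0"
  then obtain R where "\<forall>\<^sub>F n in sequentially. measure M {\<omega> \<in> space M. norm (Z n \<omega>) > R} \<le> e"
    using assms(1) unfolding tight_seq_def by meson
  from eventually_compose_filterlim[OF this assms(2)]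
  show "\<exists>R. \<forall>\<^sub>F n in sequentially. measure M {\<omega> \<in> space M. norm (Z (r n) \<omega>) > R} \<le> e" by blast
qed

lemma in_probability_to_zero_subseq:
  assumes "in_probability_to_zero M Z" "filterlim r at_top sequentially"
  shows "in_probability_to_zero M (\<lambda>n. Z (r n))"
  using assms(1) unfolding in_probability_to_zero_def
  by (auto intro: filterlim_compose[OF _ assms(2)])

lemma filterlim_div_at_top: "m > 0 \<Longrightarrow> filterlim (\<lambda>n. n div m :: nat) at_top sequentially"
  unfolding filterlim_at_top
proof
  fix Z :: nat assume m: "m > 0"
  show "\<forall>\<^sub>F n in sequentially. Z \<le> n div m"
    using eventually_ge_at_top[of "Z * m"] by eventually_elim (use m in \<open>simp add: less_eq_div_iff_mult_less_eq\<close>)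
qed


context iid_sample
begin

lemma prob_subsample:
  fixes g :: "(nat \<Rightarrow> 'x) \<Rightarrow> real"
  assumes h: "inj_on h {..<k}" and [measurable]: "g \<in> borel_measurable (PiM {..<k} (\<lambda>_. P))"
  shows "measure (PiM {..<k} (\<lambda>_. P)) {y \<in> space (PiM {..<k} (\<lambda>_. P)). g y > \<epsilon>} =
    prob {\<omega> \<in> space M. g (\<lambda>i\<in>{..<k}. X (h i) \<omega>) > \<epsilon>}"
proof -
  have T[measurable]: "(\<lambda>\<omega>. \<lambda>i\<in>{..<k}. X (h i) \<omega>) \<in> measurable M (PiM {..<k} (\<lambda>_. P))"
    by (intro measurable_restrict) simp
  have "measure (distr M (PiM {..<k} (\<lambda>_. P)) (\<lambda>\<omega>. \<lambda>i\<in>{..<k}. X (h i) \<omega>)) {y \<in> space (PiM {..<k} (\<lambda>_. P)). g y > \<epsilon>} =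
    prob ((\<lambda>\<omega>. \<lambda>i\<in>{..<k}. X (h i) \<omega>) -` {y \<in> space (PiM {..<k} (\<lambda>_. P)). g y > \<epsilon>} \<inter> space M)"
    by (rule measure_distr) measurable
  also have "(\<lambda>\<omega>. \<lambda>i\<in>{..<k}. X (h i) \<omega>) -` {y \<in> space (PiM {..<k} (\<lambda>_. P)). g y > \<epsilon>} \<inter> space M =
    {\<omega> \<in> space M. g (\<lambda>i\<in>{..<k}. X (h i) \<omega>) > \<epsilon>}"
    using measurable_space[OF T] by auto
  finally show ?thesis by (simp only: distr_subsample[OF h])
qed

text \<open>A block of the original sequence is an injective selection of k observations, so its
  scaled sum has the tails of \<open>scaled_sum k\<close>; then k runs through n div m, and the
  bound is transferred to the array.\<close>

lemma tight_block_sum: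
  assumes Y: "iid_rows m Y" and j: "j < m"
  shows "tight_seq M (\<lambda>n \<omega>. block_sum m (n div m) j (\<lambda>i. Y n i \<omega>))"
proof -
  have m: "m > 0" using j by simp
  have "inj_on (\<lambda>l. l * m + j) {..<k}" for k using m by (auto simp: inj_on_def)
  then have "prob {\<omega> \<in> space M. norm (block_sum m k j (\<lambda>i. X i \<omega>)) > R} =
     prob {\<omega> \<in> space M. norm (scaled_sum k (\<lambda>i. X i \<omega>)) > R}" for k R
    using prob_subsample[of "\<lambda>l. l * m + j" k "\<lambda>y. norm (scaled_sum k y)" R]
      prob_subsample[of "\<lambda>l. l" k "\<lambda>y. norm (scaled_sum k y)" R] scaled_sum_meas[of k]
    by (simp add: block_sum_def scaled_sum_restrict)
  then have "tight_seq M (\<lambda>k \<omega>. block_sum m k j (\<lambda>i. X i \<omega>))"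
    using scaled_sum_tight by (simp add: tight_seq_def)
  from tight_seq_subseq[OF this filterlim_div_at_top[OF m]]
  have "tight_seq M (\<lambda>n \<omega>. block_sum m (n div m) j (\<lambda>i\<in>{..<m * (n div m)}. X i \<omega>))"
    by (simp add: block_sum_restrict j)
  from tight_iid_rows[OF Y block_sum_meas[OF j] this] show ?thesis
    by (simp only: block_sum_restrict[OF j])
qed

lemma block_sum_rows_meas:
  assumes Y: "iid_rows m Y" and j: "j < m"
  shows "(\<lambda>\<omega>. block_sum m k j (\<lambda>i. Y n i \<omega>)) \<in> borel_measurable M"
proof -
  have [measurable]: "Y n i \<in> measurable M P" for i using Y by (simp add: iid_rows_def)
  show ?thesis unfolding block_sum_def scaled_sum_def by measurable
qed

lemma block_moments_rows_meas:
  assumes Y: "iid_rows m Y"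
  shows "(\<lambda>\<omega>. block_moments m k (\<lambda>i. Y n i \<omega>)) \<in> borel_measurable M"
  unfolding block_moments_def
  by (intro borel_measurable_sum measurable_compose[OF block_sum_rows_meas[OF Y] vec_moments_measurable]) simp

lemma tight_block_moments:
  assumes Y: "iid_rows m Y"
  shows "tight_seq M (\<lambda>n \<omega>. block_moments m (n div m) (\<lambda>i. Y n i \<omega>))"
  unfolding block_moments_def
  by (intro tight_seq_sum tight_seq_continuous_image[OF tight_block_sum[OF Y]] block_sum_rows_meas[OF Y]
      continuous_on_vec_moments measurable_compose[OF block_sum_rows_meas[OF Y] vec_moments_measurable]) auto

text \<open>The outer product is an unbounded function of a block sum, but t .
  \<open>vec_moments\<close> is continuous, and after composition with \<open>cis\<close> it is an
  admissible test function. Hence convergence in law of a single block suffices, and the same power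
  of the limit is found for the Gaussian columns.\<close>

theorem block_moments_conv_in_law:
  assumes Y: "iid_rows m Y" and m: "CARD('d) < m" and B: "det B \<noteq> 0" "\<And>t. (norm (transpose B *v t))\<^sup>2 = t \<bullet> (Cov *v t)"
  shows "conv_in_law M (\<lambda>n \<omega>. block_moments m (n div m) (\<lambda>i. Y n i \<omega>))
    (distr (gauss (mat_ix m)) borel (\<lambda>x. \<Sum>j<m. vec_moments (B *v col_vec x j)))"
proof (rule conv_in_law_Levy[OF prob_space_axioms _ _ block_moments_rows_meas[OF Y] tight_block_moments[OF Y]])
  note H = mean_scatter_limit_law(3)[OF B(1) m]
  have m0: "m > 0" using m by simp
  show "prob_space (distr (gauss (mat_ix m)) borel (\<lambda>x. \<Sum>j<m. vec_moments (B *v col_vec x j)))"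
    by (rule prob_space.prob_space_distr[OF prob_space_gauss H])
  fix t :: "(real^'d) \<times> (real^'d^'d)"
  have cvm: "continuous_on UNIV (\<lambda>v :: real^'d. t \<bullet> vec_moments v)"
    by (intro continuous_intros continuous_on_vec_moments)
  have "(\<lambda>k. \<integral>\<omega>. cis (t \<bullet> vec_moments (scaled_sum k (\<lambda>i. X i \<omega>))) \<partial>M) \<longlonglongrightarrow> (\<integral>x. cis (t \<bullet> vec_moments x) \<partial>normal_law B)"
    by (rule conv_in_law_cis[OF prob_space_axioms prob_space_normal_law sets_normal_law scaled_sum_X_meas
          scaled_sum_conv_in_law[OF B(2)] cvm])
  from filterlim_compose[OF tendsto_power[OF this, of m] filterlim_div_at_top[OF m0]]
  have lim: "(\<lambda>n. \<integral>\<omega>. cis (t \<bullet> block_moments m (n div m) (\<lambda>i. X i \<omega>)) \<partial>M) \<longlonglongrightarrow> (\<integral>x. cis (t \<bullet> vec_moments x) \<partial>normal_law B) ^ m"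
    by (simp add: integral_cis_block_moments)
  have YX: "(\<integral>\<omega>. cis (t \<bullet> block_moments m (n div m) (\<lambda>i. Y n i \<omega>)) \<partial>M) = (\<integral>\<omega>. cis (t \<bullet> block_moments m (n div m) (\<lambda>i. X i \<omega>)) \<partial>M)" for n
  proof -
    have "(\<lambda>y. cis (t \<bullet> block_moments m (n div m) y)) \<in> borel_measurable (PiM {..<m * (n div m)} (\<lambda>_. P))"
      using block_moments_meas[of m "n div m"] by (simp add: cis_conv_exp)
    from integral_iid_rows[OF Y this] show ?thesis by (simp only: block_moments_restrict)
  qed
  have "(\<integral>x. cis (t \<bullet> x) \<partial>distr (gauss (mat_ix m)) borel (\<lambda>x. \<Sum>j<m. vec_moments (B *v col_vec x j))) =
    (\<integral>x. cis (\<Sum>j<m. t \<bullet> vec_moments (B *v col_vec x j)) \<partial>gauss (mat_ix m))"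
    by (subst integral_distr[OF H]) (simp_all add: cis_conv_exp inner_sum_right)
  also have "\<dots> = (\<integral>x. cis (t \<bullet> vec_moments x) \<partial>normal_law B) ^ m"
    using cvm m0 by (intro integral_cis_gauss_columns borel_measurable_continuous_onI)
  finally show "(\<lambda>n. \<integral>\<omega>. cis (t \<bullet> block_moments m (n div m) (\<lambda>i. Y n i \<omega>)) \<partial>M) \<longlonglongrightarrow>
      (\<integral>x. cis (t \<bullet> x) \<partial>distr (gauss (mat_ix m)) borel (\<lambda>x. \<Sum>j<m. vec_moments (B *v col_vec x j)))"
    using lim by (simp only: YX)
qed simp

end

section \<open>Random draws\<close>

lemma ordered_draws_finite: "finite (ordered_draws N n)"
proof (rule finite_subset)
  show "ordered_draws N n \<subseteq> {s. set s \<subseteq> {..<n} \<and> length s = N}" by (auto simp: ordered_draws_def)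
qed (simp add: finite_lists_length_eq)

lemma ordered_draws_nonempty: "N \<le> n \<Longrightarrow> ordered_draws N n \<noteq> {}"
proof -
  assume "N \<le> n"
  then have "[0..<N] \<in> ordered_draws N n" by (auto simp: ordered_draws_def)
  then show ?thesis by blast
qed

context iid_sample
begin

lemma AE_draw:
  assumes D: "random_draw_without_replacement M P X N n s" and "N \<le> n"
  shows "AE \<omega> in M. s \<omega> \<in> ordered_draws N n"
proof -
  note O = ordered_draws_finite[of N n] ordered_draws_nonempty[OF \<open>N \<le> n\<close>]
  have s: "s \<in> measurable M (count_space UNIV)"
    "distr M (count_space UNIV) s = measure_pmf (pmf_of_set (ordered_draws N n))"
    using D by (auto simp: random_draw_without_replacement_def)
  have "AE x in measure_pmf (pmf_of_set (ordered_draws N n)). x \<in> ordered_draws N n"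
    using O by (simp add: AE_measure_pmf_iff)
  then show ?thesis unfolding s(2)[symmetric] using s(1) by (subst (asm) AE_distr_iff) auto
qed

text \<open>Split the event by the outcome t of the draw. By independence each piece factorizes, and
  for fixed t the selection is injective, so it has the product law whatever t is. The weights of
  the outcomes sum to 1.\<close>

lemma distr_draw:
  assumes D: "random_draw_without_replacement M P X N n s" and Nn: "N \<le> n"
  shows "distr M (PiM {..<N} (\<lambda>_. P)) (\<lambda>\<omega>. \<lambda>i\<in>{..<N}. X (s \<omega> ! i) \<omega>) = PiM {..<N} (\<lambda>_. P)" (is "?D = ?Q")
proof (rule measure_eqI)
  note O = ordered_draws_finite[of N n] ordered_draws_nonempty[OF Nn]
  let ?O = "ordered_draws N n"
  interpret Q: prob_space ?Q by (intro prob_space_PiM prob_space_P)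
  have s[measurable]: "s \<in> measurable M (count_space UNIV)"
    and ind: "indep_set {(\<lambda>\<omega>. \<lambda>i\<in>{..<n}. X i \<omega>) -` A \<inter> space M | A. A \<in> sets (PiM {..<n} (\<lambda>_. P))}
       {s -` B \<inter> space M | B. B \<in> sets (count_space UNIV)}"
    using D by (auto simp: random_draw_without_replacement_def)
  have W: "(\<lambda>\<omega>. \<lambda>i\<in>{..<N}. X (s \<omega> ! i) \<omega>) \<in> measurable M ?Q"
    by (rule measurable_compose_countable[OF _ s]) (intro measurable_restrict X_meas)
  interpret D: prob_space ?D by (rule prob_space_distr[OF W])
  fix A assume "A \<in> sets ?D"
  then have A: "A \<in> sets ?Q" by simp
  have W': "(\<lambda>\<omega>. \<lambda>i\<in>{..<N}. X (t ! i) \<omega>) \<in> measurable M ?Q" for t by (intro measurable_restrict X_meas)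
  define E where "E t = {\<omega> \<in> space M. s \<omega> = t \<and> (\<lambda>i\<in>{..<N}. X (t ! i) \<omega>) \<in> A}" for t
  have Eeq: "E t = ((\<lambda>\<omega>. \<lambda>i\<in>{..<N}. X (t ! i) \<omega>) -` A \<inter> space M) \<inter> (s -` {t} \<inter> space M)" for t
    by (auto simp: E_def)
  have Em: "E t \<in> events" for t
    unfolding Eeq by (intro sets.Int measurable_sets[OF W' A] measurable_sets[OF s]) simp
  have pE: "prob (E t) = prob (s -` {t} \<inter> space M) * measure ?Q A" if t: "t \<in> ?O" for t
  proof -
    have lt: "length t = N" "distinct t" "set t \<subseteq> {..<n}" using t by (auto simp: ordered_draws_def)
    then have tl: "t ! i < n" if "i < N" for i using nth_mem[of i t] that by blast
    define A' where "A' = (\<lambda>x. \<lambda>i\<in>{..<N}. x (t ! i)) -` A \<inter> space (PiM {..<n} (\<lambda>_. P))"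
    have "(\<lambda>x. \<lambda>i\<in>{..<N}. x (t ! i)) \<in> measurable (PiM {..<n} (\<lambda>_. P)) ?Q"
      using tl by (intro measurable_restrict measurable_component_singleton) auto
    then have A': "A' \<in> sets (PiM {..<n} (\<lambda>_. P))" unfolding A'_def using A by (rule measurable_sets)
    have sp: "(\<lambda>i\<in>{..<n}. X i \<omega>) \<in> space (PiM {..<n} (\<lambda>_. P))" if "\<omega> \<in> space M" for \<omega>
      using that measurable_space[OF X_meas] by (auto simp: space_PiM)
    have "(\<lambda>\<omega>. \<lambda>i\<in>{..<N}. X (t ! i) \<omega>) -` A \<inter> space M = (\<lambda>\<omega>. \<lambda>i\<in>{..<n}. X i \<omega>) -` A' \<inter> space M"
    proof -
      have "(\<lambda>i\<in>{..<N}. (\<lambda>i\<in>{..<n}. X i \<omega>) (t ! i)) = (\<lambda>i\<in>{..<N}. X (t ! i) \<omega>)" for \<omega>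
        using tl by (auto simp: restrict_def)
      then show ?thesis using sp by (auto simp: A'_def)
    qed
    then have "prob (E t) = prob ((\<lambda>\<omega>. \<lambda>i\<in>{..<N}. X (t ! i) \<omega>) -` A \<inter> space M) * prob (s -` {t} \<inter> space M)"
      unfolding Eeq using A' by (intro indep_setD[OF ind]) auto
    also have "prob ((\<lambda>\<omega>. \<lambda>i\<in>{..<N}. X (t ! i) \<omega>) -` A \<inter> space M) = measure ?Q A"
    proof -
      have "inj_on ((!) t) {..<N}" using lt by (auto simp: inj_on_def nth_eq_iff_index_eq)
      from distr_subsample[OF this] measure_distr[OF W' A, of t] show ?thesis by simp
    qed
    finally show ?thesis by simp
  qed
  have tot: "(\<Sum>t\<in>?O. prob (s -` {t} \<inter> space M)) = 1"
  proof -
    have "(\<Sum>t\<in>?O. prob (s -` {t} \<inter> space M)) = prob (\<Union>t\<in>?O. s -` {t} \<inter> space M)"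
      using O by (intro finite_measure_finite_Union[symmetric] measurable_sets[OF s])
        (auto simp: disjoint_family_on_def intro!: measurable_sets[OF s])
    also have "\<dots> = 1"
      using AE_draw[OF D Nn] O
      by (intro prob_eq_1[THEN iffD2] sets.finite_UN measurable_sets[OF s]) (auto elim: AE_mp)
    finally show ?thesis .
  qed
  have "measure ?D A = prob ((\<lambda>\<omega>. \<lambda>i\<in>{..<N}. X (s \<omega> ! i) \<omega>) -` A \<inter> space M)" by (rule measure_distr[OF W A])
  also have "\<dots> = prob (\<Union>t\<in>?O. E t)"
  proof (rule finite_measure_eq_AE)
    show "AE \<omega> in M. (\<omega> \<in> (\<lambda>\<omega>. \<lambda>i\<in>{..<N}. X (s \<omega> ! i) \<omega>) -` A \<inter> space M) = (\<omega> \<in> (\<Union>t\<in>?O. E t))"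
      using AE_draw[OF D Nn] by eventually_elim (auto simp: E_def)
  qed (use O Em in \<open>auto intro!: measurable_sets[OF W A]\<close>)
  also have "\<dots> = (\<Sum>t\<in>?O. prob (E t))"
    using O Em by (intro finite_measure_finite_Union) (auto simp: disjoint_family_on_def E_def)
  also have "\<dots> = measure ?Q A" using tot by (simp add: pE sum_distrib_right[symmetric])
  finally have "measure ?D A = measure ?Q A" .
  then show "emeasure ?D A = emeasure ?Q A" by (simp add: D.emeasure_eq_measure Q.emeasure_eq_measure)
qed simp

text \<open>The quantity is at most the second moment of \<phi> truncated to |\<phi>| > \<delta>
  sqrt n, divided by \<delta>^2; the truncated moment tends to 0 by dominated convergence. With a
  union bound this says that the largest of n terms is o(sqrt n) in probability.\<close>

lemma tail_second_moment_tendsto: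
  assumes "\<delta> > 0"
  shows "(\<lambda>n. real n * P.prob {x \<in> space P. norm (\<phi> x) > \<delta> * sqrt (real n)}) \<longlonglongrightarrow> 0"
proof -
  define f where "f n x = (norm (\<phi> x))\<^sup>2 * indicator {x. norm (\<phi> x) > \<delta> * sqrt (real n)} x" for n x
  have [measurable]: "f n \<in> borel_measurable P" for n unfolding f_def indicator_def by measurable
  have fi: "integrable P (f n)" for n
    by (rule Bochner_Integration.integrable_bound[OF phi_square]) (auto simp: f_def indicator_def)
  have "(\<lambda>n. \<integral>x. f n x \<partial>P) \<longlonglongrightarrow> (\<integral>x. 0 \<partial>P)"
  proof (rule integral_dominated_convergence[OF _ _ phi_square])
    show "AE x in P. (\<lambda>n. f n x) \<longlonglongrightarrow> 0"
    proof (rule AE_I2)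
      fix x
      obtain K :: nat where K: "(norm (\<phi> x) / \<delta>)\<^sup>2 < real K" using reals_Archimedean2 by blast
      have "\<forall>\<^sub>F n in sequentially. f n x = 0"
        using eventually_ge_at_top[of K]
      proof eventually_elim
        case (elim n)
        have "(norm (\<phi> x) / \<delta>)\<^sup>2 \<le> real n" using K elim by linarith
        then have "norm (\<phi> x) / \<delta> \<le> sqrt (real n)" by (rule real_le_rsqrt)
        then have "norm (\<phi> x) \<le> \<delta> * sqrt (real n)" using assms by (simp add: field_simps)
        then show ?case by (simp add: f_def)
      qed
      then show "(\<lambda>n. f n x) \<longlonglongrightarrow> 0" by (rule tendsto_eventually)
    qed
    show "AE x in P. norm (f n x) \<le> (norm (\<phi> x))\<^sup>2" for n by (auto simp: f_def indicator_def)
  qed auto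
  then have "(\<lambda>n. (\<integral>x. f n x \<partial>P) / \<delta>\<^sup>2) \<longlonglongrightarrow> 0" by (intro tendsto_divide_zero) simp
  then show ?thesis
  proof (rule Lim_null_comparison[rotated], intro always_eventually allI)
    fix n
    have "\<delta>\<^sup>2 * real n * P.prob {x \<in> space P. norm (\<phi> x) > \<delta> * sqrt (real n)} =
      (\<integral>x. \<delta>\<^sup>2 * real n * indicator {x \<in> space P. norm (\<phi> x) > \<delta> * sqrt (real n)} x \<partial>P)" by simp
    also have "\<dots> \<le> (\<integral>x. f n x \<partial>P)"
    proof (rule integral_mono[OF _ fi])
      fix x
      have "\<delta>\<^sup>2 * real n \<le> (norm (\<phi> x))\<^sup>2" if "norm (\<phi> x) > \<delta> * sqrt (real n)"
        using power_mono[of "\<delta> * sqrt (real n)" "norm (\<phi> x)" 2] that assms by (simp add: power_mult_distrib)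
      then show "\<delta>\<^sup>2 * real n * indicator {x \<in> space P. norm (\<phi> x) > \<delta> * sqrt (real n)} x \<le> f n x"
        by (auto simp: f_def indicator_def)
    qed (auto simp: less_top[symmetric])
    finally show "norm (real n * P.prob {x \<in> space P. norm (\<phi> x) > \<delta> * sqrt (real n)}) \<le> (\<integral>x. f n x \<partial>P) / \<delta>\<^sup>2"
      using assms by (simp add: field_simps)
  qed
qed

text \<open>At most \<open>m\<close> observations are left out of the draw, and each of them is \<open>o(sqrt n)\<close> uniformly
  because \<open>\<phi>\<close> is square integrable.\<close>

lemma leftover_negligible:
  fixes N :: "nat \<Rightarrow> nat"
  assumes N: "\<And>n. N n \<le> n" "\<And>n. n \<le> N n + m"
    and s: "\<And>n. AE \<omega> in M. s n \<omega> \<in> ordered_draws (N n) n"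
  shows "in_probability_to_zero M (\<lambda>n \<omega>. (1 / sqrt (real n)) *\<^sub>R
    ((\<Sum>i<n. \<phi> (X i \<omega>)) - (\<Sum>i<N n. \<phi> (X (s n \<omega> ! i) \<omega>))))"
  unfolding in_probability_to_zero_def
proof (intro allI impI)
  fix \<epsilon> :: real assume e: "\<epsilon> > 0"
  \<comment> \<open>At most m terms of size \<delta> sqrt n remain, so after division by sqrt n
    their sum is at most m \<delta> \<le> \<epsilon>.\<close>
  define \<delta> where "\<delta> = \<epsilon> / (real m + 1)"
  have d: "\<delta> > 0" "real m * \<delta> \<le> \<epsilon>" using e by (auto simp: \<delta>_def field_simps)
  let ?L = "\<lambda>n \<omega>. (1 / sqrt (real n)) *\<^sub>R ((\<Sum>i<n. \<phi> (X i \<omega>)) - (\<Sum>i<N n. \<phi> (X (s n \<omega> ! i) \<omega>)))"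
  show "(\<lambda>n. prob {\<omega> \<in> space M. norm (?L n \<omega>) > \<epsilon>}) \<longlonglongrightarrow> 0"
  proof (rule Lim_null_comparison[OF _ tail_second_moment_tendsto[OF d(1)]], intro always_eventually allI)
    fix n
    let ?A = "\<lambda>i. {\<omega> \<in> space M. norm (\<phi> (X i \<omega>)) > \<delta> * sqrt (real n)}"
    have bound: "norm (?L n \<omega>) \<le> \<epsilon>"
      if s: "s n \<omega> \<in> ordered_draws (N n) n" and small: "\<And>i. i < n \<Longrightarrow> norm (\<phi> (X i \<omega>)) \<le> \<delta> * sqrt (real n)" for \<omega>
    proof -
      let ?s = "s n \<omega>"
      have sl: "length ?s = N n" "distinct ?s" "set ?s \<subseteq> {..<n}" using s by (auto simp: ordered_draws_def)
      have "(\<Sum>i<N n. \<phi> (X (?s ! i) \<omega>)) = (\<Sum>i\<in>set ?s. \<phi> (X i \<omega>))"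
        using sl by (simp add: sum_list_sum_nth[of "map (\<lambda>i. \<phi> (X i \<omega>)) ?s"] atLeast0LessThan
            sum_list_distinct_conv_sum_set[symmetric])
      then have "(\<Sum>i<n. \<phi> (X i \<omega>)) - (\<Sum>i<N n. \<phi> (X (?s ! i) \<omega>)) = (\<Sum>i\<in>{..<n} - set ?s. \<phi> (X i \<omega>))"
        using sl by (simp add: sum_diff)
      also have "norm \<dots> \<le> (\<Sum>i\<in>{..<n} - set ?s. \<delta> * sqrt (real n))"
        using small by (intro sum_norm_le) auto
      also have "\<dots> = real (n - N n) * (\<delta> * sqrt (real n))"
        using sl by (simp add: card_Diff_subset distinct_card)
      also have "\<dots> \<le> real m * (\<delta> * sqrt (real n))" using N[of n] d by (intro mult_right_mono) auto
      finally have *: "norm ((\<Sum>i<n. \<phi> (X i \<omega>)) - (\<Sum>i<N n. \<phi> (X (?s ! i) \<omega>))) \<le> real m * \<delta> * sqrt (real n)" by simp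
      have "norm (?L n \<omega>) \<le> (1 / sqrt (real n)) * (real m * \<delta> * sqrt (real n))"
        unfolding norm_scaleR by (intro mult_mono *) auto
      also have "\<dots> \<le> real m * \<delta>" using d by (cases "n = 0") auto
      finally show ?thesis using d by simp
    qed
    \<comment> \<open>The omitted indices are random, so the union bound runs over all n
      observations; the factor n is absorbed by the tail estimate.\<close>
    have "prob {\<omega> \<in> space M. norm (?L n \<omega>) > \<epsilon>} \<le> prob (\<Union>i<n. ?A i)"
    proof (rule finite_measure_mono_AE)
      show "AE \<omega> in M. \<omega> \<in> {\<omega> \<in> space M. norm (?L n \<omega>) > \<epsilon>} \<longrightarrow> \<omega> \<in> (\<Union>i<n. ?A i)"
        using s[of n]
      proof eventually_elim
        case (elim \<omega>)
        show ?case
        proof (intro impI, rule ccontr)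
          assume w: "\<omega> \<in> {\<omega> \<in> space M. norm (?L n \<omega>) > \<epsilon>}" "\<omega> \<notin> (\<Union>i<n. ?A i)"
          then have "norm (\<phi> (X i \<omega>)) \<le> \<delta> * sqrt (real n)" if "i < n" for i using that by (auto simp: not_less)
          from bound[OF elim this] w show False by simp
        qed
      qed
    qed measurable
    also have "\<dots> \<le> (\<Sum>i<n. prob (?A i))" by (rule finite_measure_subadditive_finite) auto
    also have "\<dots> = (\<Sum>i<n. P.prob {x \<in> space P. norm (\<phi> x) > \<delta> * sqrt (real n)})"
    proof (rule sum.cong[OF refl])
      fix i
      have "measure (distr M P (X i)) {x \<in> space P. norm (\<phi> x) > \<delta> * sqrt (real n)} =
        prob (X i -` {x \<in> space P. norm (\<phi> x) > \<delta> * sqrt (real n)} \<inter> space M)"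
        by (rule measure_distr) measurable
      also have "X i -` {x \<in> space P. norm (\<phi> x) > \<delta> * sqrt (real n)} \<inter> space M = ?A i"
        using measurable_space[OF X_meas[of i]] by auto
      finally show "prob (?A i) = P.prob {x \<in> space P. norm (\<phi> x) > \<delta> * sqrt (real n)}" by (simp add: ident)
    qed
    finally show "norm (prob {\<omega> \<in> space M. norm (?L n \<omega>) > \<epsilon>}) \<le> real n * P.prob {x \<in> space P. norm (\<phi> x) > \<delta> * sqrt (real n)}"
      by simp
  qed
qed

end

section \<open>The jackknife matrix\<close>

definition kept :: "nat \<Rightarrow> nat \<Rightarrow> nat \<Rightarrow> nat list" where
  "kept m k j = filter (\<lambda>i. i mod m \<noteq> j) [0..<m * k]"

lemma set_kept: "set (kept m k j) \<subseteq> {..<m * k}"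
  by (auto simp: kept_def)

lemma distinct_kept: "distinct (kept m k j)"
  by (simp add: kept_def)

lemma sum_list_kept:
  fixes f :: "nat \<Rightarrow> 'b::comm_monoid_add"
  assumes "j < m"
  shows "(\<Sum>i\<leftarrow>kept m k j. f i) = (\<Sum>i\<in>{..<m} - {j}. \<Sum>l<k. f (l * m + i))"
proof -
  have "(\<Sum>i\<leftarrow>kept m k j. f i) = (\<Sum>i\<in>{i \<in> {..<m * k}. i mod m \<noteq> j}. f i)"
    by (subst sum_list_distinct_conv_sum_set[OF distinct_kept]) (simp add: kept_def atLeast0LessThan)
  also have "\<dots> = (\<Sum>i<m * k. if i mod m \<noteq> j then f i else 0)" by (rule sum.inter_filter) simp
  also have "\<dots> = (\<Sum>i<m. \<Sum>l<k. if i \<noteq> j then f (l * m + i) else 0)"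
    unfolding sum_blocks by (intro sum.cong) auto
  also have "\<dots> = (\<Sum>i<m. if i \<noteq> j then \<Sum>l<k. f (l * m + i) else 0)" by (intro sum.cong) auto
  also have "\<dots> = (\<Sum>i\<in>{i \<in> {..<m}. i \<noteq> j}. \<Sum>l<k. f (l * m + i))" by (rule sum.inter_filter[symmetric]) simp
  also have "{i \<in> {..<m}. i \<noteq> j} = {..<m} - {j}" by auto
  finally show ?thesis .
qed

lemma length_kept: "j < m \<Longrightarrow> length (kept m k j) = (m - 1) * k"
  using sum_list_kept[of j m "\<lambda>_. 1 :: nat" k] by (simp add: sum_list_triv)

lemma nths_upt: "nths [0..<n] A = filter (\<lambda>i. i \<in> A) [0..<n]"
  by (induction n) (auto simp: nths_append)

lemma jackknife_estimate_map:
  "jackknife_estimate est m (map y [0..<m * k]) j = est (map y (kept m k j))"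
  by (simp add: jackknife_estimate_def nths_map nths_upt kept_def)

lemma outer_product_scaleR: "outer_product (c *\<^sub>R v) (c *\<^sub>R v) = c\<^sup>2 *\<^sub>R outer_product v v"
  by (simp add: outer_product_def vec_eq_iff power2_eq_square)

lemma outer_product_add:
  "outer_product (v + w) (v + w) = outer_product v v + outer_product v w + outer_product w v + outer_product w w"
  by (simp add: outer_product_def vec_eq_iff algebra_simps)

lemma scatter_centered:
  fixes g :: "nat \<Rightarrow> real^'d"
  assumes "m > 0"
  shows "(\<Sum>j<m. outer_product ((1 / real m) *\<^sub>R (\<Sum>i<m. g i) - g j) ((1 / real m) *\<^sub>R (\<Sum>i<m. g i) - g j)) =
    (\<Sum>j<m. outer_product (g j) (g j)) - (1 / real m) *\<^sub>R outer_product (\<Sum>i<m. g i) (\<Sum>i<m. g i)"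
proof (subst vec_eq_iff, intro allI, subst vec_eq_iff, intro allI)
  fix a b
  define A where "A = (\<Sum>i<m. g i $ a)"
  define B where "B = (\<Sum>i<m. g i $ b)"
  have "(\<Sum>j<m. (A / real m - g j $ a) * (B / real m - g j $ b)) =
    (\<Sum>j<m. A * B / (real m * real m) - (A / real m) * g j $ b - (B / real m) * g j $ a + g j $ a * g j $ b)"
    by (intro sum.cong) (auto simp: algebra_simps)
  also have "\<dots> = A * B / real m - (A / real m) * B - (B / real m) * A + (\<Sum>j<m. g j $ a * g j $ b)"
    using assms by (simp only: sum.distrib sum_subtractf sum_distrib_left[symmetric] A_def[symmetric] B_def[symmetric]) simp
  also have "\<dots> = (\<Sum>j<m. g j $ a * g j $ b) - A * B / real m" by simp
  finally show "(\<Sum>j<m. outer_product ((1 / real m) *\<^sub>R (\<Sum>i<m. g i) - g j) ((1 / real m) *\<^sub>R (\<Sum>i<m. g i) - g j)) $ a $ b =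
    ((\<Sum>j<m. outer_product (g j) (g j)) - (1 / real m) *\<^sub>R outer_product (\<Sum>i<m. g i) (\<Sum>i<m. g i)) $ a $ b"
    by (simp add: outer_product_def A_def B_def)
qed

lemma sum_omit_index: "j < m \<Longrightarrow> (\<Sum>i\<in>{..<m} - {j}. g i) = (\<Sum>i<m. g i) - g j" for g :: "nat \<Rightarrow> 'b::ab_group_add"
  by (simp add: sum_diff1)

text \<open>A draw is postulated for every n. For n < m its size m * (n div m) is 0, so these draws
  are empty; this avoids carrying n \<ge> m through all limits.\<close>

locale block_jackknife = iid_sample M P X \<phi> for M :: "'a measure" and P :: "'x measure" and X and \<phi> :: "'x \<Rightarrow> real^'d" +
  fixes est :: "'x list \<Rightarrow> real^'d" and \<beta>\<^sub>0 :: "real^'d" and m :: nat and s :: "nat \<Rightarrow> 'a \<Rightarrow> nat list"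
  assumes m: "CARD('d) < m"
    and est: "\<And>n. (\<lambda>x. est (map x [0..<n])) \<in> borel_measurable (PiM {..<n} (\<lambda>_. P))"
    and expansion: "in_probability_to_zero M
          (\<lambda>n \<omega>. sqrt (real n) *\<^sub>R (est (map (\<lambda>i. X i \<omega>) [0..<n]) - \<beta>\<^sub>0)
                - sqrt (real n) *\<^sub>R ((1 / real n) *\<^sub>R (\<Sum>i<n. \<phi> (X i \<omega>))))"
    and draw: "\<And>n. random_draw_without_replacement M P X (m * (n div m)) n (s n)"
begin

lemma m_gt_1: "m > 1" "real m > 1" "m > 0"
proof -
  have "0 < CARD('d)" by simp
  then have "m > 1" using m by linarith
  then show "m > 1" "real m > 1" "m > 0" by auto
qed

text \<open>The error term of the asymptotic expansion as a function of a sample of size r, so that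
  it can be evaluated on any subsample.\<close>

definition remainder :: "nat \<Rightarrow> (nat \<Rightarrow> 'x) \<Rightarrow> real^'d" where
  "remainder r y = sqrt (real r) *\<^sub>R (est (map y [0..<r]) - \<beta>\<^sub>0) - scaled_sum r y"

definition drawn :: "nat \<Rightarrow> nat \<Rightarrow> 'a \<Rightarrow> 'x" where
  "drawn n i \<omega> = X (s n \<omega> ! i) \<omega>"

lemma remainder_meas: "remainder r \<in> borel_measurable (PiM {..<r} (\<lambda>_. P))"
  unfolding remainder_def by (intro borel_measurable_diff borel_measurable_scaleR est scaled_sum_meas) auto

lemma remainder_restrict: "remainder r (\<lambda>i\<in>{..<r}. y i) = remainder r y"
proof -
  have "map (\<lambda>i\<in>{..<r}. y i) [0..<r] = map y [0..<r]" by (intro map_cong) auto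
  then show ?thesis by (simp only: remainder_def scaled_sum_restrict)
qed

lemma remainder_X_meas: "(\<lambda>\<omega>. remainder r (\<lambda>i. X i \<omega>)) \<in> borel_measurable M"
proof -
  have "(\<lambda>\<omega>. remainder r (\<lambda>i\<in>{..<r}. X i \<omega>)) \<in> borel_measurable M"
    by (rule measurable_compose[OF _ remainder_meas]) (intro measurable_restrict X_meas)
  then show ?thesis by (simp only: remainder_restrict)
qed

lemma remainder_negligible: "in_probability_to_zero M (\<lambda>n \<omega>. remainder n (\<lambda>i. X i \<omega>))"
proof -
  have "sqrt (real n) * (1 / real n) = 1 / sqrt (real n)" for n
    by (cases "n = 0") (simp_all add: real_div_sqrt divide_simps)
  then have "sqrt (real n) *\<^sub>R ((1 / real n) *\<^sub>R v) = (1 / sqrt (real n)) *\<^sub>R v" for n and v :: "real^'d"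
    by (simp only: scaleR_scaleR)
  then show ?thesis using expansion by (simp only: remainder_def scaled_sum_def)
qed

lemma iid_rows_drawn: "iid_rows m drawn"
  unfolding iid_rows_def
proof (intro conjI allI)
  show "drawn n i \<in> measurable M P" for n i
  proof -
    have "s n \<in> measurable M (count_space UNIV)" using draw[of n] by (simp add: random_draw_without_replacement_def)
    then show ?thesis unfolding drawn_def[abs_def]
      by (rule measurable_compose_countable[rotated]) (rule X_meas)
  qed
  show "distr M (PiM {..<m * (n div m)} (\<lambda>_. P)) (\<lambda>\<omega>. \<lambda>i\<in>{..<m * (n div m)}. drawn n i \<omega>) = PiM {..<m * (n div m)} (\<lambda>_. P)" for n
    unfolding drawn_def by (rule distr_draw[OF draw]) simp
qed

lemma drawn_meas[measurable]: "drawn n i \<in> measurable M P"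
  using iid_rows_drawn by (simp add: iid_rows_def)

definition jack_remainder :: "nat \<Rightarrow> nat \<Rightarrow> (nat \<Rightarrow> 'x) \<Rightarrow> real^'d" where
  "jack_remainder k j y = remainder ((m - 1) * k) (\<lambda>i. y (kept m k j ! i))"

lemma kept_nth_less: "j < m \<Longrightarrow> i < (m - 1) * k \<Longrightarrow> kept m k j ! i < m * k"
  using subsetD[OF set_kept nth_mem[of i "kept m k j"]] by (simp add: length_kept del: One_nat_def)

lemma jack_remainder_meas:
  assumes "j < m"
  shows "jack_remainder k j \<in> borel_measurable (PiM {..<m * k} (\<lambda>_. P))"
proof -
  have "(\<lambda>y. remainder ((m - 1) * k) (\<lambda>i\<in>{..<(m - 1) * k}. y (kept m k j ! i))) \<in> borel_measurable (PiM {..<m * k} (\<lambda>_. P))"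
    by (rule measurable_compose[OF _ remainder_meas])
       (intro measurable_restrict measurable_component_singleton, simp add: kept_nth_less[OF assms])
  then show ?thesis unfolding jack_remainder_def[abs_def] by (simp only: remainder_restrict)
qed

lemma jack_remainder_restrict:
  assumes "j < m"
  shows "jack_remainder k j (\<lambda>i\<in>{..<m * k}. y i) = jack_remainder k j y"
proof -
  have "jack_remainder k j z = remainder ((m - 1) * k) (\<lambda>i\<in>{..<(m - 1) * k}. z (kept m k j ! i))" for z
    by (simp only: jack_remainder_def remainder_restrict)
  moreover have "(\<lambda>i\<in>{..<(m - 1) * k}. (\<lambda>i\<in>{..<m * k}. y i) (kept m k j ! i)) = (\<lambda>i\<in>{..<(m - 1) * k}. y (kept m k j ! i))"
    by (auto simp: restrict_def kept_nth_less[OF assms])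
  ultimately show ?thesis by simp
qed

lemma jack_remainder_drawn_meas[measurable]:
  assumes "j < m"
  shows "(\<lambda>\<omega>. jack_remainder k j (\<lambda>i. drawn n i \<omega>)) \<in> borel_measurable M"
proof -
  have "(\<lambda>\<omega>. jack_remainder k j (\<lambda>i\<in>{..<m * k}. drawn n i \<omega>)) \<in> borel_measurable M"
    by (rule measurable_compose[OF _ jack_remainder_meas[OF assms]]) (intro measurable_restrict drawn_meas)
  then show ?thesis by (simp only: jack_remainder_restrict[OF assms])
qed

text \<open>The law of the error term on an i.i.d. sample depends on its size only. The positions
  kept after omitting block j select (m - 1) k observations injectively, and this size tends to
  infinity because m > 1; the result then passes to the drawn array.\<close>

lemma jack_remainder_negligible:
  assumes j: "j < m"
  shows "in_probability_to_zero M (\<lambda>n \<omega>. jack_remainder (n div m) j (\<lambda>i. drawn n i \<omega>))"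
proof -
  have eq: "prob {\<omega> \<in> space M. norm (jack_remainder k j (\<lambda>i. X i \<omega>)) > e} =
      prob {\<omega> \<in> space M. norm (remainder ((m - 1) * k) (\<lambda>i. X i \<omega>)) > e}" for k e
  proof -
    have "inj_on ((!) (kept m k j)) {..<(m - 1) * k}"
      using distinct_kept[of m k j] length_kept[OF j, of k] by (auto simp: inj_on_def nth_eq_iff_index_eq)
    moreover have "(\<lambda>y. norm (remainder ((m - 1) * k) y)) \<in> borel_measurable (PiM {..<(m - 1) * k} (\<lambda>_. P))"
      using remainder_meas by simp
    ultimately show ?thesis
      using prob_subsample[of "(!) (kept m k j)" "(m - 1) * k" "\<lambda>y. norm (remainder ((m - 1) * k) y)" e]
        prob_subsample[of "\<lambda>i. i" "(m - 1) * k" "\<lambda>y. norm (remainder ((m - 1) * k) y)" e]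
      by (simp only: remainder_restrict jack_remainder_def inj_on_id2)
  qed
  have "filterlim (\<lambda>n. (m - 1) * (n div m)) at_top sequentially"
  proof (rule filterlim_at_top_mono[OF filterlim_div_at_top[OF m_gt_1(3)]], intro always_eventually allI)
    have "1 \<le> m - 1" using m_gt_1(1) by arith
    then show "n div m \<le> (m - 1) * (n div m)" for n using mult_le_mono1[of 1 "m - 1" "n div m"] by (simp only: mult_1)
  qed
  from in_probability_to_zero_subseq[OF remainder_negligible this]
  have "in_probability_to_zero M (\<lambda>n \<omega>. jack_remainder (n div m) j (\<lambda>i. X i \<omega>))"
    by (simp add: in_probability_to_zero_def eq)
  then have "in_probability_to_zero M (\<lambda>n \<omega>. jack_remainder (n div m) j (\<lambda>i\<in>{..<m * (n div m)}. X i \<omega>))"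
    by (simp only: jack_remainder_restrict[OF j])
  from in_probability_iid_rows[OF iid_rows_drawn jack_remainder_meas[OF j] this]
  show ?thesis by (simp only: jack_remainder_restrict[OF j])
qed

text \<open>The sum over the sample without block j is the total minus that block. The factor 1 /
  sqrt (m - 1) converts the normalization sqrt k of a block sum to sqrt ((m - 1) k).\<close>

lemma scaled_sum_kept:
  assumes j: "j < m"
  shows "scaled_sum ((m - 1) * k) (\<lambda>i. y (kept m k j ! i)) =
    (1 / sqrt (real m - 1)) *\<^sub>R ((\<Sum>i<m. block_sum m k i y) - block_sum m k j y)"
proof -
  have r: "real (m - 1) = real m - 1" using m_gt_1 by (simp add: of_nat_diff)
  have "(\<Sum>i<(m - 1) * k. \<phi> (y (kept m k j ! i))) = (\<Sum>i\<leftarrow>kept m k j. \<phi> (y i))"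
    by (simp add: sum_list_sum_nth length_kept[OF j] atLeast0LessThan)
  also have "\<dots> = (\<Sum>i\<in>{..<m} - {j}. \<Sum>l<k. \<phi> (y (l * m + i)))" by (rule sum_list_kept[OF j])
  finally have "scaled_sum ((m - 1) * k) (\<lambda>i. y (kept m k j ! i)) =
    (1 / sqrt (real m - 1)) *\<^sub>R (\<Sum>i\<in>{..<m} - {j}. block_sum m k i y)"
    by (simp add: scaled_sum_def block_sum_def real_sqrt_mult r scaleR_sum_right[symmetric] del: One_nat_def)
  then show ?thesis by (simp only: sum_omit_index[OF j])
qed

text \<open>This is the deviation of the sum in \<open>scaled_sum_kept\<close> from its average over
  j. The total cancels, and block j enters with a negative sign because it is the one left
  out.\<close>

definition centered_block :: "nat \<Rightarrow> nat \<Rightarrow> (nat \<Rightarrow> 'x) \<Rightarrow> real^'d" where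
  "centered_block k j y = (1 / sqrt (real m - 1)) *\<^sub>R ((1 / real m) *\<^sub>R (\<Sum>i<m. block_sum m k i y) - block_sum m k j y)"

definition centered_remainder :: "nat \<Rightarrow> nat \<Rightarrow> (nat \<Rightarrow> 'x) \<Rightarrow> real^'d" where
  "centered_remainder k j y = jack_remainder k j y - (1 / real m) *\<^sub>R (\<Sum>i<m. jack_remainder k i y)"

text \<open>The factor (m - 1) k in the jackknife matrix is the sample size behind each leave-out
  estimate. Moving its square root into each deviation gives normalized errors, to which the
  expansion applies; \<beta>_0 cancels in the deviations from the mean.\<close>

lemma jackknife_matrix_decomposition:
  "jackknife_matrix est m k (map y [0..<m * k]) =
    (\<Sum>j<m. outer_product (centered_block k j y + centered_remainder k j y) (centered_block k j y + centered_remainder k j y))"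
proof -
  define e where "e j = est (map y (kept m k j))" for j
  let ?r = "(real m - 1) * real k"
  have r: "real ((m - 1) * k) = ?r" "?r \<ge> 0" using m_gt_1 by (auto simp: of_nat_diff)
  have dev: "sqrt ?r *\<^sub>R (e j - (1 / real m) *\<^sub>R (\<Sum>i<m. e i)) = centered_block k j y + centered_remainder k j y"
    if j: "j < m" for j
  proof -
    define c where "c = 1 / sqrt (real m - 1)"
    define G where "G i = block_sum m k i y" for i
    have D: "sqrt ?r *\<^sub>R (e i - \<beta>\<^sub>0) = jack_remainder k i y + c *\<^sub>R ((\<Sum>i<m. G i) - G i)" if i: "i < m" for i
    proof -
      have "map (\<lambda>l. y (kept m k i ! l)) [0..<(m - 1) * k] = map y (kept m k i)"
        by (rule nth_equalityI) (simp_all add: length_kept[OF i])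
      then have "jack_remainder k i y = sqrt ?r *\<^sub>R (e i - \<beta>\<^sub>0) - scaled_sum ((m - 1) * k) (\<lambda>l. y (kept m k i ! l))"
        by (simp only: jack_remainder_def remainder_def r e_def)
      then show ?thesis unfolding scaled_sum_kept[OF i] c_def G_def by simp
    qed
    have mm: "(1 / real m) *\<^sub>R (\<Sum>i<m. v) = v" for v :: "real^'d" using m_gt_1 by (simp add: sum_constant_scaleR del: sum_constant)
    have "sqrt ?r *\<^sub>R (e j - (1 / real m) *\<^sub>R (\<Sum>i<m. e i)) =
      sqrt ?r *\<^sub>R (e j - \<beta>\<^sub>0) - (1 / real m) *\<^sub>R (\<Sum>i<m. sqrt ?r *\<^sub>R (e i - \<beta>\<^sub>0))"
    proof -
      have "(1 / real m) *\<^sub>R (\<Sum>i<m. sqrt ?r *\<^sub>R (e i - \<beta>\<^sub>0)) = sqrt ?r *\<^sub>R ((1 / real m) *\<^sub>R (\<Sum>i<m. e i)) - sqrt ?r *\<^sub>R \<beta>\<^sub>0"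
        by (simp only: scaleR_right_diff_distrib sum_subtractf mm) (simp add: scaleR_sum_right[symmetric])
      then show ?thesis by (simp add: scaleR_right_diff_distrib)
    qed
    also have "\<dots> = jack_remainder k j y + c *\<^sub>R ((\<Sum>i<m. G i) - G j)
        - (1 / real m) *\<^sub>R (\<Sum>i<m. jack_remainder k i y + c *\<^sub>R ((\<Sum>i<m. G i) - G i))"
      using D j by simp
    also have "(1 / real m) *\<^sub>R (\<Sum>i<m. jack_remainder k i y + c *\<^sub>R ((\<Sum>i<m. G i) - G i)) =
        (1 / real m) *\<^sub>R (\<Sum>i<m. jack_remainder k i y) + c *\<^sub>R ((\<Sum>i<m. G i) - (1 / real m) *\<^sub>R (\<Sum>i<m. G i))"
    proof -
      have "(1 / real m) *\<^sub>R (\<Sum>i<m. c *\<^sub>R ((\<Sum>i<m. G i) - G i)) = c *\<^sub>R ((1 / real m) *\<^sub>R (\<Sum>i<m. (\<Sum>i<m. G i) - G i))"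
        by (simp add: scaleR_sum_right[symmetric] mult.commute)
      also have "(1 / real m) *\<^sub>R (\<Sum>i<m. (\<Sum>i<m. G i) - G i) = (\<Sum>i<m. G i) - (1 / real m) *\<^sub>R (\<Sum>i<m. G i)"
        by (simp only: sum_subtractf scaleR_right_diff_distrib mm)
      finally show ?thesis by (simp only: sum.distrib scaleR_right_distrib)
    qed
    finally show ?thesis
      by (simp add: centered_block_def centered_remainder_def c_def G_def scaleR_right_diff_distrib)
  qed
  have "jackknife_matrix est m k (map y [0..<m * k]) =
    (\<Sum>j<m. ?r *\<^sub>R outer_product (e j - (1 / real m) *\<^sub>R (\<Sum>i<m. e i)) (e j - (1 / real m) *\<^sub>R (\<Sum>i<m. e i)))"
    by (simp add: jackknife_matrix_def jackknife_mean_def jackknife_estimate_map e_def scaleR_sum_right)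
  also have "\<dots> = (\<Sum>j<m. outer_product (sqrt ?r *\<^sub>R (e j - (1 / real m) *\<^sub>R (\<Sum>i<m. e i))) (sqrt ?r *\<^sub>R (e j - (1 / real m) *\<^sub>R (\<Sum>i<m. e i))))"
    using r(2) by (simp only: outer_product_scaleR real_sqrt_pow2)
  finally show ?thesis using dev by simp
qed

lemma fst_block_moments: "fst (block_moments m k y) = (\<Sum>j<m. block_sum m k j y)"
  by (simp add: block_moments_def fst_sum vec_moments_def)

lemma mean_scatter_block_moments:
  "fst (mean_scatter m (block_moments m k y)) = scaled_sum (m * k) y"
  "snd (mean_scatter m (block_moments m k y)) = (\<Sum>j<m. outer_product (centered_block k j y) (centered_block k j y))"
proof -
  show "fst (mean_scatter m (block_moments m k y)) = scaled_sum (m * k) y"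
    unfolding mean_scatter_def fst_conv fst_block_moments
    by (simp add: scaled_sum_def block_sum_def sum_blocks real_sqrt_mult scaleR_sum_right[symmetric])
  have p: "(1 / sqrt (real m - 1))\<^sup>2 = 1 / (real m - 1)" using m_gt_1 by (simp add: power_divide)
  have "snd (block_moments m k y) = (\<Sum>j<m. outer_product (block_sum m k j y) (block_sum m k j y))"
    by (simp add: block_moments_def snd_sum vec_moments_def)
  then show "snd (mean_scatter m (block_moments m k y)) = (\<Sum>j<m. outer_product (centered_block k j y) (centered_block k j y))"
    unfolding mean_scatter_def snd_conv fst_block_moments centered_block_def outer_product_scaleR p
    by (simp only: scaleR_sum_right[symmetric] scatter_centered[OF m_gt_1(3)])
qed

end

text \<open>The drawn size differs from n by n mod m < m. The ratio enters because the drawn sum is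
  normalized by its own size, the estimation error by n.\<close>

lemma sqrt_block_ratio_tendsto:
  assumes "m > 0"
  shows "(\<lambda>n. sqrt (real (m * (n div m))) / sqrt (real n) - 1) \<longlonglongrightarrow> 0"
proof -
  have "(\<lambda>n. real (n mod m) / real n) \<longlonglongrightarrow> 0"
  proof (rule Lim_null_comparison)
    show "(\<lambda>n. real m / real n) \<longlonglongrightarrow> 0" by (rule lim_const_over_n)
    show "\<forall>\<^sub>F n in sequentially. norm (real (n mod m) / real n) \<le> real m / real n"
    proof (intro always_eventually allI)
      fix n
      have "real (n mod m) \<le> real m" using assms by (simp add: less_imp_le)
      then show "norm (real (n mod m) / real n) \<le> real m / real n" by (simp add: divide_right_mono)
    qed
  qed
  then have "(\<lambda>n. sqrt (1 - real (n mod m) / real n) - 1) \<longlonglongrightarrow> sqrt (1 - 0) - 1"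
    by (intro tendsto_intros)
  then have "(\<lambda>n. sqrt (1 - real (n mod m) / real n) - 1) \<longlonglongrightarrow> 0" by simp
  then show ?thesis
  proof (rule Lim_transform_eventually)
    show "\<forall>\<^sub>F n in sequentially. sqrt (1 - real (n mod m) / real n) - 1 = sqrt (real (m * (n div m))) / sqrt (real n) - 1"
      using eventually_gt_at_top[of 0]
    proof eventually_elim
      case (elim n)
      have "real n = real (m * (n div m)) + real (n mod m)" by (metis mult_div_mod_eq of_nat_add)
      then have "1 - real (n mod m) / real n = real (m * (n div m)) / real n" using elim by (simp add: field_simps)
      then show ?case by (simp add: real_sqrt_divide)
    qed
  qed
qed

section \<open>Comparison of the statistic with its limit\<close>

context block_jackknife
begin

text \<open>The factor n of the statistic is absorbed into the vector as sqrt n on either side of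
  the form, so that \<open>raw_form\<close> of this pair is the statistic.\<close>

definition stat_pair :: "nat \<Rightarrow> 'a \<Rightarrow> (real^'d) \<times> (real^'d^'d)" where
  "stat_pair n \<omega> = (sqrt (real n) *\<^sub>R (est (map (\<lambda>i. X i \<omega>) [0..<n]) - \<beta>\<^sub>0),
     jackknife_matrix est m (n div m) (map (\<lambda>i. X i \<omega>) (s n \<omega>)))"

definition limit_pair :: "nat \<Rightarrow> 'a \<Rightarrow> (real^'d) \<times> (real^'d^'d)" where
  "limit_pair n \<omega> = mean_scatter m (block_moments m (n div m) (\<lambda>i. drawn n i \<omega>))"

lemma s_meas: "s n \<in> measurable M (count_space UNIV)"
  using draw[of n] by (simp add: random_draw_without_replacement_def)

lemma AE_s: "AE \<omega> in M. s n \<omega> \<in> ordered_draws (m * (n div m)) n"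
  by (rule AE_draw[OF draw]) simp

lemma est_list_meas: "(\<lambda>\<omega>. est (map (\<lambda>i. X i \<omega>) t)) \<in> borel_measurable M"
proof -
  have "(\<lambda>\<omega>. est (map (\<lambda>i\<in>{..<length t}. X (t ! i) \<omega>) [0..<length t])) \<in> borel_measurable M"
    by (rule measurable_compose[OF _ est]) (intro measurable_restrict X_meas)
  moreover have "map (\<lambda>i\<in>{..<length t}. X (t ! i) \<omega>) [0..<length t] = map (\<lambda>i. X i \<omega>) t" for \<omega>
    by (rule nth_equalityI) auto
  ultimately show ?thesis by simp
qed

lemma outer_product_measurable:
  assumes "f \<in> borel_measurable N"
  shows "(\<lambda>x. outer_product (f x) (f x) :: real^'d^'d) \<in> borel_measurable N"
  by (rule measurable_compose[OF assms, of "\<lambda>v. outer_product v v"])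
     (intro borel_measurable_continuous_onI continuous_intros)

lemma stat_pair_meas: "stat_pair n \<in> borel_measurable M"
  unfolding stat_pair_def[abs_def]
proof (rule borel_measurable_Pair)
  show "(\<lambda>\<omega>. sqrt (real n) *\<^sub>R (est (map (\<lambda>i. X i \<omega>) [0..<n]) - \<beta>\<^sub>0)) \<in> borel_measurable M"
    using est_list_meas by (intro borel_measurable_scaleR borel_measurable_diff) auto
  show "(\<lambda>\<omega>. jackknife_matrix est m (n div m) (map (\<lambda>i. X i \<omega>) (s n \<omega>))) \<in> borel_measurable M"
  proof (rule measurable_compose_countable[OF _ s_meas])
    fix t
    have "(\<lambda>\<omega>. jackknife_estimate est m (map (\<lambda>i. X i \<omega>) t) j) \<in> borel_measurable M" for j
      unfolding jackknife_estimate_def nths_map by (rule est_list_meas)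
    then show "(\<lambda>\<omega>. jackknife_matrix est m (n div m) (map (\<lambda>i. X i \<omega>) t)) \<in> borel_measurable M"
      unfolding jackknife_matrix_def jackknife_mean_def
      by (intro borel_measurable_scaleR borel_measurable_sum outer_product_measurable borel_measurable_diff) auto
  qed
qed

lemma limit_pair_meas: "limit_pair n \<in> borel_measurable M"
  unfolding limit_pair_def[abs_def]
  by (rule measurable_compose[OF block_moments_rows_meas[OF iid_rows_drawn] mean_scatter_measurable])

lemma limit_pair_tight: "tight_seq M limit_pair"
  unfolding limit_pair_def[abs_def]
  by (rule tight_seq_continuous_image[OF tight_block_moments[OF iid_rows_drawn] block_moments_rows_meas[OF iid_rows_drawn]
        continuous_on_mean_scatter])

text \<open>Three errors: the expansion on the full sample, the observations that the draw leaves
  out, and the ratio of the normalizations of the drawn and of the full sum. The last one multiplies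
  a tight sequence.\<close>

lemma fst_diff_negligible: "in_probability_to_zero M (\<lambda>n \<omega>. fst (stat_pair n \<omega>) - fst (limit_pair n \<omega>))"
proof -
  define L where "L n \<omega> = (1 / sqrt (real n)) *\<^sub>R ((\<Sum>i<n. \<phi> (X i \<omega>)) - (\<Sum>i<m * (n div m). \<phi> (X (s n \<omega> ! i) \<omega>)))" for n \<omega>
  define c where "c n = sqrt (real (m * (n div m))) / sqrt (real n) - 1" for n
  have eq: "fst (stat_pair n \<omega>) - fst (limit_pair n \<omega>) = remainder n (\<lambda>i. X i \<omega>) + L n \<omega> + c n *\<^sub>R fst (limit_pair n \<omega>)" for n \<omega>
  proof -
    let ?v = "\<Sum>i<m * (n div m). \<phi> (X (s n \<omega> ! i) \<omega>)"
    have f: "fst (limit_pair n \<omega>) = (1 / sqrt (real (m * (n div m)))) *\<^sub>R ?v"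
      by (simp add: limit_pair_def mean_scatter_block_moments scaled_sum_def drawn_def)
    \<comment> \<open>For n < m the drawn sum is empty and both sides are 0, as
      \<open>1 / sqrt 0\<close> is 0.\<close>
    have "(sqrt (real (m * (n div m))) / sqrt (real n)) *\<^sub>R fst (limit_pair n \<omega>) = (1 / sqrt (real n)) *\<^sub>R ?v"
      unfolding f using m_gt_1 by (cases "n div m = 0") auto
    then have "c n *\<^sub>R fst (limit_pair n \<omega>) = (1 / sqrt (real n)) *\<^sub>R ?v - fst (limit_pair n \<omega>)"
      by (simp add: c_def scaleR_left_diff_distrib)
    then show ?thesis
      by (simp add: L_def remainder_def stat_pair_def scaled_sum_def scaleR_right_diff_distrib)
  qed
  have Lm: "L n \<in> borel_measurable M" for n
    using drawn_meas[of n] unfolding L_def[abs_def] drawn_def[symmetric]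
    by (intro borel_measurable_scaleR borel_measurable_diff borel_measurable_sum measurable_compose[OF _ phi_meas] X_meas) auto
  have fm: "(\<lambda>\<omega>. fst (limit_pair n \<omega>)) \<in> borel_measurable M" for n
    by (rule measurable_compose[OF limit_pair_meas fst_snd_borel_measurable(1)])
  have L: "in_probability_to_zero M L"
    unfolding L_def[abs_def]
  proof (rule leftover_negligible[where m=m and N="\<lambda>n. m * (n div m)"])
    show "n \<le> m * (n div m) + m" for n
      using mult_div_mod_eq[of m n] mod_less_divisor[OF m_gt_1(3), of n] by linarith
  qed (auto intro: AE_s)
  have ft: "tight_seq M (\<lambda>n \<omega>. fst (limit_pair n \<omega>))"
    by (rule tight_seq_continuous_image[OF limit_pair_tight limit_pair_meas]) (intro continuous_intros)
  have cl: "c \<longlonglongrightarrow> 0" unfolding c_def[abs_def] by (rule sqrt_block_ratio_tendsto[OF m_gt_1(3)])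
  have "in_probability_to_zero M (\<lambda>n \<omega>. norm (c n) * norm (fst (limit_pair n \<omega>)))"
    by (rule in_probability_to_zero_mult_tight[OF in_probability_to_zero_const[OF cl] ft _ fm]) simp
  then have "in_probability_to_zero M (\<lambda>n \<omega>. c n *\<^sub>R fst (limit_pair n \<omega>))"
    by (simp add: in_probability_to_zero_def)
  then show ?thesis unfolding eq
    by (intro in_probability_to_zero_add L remainder_negligible remainder_X_meas Lm borel_measurable_add
        borel_measurable_scaleR fm borel_measurable_const)
qed

lemma centered_block_drawn_meas: "j < m \<Longrightarrow> (\<lambda>\<omega>. centered_block k j (\<lambda>i. drawn n i \<omega>)) \<in> borel_measurable M"
  unfolding centered_block_def
  by (intro borel_measurable_scaleR borel_measurable_diff borel_measurable_sum block_sum_rows_meas[OF iid_rows_drawn]) auto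

lemma centered_remainder_drawn_meas: "j < m \<Longrightarrow> (\<lambda>\<omega>. centered_remainder k j (\<lambda>i. drawn n i \<omega>)) \<in> borel_measurable M"
  unfolding centered_remainder_def
  by (intro borel_measurable_scaleR borel_measurable_diff borel_measurable_sum jack_remainder_drawn_meas) auto

lemma centered_block_tight:
  assumes j: "j < m"
  shows "tight_seq M (\<lambda>n \<omega>. centered_block (n div m) j (\<lambda>i. drawn n i \<omega>))"
proof -
  have "centered_block k j y = (1 / sqrt (real m - 1)) *\<^sub>R ((1 / real m) *\<^sub>R (\<Sum>i<m. block_sum m k i y) + (- 1) *\<^sub>R block_sum m k j y)" for k y
    by (simp add: centered_block_def)
  then show ?thesis
    using j by (simp only:)
      (intro tight_seq_scaleR tight_seq_add tight_seq_sum tight_block_sum[OF iid_rows_drawn] borel_measurable_scaleR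
        borel_measurable_add borel_measurable_sum block_sum_rows_meas[OF iid_rows_drawn] borel_measurable_const, auto)
qed

lemma centered_remainder_negligible:
  assumes j: "j < m"
  shows "in_probability_to_zero M (\<lambda>n \<omega>. centered_remainder (n div m) j (\<lambda>i. drawn n i \<omega>))"
proof -
  have "centered_remainder k j y = jack_remainder k j y + (- 1 / real m) *\<^sub>R (\<Sum>i<m. jack_remainder k i y)" for k y
    by (simp add: centered_remainder_def)
  then show ?thesis
    using j by (simp only:)
      (intro in_probability_to_zero_add in_probability_to_zero_scaleR in_probability_to_zero_sum jack_remainder_negligible
        borel_measurable_scaleR borel_measurable_sum jack_remainder_drawn_meas borel_measurable_const, auto)
qed

text \<open>For tight F and negligible R the difference (F + R)(F + R)^T - F F^T consists of cross
  terms and R R^T, all of which are negligible. The underlying decomposition presupposes a draw of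
  the right length, hence the almost sure bound.\<close>

lemma snd_diff_negligible: "in_probability_to_zero M (\<lambda>n \<omega>. snd (stat_pair n \<omega>) - snd (limit_pair n \<omega>))"
proof -
  define F where "F j n \<omega> = centered_block (n div m) j (\<lambda>i. drawn n i \<omega>)" for j n \<omega>
  define R where "R j n \<omega> = centered_remainder (n div m) j (\<lambda>i. drawn n i \<omega>)" for j n \<omega>
  define Z where "Z n \<omega> = (\<Sum>j<m. norm (R j n \<omega>) * norm (F j n \<omega>) + norm (R j n \<omega>) * norm (F j n \<omega>) + norm (R j n \<omega>) * norm (R j n \<omega>))" for n \<omega>
  have Fm[measurable]: "F j n \<in> borel_measurable M" if "j < m" for j n
    unfolding F_def[abs_def] by (rule centered_block_drawn_meas[OF that])
  have Rm[measurable]: "R j n \<in> borel_measurable M" if "j < m" for j n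
    unfolding R_def[abs_def] by (rule centered_remainder_drawn_meas[OF that])
  have R0: "in_probability_to_zero M (R j)" if "j < m" for j
    unfolding R_def[abs_def] by (rule centered_remainder_negligible[OF that])
  have Ft: "tight_seq M (F j)" if "j < m" for j
    unfolding F_def[abs_def] by (rule centered_block_tight[OF that])
  have Z: "in_probability_to_zero M Z"
    unfolding Z_def[abs_def]
    by (intro in_probability_to_zero_sum in_probability_to_zero_add in_probability_to_zero_mult_tight
        R0 Ft in_probability_to_zero_imp_tight[OF R0] borel_measurable_add borel_measurable_times borel_measurable_norm Fm Rm) auto
  have Zm: "Z n \<in> borel_measurable M" for n
    unfolding Z_def[abs_def]
    by (intro borel_measurable_sum borel_measurable_add borel_measurable_times borel_measurable_norm Fm Rm) auto
  show ?thesis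
  proof (rule in_probability_to_zero_AE_le[OF Z Zm])
    fix n
    show "AE \<omega> in M. norm (snd (stat_pair n \<omega>) - snd (limit_pair n \<omega>)) \<le> norm (Z n \<omega>)"
      using AE_s[of n]
    proof eventually_elim
      case (elim \<omega>)
      then have "map (\<lambda>i. X i \<omega>) (s n \<omega>) = map (\<lambda>i. drawn n i \<omega>) [0..<m * (n div m)]"
        by (intro nth_equalityI) (auto simp: ordered_draws_def drawn_def)
      then have "snd (stat_pair n \<omega>) - snd (limit_pair n \<omega>) = (\<Sum>j<m. outer_product (F j n \<omega> + R j n \<omega>) (F j n \<omega> + R j n \<omega>)) - (\<Sum>j<m. outer_product (F j n \<omega>) (F j n \<omega>))"
        by (simp only: stat_pair_def snd_conv jackknife_matrix_decomposition limit_pair_def mean_scatter_block_moments F_def R_def)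
      also have "\<dots> = (\<Sum>j<m. outer_product (F j n \<omega>) (R j n \<omega>) + outer_product (R j n \<omega>) (F j n \<omega>) + outer_product (R j n \<omega>) (R j n \<omega>))"
        by (simp add: outer_product_add sum_subtractf[symmetric] algebra_simps)
      also have "norm \<dots> \<le> Z n \<omega>"
        unfolding Z_def
        by (intro sum_norm_le order_trans[OF norm_triangle_ineq] add_mono) (auto simp: norm_outer_product mult.commute)
      finally show ?case by simp
    qed
  qed
qed

lemma pair_diff_negligible: "in_probability_to_zero M (\<lambda>n \<omega>. stat_pair n \<omega> - limit_pair n \<omega>)"
proof -
  note [measurable] = stat_pair_meas limit_pair_meas fst_snd_borel_measurable
  define W where "W n \<omega> = norm (fst (stat_pair n \<omega>) - fst (limit_pair n \<omega>)) + norm (snd (stat_pair n \<omega>) - snd (limit_pair n \<omega>))" for n \<omega>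
  have m1: "(\<lambda>\<omega>. fst (stat_pair n \<omega>) - fst (limit_pair n \<omega>)) \<in> borel_measurable M"
    "(\<lambda>\<omega>. snd (stat_pair n \<omega>) - snd (limit_pair n \<omega>)) \<in> borel_measurable M" for n
    by (intro borel_measurable_diff measurable_compose[OF stat_pair_meas] measurable_compose[OF limit_pair_meas] fst_snd_borel_measurable)+
  have "in_probability_to_zero M W"
    unfolding W_def[abs_def]
    by (intro in_probability_to_zero_add in_probability_to_zero_norm[THEN iffD2] fst_diff_negligible snd_diff_negligible
        measurable_compose[OF m1(1) borel_measurable_norm] measurable_compose[OF m1(2) borel_measurable_norm])
  moreover have "W n \<in> borel_measurable M" for n
    unfolding W_def[abs_def]
    by (intro borel_measurable_add measurable_compose[OF m1(1) borel_measurable_norm] measurable_compose[OF m1(2) borel_measurable_norm])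
  moreover have "norm (stat_pair n \<omega> - limit_pair n \<omega>) \<le> norm (W n \<omega>)" for n \<omega>
    by (cases "stat_pair n \<omega>"; cases "limit_pair n \<omega>") (simp add: W_def norm_Pair_le)
  ultimately show ?thesis by (rule in_probability_to_zero_le)
qed

text \<open>The discontinuities of \<open>raw_form\<close> lie in the zero set of the determinant,
  which is null under the limit law, so the mapping theorem applies to the pair. It yields the law
  already identified in \<open>mean_scatter_limit_law\<close>.\<close>

theorem stat_weak_conv:
  "weak_conv_m (\<lambda>n. distr M borel (\<lambda>\<omega>. raw_form (stat_pair n \<omega>)))
     (distr (F_distribution CARD('d) (m - CARD('d))) borel
        (\<lambda>f. real CARD('d) * (real m - 1) * f / (real m - real CARD('d))))"
proof -
  obtain B :: "real^'d^'d" where B: "det B \<noteq> 0" "\<And>t. (norm (transpose B *v t))\<^sup>2 = t \<bullet> (Cov *v t)"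
    using Cov_root by metis
  let ?P = "gauss (mat_ix m :: (nat \<times> 'd) set)"
  define H where "H x = (\<Sum>j<m. vec_moments (B *v col_vec x j))" for x :: "nat \<times> 'd \<Rightarrow> real"
  note lim = mean_scatter_limit_law[OF B(1) m, folded H_def]
  define \<nu> where "\<nu> = distr (distr ?P borel H) borel (mean_scatter m)"
  have H: "(\<lambda>x. mean_scatter m (H x)) \<in> borel_measurable ?P"
    by (rule measurable_compose[OF lim(3) mean_scatter_measurable])
  have \<nu>: "\<nu> = distr ?P borel (\<lambda>x. mean_scatter m (H x))"
    unfolding \<nu>_def using distr_distr[OF mean_scatter_measurable lim(3)] by (simp add: o_def)
  have p\<nu>: "prob_space \<nu>" unfolding \<nu> by (rule prob_space.prob_space_distr[OF prob_space_gauss H])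
  have s\<nu>: "sets \<nu> = sets borel" by (simp add: \<nu>)
  have "conv_in_law M limit_pair \<nu>"
    unfolding limit_pair_def[abs_def] \<nu>_def
    by (rule conv_in_law_continuous_image[OF block_moments_conv_in_law[OF iid_rows_drawn m B, folded H_def]])
      (simp_all add: continuous_on_mean_scatter)
  then have conv: "conv_in_law M stat_pair \<nu>"
    by (rule conv_in_law_Slutsky[OF prob_space_axioms p\<nu> s\<nu> limit_pair_meas stat_pair_meas _ limit_pair_tight pair_diff_negligible])
  have detc: "continuous_on UNIV (\<lambda>p :: (real^'d) \<times> (real^'d^'d). det (snd p))"
    by (intro continuous_on_det continuous_on_component continuous_intros)
  have "continuous_on {p :: (real^'d) \<times> (real^'d^'d). det (snd p) \<noteq> 0} raw_form"
  proof -
    have "continuous_on {p :: (real^'d) \<times> (real^'d^'d). det (snd p) \<noteq> 0} (\<lambda>p. inv_form (fst p) (snd p))"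
      by (intro continuous_on_inv_form continuous_intros) auto
    then show ?thesis by (rule continuous_on_eq) (auto simp: raw_form_eq)
  qed
  moreover have "AE p in \<nu>. det (snd p) \<noteq> 0"
    unfolding \<nu> using lim(1) borel_measurable_continuous_onI[OF detc]
    by (subst AE_distr_iff[OF H]) auto
  ultimately have "conv_in_law M (\<lambda>n \<omega>. raw_form (stat_pair n \<omega>)) (distr \<nu> borel raw_form)"
    by (intro conv_in_law_discontinuous_image[OF prob_space_axioms p\<nu> s\<nu> stat_pair_meas conv raw_form_measurable _ detc])
  moreover have "distr \<nu> borel raw_form = distr ?P borel (\<lambda>x. raw_form (mean_scatter m (H x)))"
    unfolding \<nu> by (subst distr_distr[OF raw_form_measurable H]) (simp add: o_def)
  moreover have "prob_space (distr ?P borel (\<lambda>x. raw_form (mean_scatter m (H x))))"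
    by (rule prob_space.prob_space_distr[OF prob_space_gauss measurable_compose[OF H raw_form_measurable]])
  ultimately show ?thesis
    unfolding lim(2)[symmetric]
    by (intro conv_in_law_imp_weak_conv[OF prob_space_axioms] measurable_compose[OF stat_pair_meas raw_form_measurable]) auto
qed

end

text \<open>A constant is independent of everything, and the only list of length 0 is the empty one.
  This supplies the draws for n < m.\<close>

lemma (in iid_sample) empty_draw: "random_draw_without_replacement M P X 0 n (\<lambda>_. [])"
  unfolding random_draw_without_replacement_def
proof (intro conjI)
  have O: "ordered_draws 0 n = {[]}" by (auto simp: ordered_draws_def)
  show "distr M (count_space UNIV) (\<lambda>_. []) = measure_pmf (pmf_of_set (ordered_draws 0 n))"
    by (simp add: O pmf_of_set_singleton return_pmf.rep_eq distr_const)
  have R: "(\<lambda>\<omega>. \<lambda>i\<in>{..<n}. X i \<omega>) \<in> measurable M (PiM {..<n} (\<lambda>_. P))" by (intro measurable_restrict X_meas)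
  show "indep_set {(\<lambda>\<omega>. \<lambda>i\<in>{..<n}. X i \<omega>) -` A \<inter> space M | A. A \<in> sets (PiM {..<n} (\<lambda>_. P))}
     {(\<lambda>_. []) -` B \<inter> space M | B :: nat list set. B \<in> sets (count_space UNIV)}"
  proof (rule indep_setI)
    show "{(\<lambda>\<omega>. \<lambda>i\<in>{..<n}. X i \<omega>) -` A \<inter> space M | A. A \<in> sets (PiM {..<n} (\<lambda>_. P))} \<subseteq> events"
      using measurable_sets[OF R] by auto
    show "{(\<lambda>_. []) -` B \<inter> space M | B :: nat list set. B \<in> sets (count_space UNIV)} \<subseteq> events"
      by (auto simp: vimage_def)
    fix a b assume a: "a \<in> {(\<lambda>\<omega>. \<lambda>i\<in>{..<n}. X i \<omega>) -` A \<inter> space M | A. A \<in> sets (PiM {..<n} (\<lambda>_. P))}"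
      and "b \<in> {(\<lambda>_. []) -` B \<inter> space M | B :: nat list set. B \<in> sets (count_space UNIV)}"
    then obtain B :: "nat list set" where b: "b = (\<lambda>_. []) -` B \<inter> space M" by auto
    have "a \<inter> space M = a" using a by auto
    then show "prob (a \<inter> b) = prob a * prob b"
      unfolding b by (cases "[] \<in> B") (auto simp: prob_space)
  qed
qed simp

theorem lemma5:
  fixes M :: "'a measure" and P :: "'x measure"
    and X :: "nat \<Rightarrow> 'a \<Rightarrow> 'x"
    and est :: "'x list \<Rightarrow> real ^ 'd"
    and \<beta>\<^sub>0 :: "real ^ 'd" and \<phi> :: "'x \<Rightarrow> real ^ 'd"
    and draw :: "nat \<Rightarrow> 'a \<Rightarrow> nat list"
    and \<beta> :: "nat \<Rightarrow> 'a \<Rightarrow> real ^ 'd" and S :: "nat \<Rightarrow> 'a \<Rightarrow> real ^ 'd ^ 'd"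
    and m :: nat
  defines "\<beta> \<equiv> (\<lambda>n \<omega>. est (map (\<lambda>i. X i \<omega>) [0..<n]))"
    and "S \<equiv> (\<lambda>n \<omega>. jackknife_matrix est m (block_size m n) (map (\<lambda>i. X i \<omega>) (draw n \<omega>)))"
  assumes m: "m > CARD('d)"
    and M: "prob_space M"
    and indep: "prob_space.indep_vars M (\<lambda>_. P) X UNIV"
    and ident: "\<And>i. distr M P (X i) = P"
    and est: "\<And>n. (\<lambda>x. est (map x [0..<n])) \<in> borel_measurable (PiM {..<n} (\<lambda>_. P))"
    and phi_meas: "\<phi> \<in> borel_measurable P"
    and phi_square: "integrable P (\<lambda>x. (norm (\<phi> x))\<^sup>2)"
    and phi_mean: "(\<integral>x. \<phi> x \<partial>P) = 0"
    and phi_nonsing: "invertible (\<integral>x. outer_product (\<phi> x) (\<phi> x) \<partial>P)"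
    and expansion: "in_probability_to_zero M
          (\<lambda>n \<omega>. sqrt (real n) *\<^sub>R (\<beta> n \<omega> - \<beta>\<^sub>0)
                - sqrt (real n) *\<^sub>R ((1 / real n) *\<^sub>R (\<Sum>i<n. \<phi> (X i \<omega>))))"
    and draw: "\<And>n. n \<ge> m \<Longrightarrow>
          random_draw_without_replacement M P X (m * block_size m n) n (draw n)"
  shows "weak_conv_m
           (\<lambda>n. distr M borel
              (\<lambda>\<omega>. real n * ((\<beta> n \<omega> - \<beta>\<^sub>0) \<bullet> (matrix_inv (S n \<omega>) *v (\<beta> n \<omega> - \<beta>\<^sub>0)))))
           (distr (F_distribution CARD('d) (m - CARD('d))) borel
              (\<lambda>f. real CARD('d) * (real m - 1) * f / (real m - real CARD('d))))"
proof -
  \<comment> \<open>Draws are given only for n \<ge> m; below that the empty draw meets the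
    requirement of the locale.\<close>
  define s where "s n = (if m \<le> n then draw n else (\<lambda>_. []))" for n
  have m0: "m > 0" using m by simp
  interpret iid_sample M P X \<phi>
    using M indep ident phi_meas phi_square phi_mean phi_nonsing
    by (simp add: iid_sample_def iid_sample_axioms_def)
  interpret block_jackknife M P X \<phi> est \<beta>\<^sub>0 m s
  proof
    show "random_draw_without_replacement M P X (m * (n div m)) n (s n)" for n
      using draw[of n] empty_draw[of n] m0 by (cases "m \<le> n") (auto simp: s_def block_size_eq_div)
  qed (use m est expansion in \<open>auto simp: \<beta>_def\<close>)
  have eq: "real n * ((\<beta> n \<omega> - \<beta>\<^sub>0) \<bullet> (matrix_inv (S n \<omega>) *v (\<beta> n \<omega> - \<beta>\<^sub>0))) = raw_form (stat_pair n \<omega>)"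
    if "m \<le> n" for n \<omega>
    using that m0 unfolding raw_form_def stat_pair_def \<beta>_def S_def s_def
    by (simp add: matrix_vector_mult_scaleR block_size_eq_div)
  \<comment> \<open>The two statistics are known to agree only for n \<ge> m, so weak convergence is
    unfolded to limits of distribution functions, which ignore finitely many n.\<close>
  show ?thesis
    unfolding weak_conv_m_def weak_conv_def
  proof (intro allI impI)
    fix x
    let ?F = "distr (F_distribution CARD('d) (m - CARD('d))) borel
       (\<lambda>f. real CARD('d) * (real m - 1) * f / (real m - real CARD('d)))"
    assume "isCont (cdf ?F) x"
    with stat_weak_conv have "(\<lambda>n. cdf (distr M borel (\<lambda>\<omega>. raw_form (stat_pair n \<omega>))) x) \<longlonglongrightarrow> cdf ?F x"
      by (simp add: weak_conv_m_def weak_conv_def)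
    then show "(\<lambda>n. cdf (distr M borel (\<lambda>\<omega>. real n * ((\<beta> n \<omega> - \<beta>\<^sub>0) \<bullet> (matrix_inv (S n \<omega>) *v (\<beta> n \<omega> - \<beta>\<^sub>0))))) x)
      \<longlonglongrightarrow> cdf ?F x"
    proof (rule Lim_transform_eventually)
      show "\<forall>\<^sub>F n in sequentially. cdf (distr M borel (\<lambda>\<omega>. raw_form (stat_pair n \<omega>))) x =
        cdf (distr M borel (\<lambda>\<omega>. real n * ((\<beta> n \<omega> - \<beta>\<^sub>0) \<bullet> (matrix_inv (S n \<omega>) *v (\<beta> n \<omega> - \<beta>\<^sub>0))))) x"
        using eventually_ge_at_top[of m] by eventually_elim (simp add: eq)
    qed
  qed
qed

end
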